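(* Let $A:L_2(D)\to L_2(\mathbf Y,\nu)$ be the two-dimensional Radon transform on the unit disk $D\subset\mathbf R^2$ (normalized as in the context), and let $(\phi_{j_1j_2})$, $(j_1,j_2)\in\{0,1,\dots\}^2\setminus\{(0,0)\}$, be the real Zernike system given in the context. Let $$\mathcal F=\Big\{\sum_{(j_1,j_2)\ne(0,0)}\theta_{j_1j_2}\phi_{j_1j_2}:\ \sum_{(j_1,j_2)\ne(0,0)}a_{j_1j_2}^2\theta_{j_1j_2}^2\le L^2\Big\},$$ where $L>0$ and, for some $s>0$ and $C_0,C_1>0$, $C_0(j_1+j_2)^s\le a_{j_1j_2}\le C_1(j_1+j_2)^s$ for all $(j_1,j_2)\ne(0,0)$. Consider the Gaussian white noise model. Then, with $d=2$, $$\limsup_{n\to\infty}\ n^{2s/(2s+2d-1)}\sup_{f\in\mathcal F}E_f\|\hat f-f\|_2^2<\infty,$$ where $\hat f$ is the $\delta$-net estimator described in the context with $\delta=n^{-s/(2s+2d-1)}$. Also $$\liminf_{n\to\infty}\ n^{2s/(2s+2d-1)}\inf_{\hat g}\sup_{f\in\mathcal F}E_f\|\hat g-f\|_2^2>0,$$ where the infimum is over all estimators $\hat g$.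
   Context: Radon transform: for $(u,\varphi)\in\mathbf Y=[0,1]\times[0,2\pi]$, $$Af(u,\varphi)=\frac{\pi}{2\sqrt{1-u^2}}\int_{-\sqrt{1-u^2}}^{\sqrt{1-u^2}}f(u\cos\varphi-t\sin\varphi,\ u\sin\varphi+t\cos\varphi)\,dt,$$ and $d\nu(u,\varphi)=2\pi^{-1}\sqrt{1-u^2}\,du\,d\varphi$. Basis (polar coordinates $(r,\theta)$ on $D$, $L_2(D)$ with Lebesgue measure): $\tilde\phi_{jk}(r,\theta)=\pi^{-1/2}(j+k+1)^{1/2}Z_{j+k}^{|j-k|}(r)e^{i(j-k)\theta}$, where $Z_a^b$ is the Zernike (radial) polynomial of degree $a$ and order $b$; $\phi_{jk}=\sqrt2\,\mathrm{Re}(\tilde\phi_{jk})$ if $j>k$, $\phi_{jk}=\tilde\phi_{jk}$ if $j=k$, $\phi_{jk}=\sqrt2\,\mathrm{Im}(\tilde\phi_{jk})$ if $j<k$. These are orthonormal eigenfunctions of $A^*A$, where $A^*$ is the adjoint of $A$ with respect to $L_2(D)$ and $L_2(\mathbf Y,\nu)$. Gaussian white noise model: one observes $dY_n=(Af)\,d\nu+n^{-1/2}dW$ on $\mathbf Y$, where for $h_1,h_2\in L_2(\mathbf Y,\nu)$ the vector $(\int h_1dW,\int h_2dW)$ is centered Gaussian with variances $\|h_1\|_{2,\nu}^2,\|h_2\|_{2,\nu}^2$ and covariance $\int h_1h_2\,d\nu$. For finite linear combinations $g$ of the $\phi_{jk}$, $Qg=(A^{-1})^*g=A(A^*A)^{-1}g$.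 Empirical risk: $\gamma_n(g)=-2\int_{\mathbf Y}(Qg)\,dY_n+\|g\|_2^2$. $\delta$-net estimator: $\hat f=\operatorname{argmin}_{\phi\in\mathcal F_\delta}\gamma_n(\phi)$, where $\mathcal F_\delta$ is a finite $\delta$-net of $\mathcal F$ in $L_2$ (every $f\in\mathcal F$ is within $L_2$ distance $\delta$ of some $\phi\in\mathcal F_\delta$) such that, with constants $K,K'$ not depending on $\delta$, every element of $\mathcal F_\delta$ has basis coefficients $\theta_{j_1j_2}=0$ for $(j_1,j_2)\notin\{0,\dots,M\}^2$ with $M\le K\delta^{-1/s}$, and $\log(\#\mathcal F_\delta)\le K'\delta^{-2/s}$ for all small $\delta$ (such nets exist). *)

theory Defs
  imports "HOL-Probability.Probability"
begin

text \<open>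
  Elements of an \<open>L\<^sub>2\<close> space are represented by functions rather than by almost-everywhere
  classes, so norms below are seminorms on functions, and several representatives of the same
  class may belong to the sets defined below.
\<close>

definition L2 :: "'a measure \<Rightarrow> ('a \<Rightarrow> real) set" where
  "L2 M = {f \<in> borel_measurable M. integrable M (\<lambda>x. (f x)\<^sup>2)}"

definition l2_inner :: "'a measure \<Rightarrow> ('a \<Rightarrow> real) \<Rightarrow> ('a \<Rightarrow> real) \<Rightarrow> real" where
  "l2_inner M f g = (\<integral>x. f x * g x \<partial>M)"

definition l2_norm :: "'a measure \<Rightarrow> ('a \<Rightarrow> real) \<Rightarrow> real" where
  "l2_norm M f = sqrt (l2_inner M f f)"

definition l2_dist :: "'a measure \<Rightarrow> ('a \<Rightarrow> real) \<Rightarrow> ('a \<Rightarrow> real) \<Rightarrow> real" where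
  "l2_dist M f g = l2_norm M (\<lambda>x. f x - g x)"

text \<open>Unconditional convergence in \<open>L\<^sub>2\<close>, in analogy with \<^const>\<open>has_sum\<close>.\<close>

definition l2_has_sum ::
  "'a measure \<Rightarrow> ('i \<Rightarrow> 'a \<Rightarrow> real) \<Rightarrow> 'i set \<Rightarrow> ('a \<Rightarrow> real) \<Rightarrow> bool" where
  "l2_has_sum M g I f \<longleftrightarrow>
     ((\<lambda>S. l2_dist M (\<lambda>x. \<Sum>i\<in>S. g i x) f) \<longlongrightarrow> 0) (finite_subsets_at_top I)"

definition l2_open :: "'a measure \<Rightarrow> ('a \<Rightarrow> real) set \<Rightarrow> bool" where
  "l2_open M U \<longleftrightarrow>
     U \<subseteq> L2 M \<and> (\<forall>f\<in>U. \<exists>e>0. \<forall>g\<in>L2 M. l2_dist M g f < e \<longrightarrow> g \<in> U)"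

definition l2_borel :: "'a measure \<Rightarrow> ('a \<Rightarrow> real) measure" where
  "l2_borel M = sigma (L2 M) {U. l2_open M U}"

definition disk :: "(real \<times> real) measure" where
  "disk = restrict_space lborel (cball 0 1)"

definition nu :: "(real \<times> real) measure" where
  "nu = density (restrict_space lborel ({0..1} \<times> {0..2 * pi}))
          (\<lambda>(u, \<phi>). ennreal (2 / pi * sqrt (1 - u\<^sup>2)))"

text \<open>Where the line integral diverges, and for \<open>u = 1\<close>, the value is \<open>0\<close>; for
  square-integrable \<open>f\<close> this concerns only a null set of \<open>(u, \<phi>)\<close>.\<close>

definition radon :: "(real \<times> real \<Rightarrow> real) \<Rightarrow> real \<times> real \<Rightarrow> real" where
  "radon f = (\<lambda>(u, \<phi>).
     pi / (2 * sqrt (1 - u\<^sup>2)) *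
     (LBINT t:{- sqrt (1 - u\<^sup>2)..sqrt (1 - u\<^sup>2)}.
        f (u * cos \<phi> - t * sin \<phi>, u * sin \<phi> + t * cos \<phi>)))"

text \<open>The graph of the adjoint: \<open>radon_adjoint q p\<close> says \<open>A\<^sup>* q = p\<close> as elements of
  \<open>L\<^sub>2(D)\<close>, which determines \<open>p\<close> almost everywhere.\<close>

definition radon_adjoint ::
  "(real \<times> real \<Rightarrow> real) \<Rightarrow> (real \<times> real \<Rightarrow> real) \<Rightarrow> bool" where
  "radon_adjoint q p \<longleftrightarrow>
     q \<in> L2 nu \<and> p \<in> L2 disk \<and> (\<forall>f\<in>L2 disk. l2_inner nu (radon f) q = l2_inner disk f p)"

text \<open>A representative of \<open>(A\<^sup>* A)\<^sup>-\<^sup>1 g\<close>, meaningful for \<open>g\<close> in the range of \<open>A\<^sup>* A\<close>.\<close>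

definition radon_normal_inv :: "(real \<times> real \<Rightarrow> real) \<Rightarrow> real \<times> real \<Rightarrow> real" where
  "radon_normal_inv g = (SOME h. h \<in> L2 disk \<and> radon_adjoint (radon h) g)"

definition Q_op :: "(real \<times> real \<Rightarrow> real) \<Rightarrow> real \<times> real \<Rightarrow> real" where
  "Q_op g = radon (radon_normal_inv g)"

text \<open>The radial Zernike polynomial of degree \<open>n\<close> and order \<open>m \<le> n\<close>, with \<open>n - m\<close> even,
  normalized to take the value \<open>1\<close> at \<open>r = 1\<close>.\<close>

definition zernike_radial :: "nat \<Rightarrow> nat \<Rightarrow> real \<Rightarrow> real" where
  "zernike_radial n m r =
     (\<Sum>l = 0..(n - m) div 2.
        (- 1) ^ l * fact (n - l) /
        (fact l * fact ((n + m) div 2 - l) * fact ((n - m) div 2 - l)) * r ^ (n - 2 * l))"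

definition zernike_complex :: "nat \<Rightarrow> nat \<Rightarrow> real \<Rightarrow> real \<Rightarrow> complex" where
  "zernike_complex j k r \<theta> =
     complex_of_real (pi powr (- 1 / 2) * real (j + k + 1) powr (1 / 2) *
       zernike_radial (j + k) (nat \<bar>int j - int k\<bar>) r) * cis ((real j - real k) * \<theta>)"

definition zernike :: "nat \<times> nat \<Rightarrow> real \<times> real \<Rightarrow> real" where
  "zernike = (\<lambda>(j, k) (x, y).
     (let z = zernike_complex j k (norm (x, y)) (Arg (Complex x y)) in
      if j > k then sqrt 2 * Re z else if j = k then Re z else sqrt 2 * Im z))"

definition index_set :: "(nat \<times> nat) set" where
  "index_set = UNIV - {(0, 0)}"

definition ellipsoid :: "(nat \<times> nat \<Rightarrow> real) \<Rightarrow> real \<Rightarrow> (real \<times> real \<Rightarrow> real) set" where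
  "ellipsoid a L = {f \<in> L2 disk. \<exists>\<theta>.
     (\<lambda>i. (a i)\<^sup>2 * (\<theta> i)\<^sup>2) summable_on index_set \<and>
     (\<Sum>\<^sub>\<infinity>i\<in>index_set. (a i)\<^sup>2 * (\<theta> i)\<^sup>2) \<le> L\<^sup>2 \<and>
     l2_has_sum disk (\<lambda>i x. \<theta> i * zernike i x) index_set f}"

definition zernike_span :: "nat \<Rightarrow> (real \<times> real \<Rightarrow> real) set" where
  "zernike_span M = {f \<in> L2 disk. \<exists>\<theta>.
     (\<forall>i. i \<notin> {0..M} \<times> {0..M} \<longrightarrow> \<theta> i = 0) \<and>
     l2_has_sum disk (\<lambda>i x. \<theta> i * zernike i x) index_set f}"

definition is_delta_net ::
  "(real \<times> real \<Rightarrow> real) set \<Rightarrow> real \<Rightarrow> (real \<times> real \<Rightarrow> real) set \<Rightarrow> bool" where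
  "is_delta_net F \<delta> N \<longleftrightarrow>
     finite N \<and> N \<subseteq> L2 disk \<and> (\<forall>f\<in>F. \<exists>\<phi>\<in>N. l2_dist disk f \<phi> \<le> \<delta>)"

text \<open>The size restrictions with the constants \<open>K\<close>, \<open>K'\<close> are only required for all
  sufficiently small \<open>\<delta>\<close>; for every \<open>\<delta>\<close> the net consists of finite linear combinations,
  so that \<^const>\<open>Q_op\<close> is defined on it.\<close>

definition net_family ::
  "(real \<times> real \<Rightarrow> real) set \<Rightarrow> real \<Rightarrow> real \<Rightarrow> real \<Rightarrow>
   (real \<Rightarrow> (real \<times> real \<Rightarrow> real) set) \<Rightarrow> bool" where
  "net_family F s K K' N \<longleftrightarrow>
     (\<forall>\<delta>>0. is_delta_net F \<delta> (N \<delta>) \<and> (\<exists>M. N \<delta> \<subseteq> zernike_span M)) \<and>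
     (\<forall>\<^sub>F \<delta> in at_right 0.
        (\<exists>M. real M \<le> K * \<delta> powr (- 1 / s) \<and> N \<delta> \<subseteq> zernike_span M) \<and>
        ln (real (card (N \<delta>))) \<le> K' * \<delta> powr (- 2 / s))"

text \<open>Degenerate (zero variance) normal distributions are included.\<close>

definition normal_rv :: "'w measure \<Rightarrow> ('w \<Rightarrow> real) \<Rightarrow> real \<Rightarrow> real \<Rightarrow> bool" where
  "normal_rv P X m v \<longleftrightarrow>
     X \<in> borel_measurable P \<and>
     (if v = 0 then AE \<omega> in P. X \<omega> = m
      else distributed P lborel X (\<lambda>x. ennreal (normal_density m (sqrt v) x)))"

text \<open>\<open>(X\<^sub>1, X\<^sub>2)\<close> is a Gaussian vector (all linear combinations are normal), centered, with
  variances \<open>v\<^sub>1\<close>, \<open>v\<^sub>2\<close> and covariance \<open>c\<close>.\<close>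

definition centered_gaussian_pair ::
  "'w measure \<Rightarrow> ('w \<Rightarrow> real) \<Rightarrow> ('w \<Rightarrow> real) \<Rightarrow> real \<Rightarrow> real \<Rightarrow> real \<Rightarrow> bool" where
  "centered_gaussian_pair P X1 X2 v1 v2 c \<longleftrightarrow>
     (\<forall>\<alpha> \<beta>. normal_rv P (\<lambda>\<omega>. \<alpha> * X1 \<omega> + \<beta> * X2 \<omega>) 0
        (\<alpha>\<^sup>2 * v1 + 2 * \<alpha> * \<beta> * c + \<beta>\<^sup>2 * v2))"

text \<open>\<open>W h\<close> is the stochastic integral of \<open>h\<close> with respect to the white noise.\<close>

definition white_noise ::
  "'w measure \<Rightarrow> ((real \<times> real \<Rightarrow> real) \<Rightarrow> 'w \<Rightarrow> real) \<Rightarrow> bool" where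
  "white_noise P W \<longleftrightarrow>
     prob_space P \<and>
     (\<forall>h1\<in>L2 nu. \<forall>h2\<in>L2 nu. centered_gaussian_pair P (W h1) (W h2)
        ((l2_norm nu h1)\<^sup>2) ((l2_norm nu h2)\<^sup>2) (l2_inner nu h1 h2))"

text \<open>An observation is the family of the integrals \<open>\<integral>h dY\<^sub>n\<close> over all \<open>h \<in> L\<^sub>2(\<nu>)\<close>.\<close>

definition data_space :: "((real \<times> real \<Rightarrow> real) \<Rightarrow> real) measure" where
  "data_space = (\<Pi>\<^sub>M h\<in>L2 nu. borel)"

definition observation ::
  "((real \<times> real \<Rightarrow> real) \<Rightarrow> 'w \<Rightarrow> real) \<Rightarrow> nat \<Rightarrow> (real \<times> real \<Rightarrow> real) \<Rightarrow> 'w \<Rightarrow>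
   (real \<times> real \<Rightarrow> real) \<Rightarrow> real" where
  "observation W n f \<omega> =
     (\<lambda>h\<in>L2 nu. l2_inner nu h (radon f) + real n powr (- 1 / 2) * W h \<omega>)"

definition estimators ::
  "(((real \<times> real \<Rightarrow> real) \<Rightarrow> real) \<Rightarrow> real \<times> real \<Rightarrow> real) set" where
  "estimators = measurable data_space (l2_borel disk)"

definition risk ::
  "'w measure \<Rightarrow> ((real \<times> real \<Rightarrow> real) \<Rightarrow> 'w \<Rightarrow> real) \<Rightarrow> nat \<Rightarrow>
   (((real \<times> real \<Rightarrow> real) \<Rightarrow> real) \<Rightarrow> real \<times> real \<Rightarrow> real) \<Rightarrow>
   (real \<times> real \<Rightarrow> real) \<Rightarrow> ennreal" where
  "risk P W n g f = (\<integral>\<^sup>+ \<omega>. ennreal ((l2_dist disk (g (observation W n f \<omega>)) f)\<^sup>2) \<partial>P)"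

definition empirical_risk ::
  "((real \<times> real \<Rightarrow> real) \<Rightarrow> real) \<Rightarrow> (real \<times> real \<Rightarrow> real) \<Rightarrow> real" where
  "empirical_risk y g = - 2 * y (Q_op g) + (l2_norm disk g)\<^sup>2"

text \<open>A measurable minimizer of the empirical risk over the net \<open>N\<close>; ties may be broken
  arbitrarily.\<close>

definition is_net_estimator ::
  "(real \<times> real \<Rightarrow> real) set \<Rightarrow>
   (((real \<times> real \<Rightarrow> real) \<Rightarrow> real) \<Rightarrow> real \<times> real \<Rightarrow> real) \<Rightarrow> bool" where
  "is_net_estimator N g \<longleftrightarrow>
     g \<in> estimators \<and>
     (\<forall>y\<in>space data_space. is_arg_min (empirical_risk y) (\<lambda>\<phi>. \<phi> \<in> N) (g y))"

end

theory Submission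
  imports Defs
begin

text \<open>
  Write \<open>m = j + k\<close>, \<open>l = j - k\<close>, and let \<open>U\<^sub>m\<close> be the Chebyshev polynomial of the second kind. Up to a
  constant, the Zernike function of index \<open>(j, k)\<close> at \<open>x\<close> is the average of
  \<open>U\<^sub>m (x \<bullet> e\<^sub>t)\<close> over the directions \<open>e\<^sub>t = (cos t, sin t)\<close> against the trigonometric function of frequency \<open>l\<close>.
  The identity \<open>\<integral> U\<^sub>m (u cos \<alpha> + t sin \<alpha>) dt = 2 \<surd>(1 - u\<^sup>2) U\<^sub>m(u) U\<^sub>m(cos \<alpha>) / (m + 1)\<close> along a chord then
  shows that the Zernike functions are orthonormal eigenfunctions of \<open>A\<^sup>* A\<close> with eigenvalues \<open>\<pi>\<^sup>2 / (m + 1)\<close>.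

  Upper bound: the empirical risk of \<open>\<phi>\<close> is the loss of \<open>\<phi>\<close>, up to a constant, minus a Gaussian variable whose
  increments have variance of order \<open>M \<parallel>\<phi> - \<phi>\<^sub>0\<parallel>\<^sup>2 / n\<close>. A maximal inequality over the net bounds the risk by a
  multiple of \<open>\<delta>\<^sup>2 + M (1 + log #F\<^sub>\<delta>) / n\<close>, which is of order \<open>\<delta>\<^sup>2\<close>.

  Lower bound: Assouad's argument with the functions \<open>\<epsilon> \<Sum>\<^sub>i\<^sub>\<in>\<^sub>S \<phi>\<^sub>i\<close>, \<open>S \<subseteq> {m..<2m}\<^sup>2\<close>, where \<open>m\<close> is of order
  \<open>n\<^bsup>1/(2s+3)\<^esup>\<close> and \<open>\<epsilon>\<^sup>2\<close> of order \<open>m\<^bsup>-2s-2\<^esup>\<close>. Toggling one index shifts the observation in the direction of one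
  singular function; splitting the white noise into its component in that direction and an independent
  remainder reduces each comparison to a shift of a standard normal variable.
\<close>

section \<open>Chebyshev polynomials and trigonometric integrals\<close>

text \<open>The exponents come from balancing. With \<delta> = x^(-s) the net has degree bound
  \<open>M\<close> of order x and log-cardinality of order x^2, so the product M * log / n is of
  order \<delta>^2 = x^(-2s) when n = x^(2s+3). In the lower bound a change of size \<epsilon> in
  one coefficient moves the observation by \<epsilon> times a singular value of order m^(-1/2).
  Indistinguishability asks for \<epsilon>^2 of order m / n, the ellipsoid for \<epsilon>^2 of order
  m^(-2s-2); both agree when m^(2s+3) is of order n.

  Two features of the setting shape the details. The strip carries only u in [0, 1], half of the
  natural domain of the singular functions; the gap is closed by parity under (u, \<phi>) -> (-u,
  \<phi> + pi), two names of the same line. And functions stand for classes, with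
  \<open>Q_op\<close> resting on a choice by \<open>SOME\<close>, so net elements and their images
  under \<open>Q_op\<close> are compared only through inner products and the adjoint relation.

  Orthonormality on the disk is transported from the strip, where the variables separate.\<close>

fun cheb_U :: "nat \<Rightarrow> real \<Rightarrow> real" where
  "cheb_U 0 x = 1"
| "cheb_U (Suc 0) x = 2 * x"
| "cheb_U (Suc (Suc n)) x = 2 * x * cheb_U (Suc n) x - cheb_U n x"

text \<open>The polynomials of the first kind serve as antiderivatives of those of the second kind
  when a ridge function is integrated along a chord.\<close>

fun cheb_T :: "nat \<Rightarrow> real \<Rightarrow> real" where
  "cheb_T 0 x = 1"
| "cheb_T (Suc 0) x = x"
| "cheb_T (Suc (Suc n)) x = 2 * x * cheb_T (Suc n) x - cheb_T n x"

text \<open>The recurrence is the addition theorem for the sine. The product form avoids division by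
  \<open>sin a\<close>, so it holds at every angle.\<close>

lemma cheb_U_sin: "sin a * cheb_U n (cos a) = sin (real (n + 1) * a)"
proof (induction n "cos a" rule: cheb_U.induct)
  case 1
  then show ?case by simp
next
  case 2
  then show ?case by (simp add: sin_double)
next
  case (3 n)
  have "sin a * cheb_U (Suc (Suc n)) (cos a) =
      2 * cos a * (sin a * cheb_U (Suc n) (cos a)) - sin a * cheb_U n (cos a)"
    by (simp add: algebra_simps)
  also have "\<dots> = 2 * cos a * sin (real (n + 2) * a) - sin (real (n + 1) * a)"
    using 3 by simp
  also have "sin (real (n + 1) * a) = sin (real (n + 2) * a) * cos a - cos (real (n + 2) * a) * sin a"
    by (subst sin_diff[symmetric]) (simp add: algebra_simps)
  also have "2 * cos a * sin (real (n + 2) * a) -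
      (sin (real (n + 2) * a) * cos a - cos (real (n + 2) * a) * sin a) = sin (real (n + 2) * a + a)"
    by (subst sin_add) (simp add: algebra_simps)
  finally show ?case by (simp add: algebra_simps)
qed

lemma cheb_T_cos: "cheb_T n (cos a) = cos (real n * a)"
proof (induction n "cos a" rule: cheb_T.induct)
  case (3 n)
  define b where "b = real (n + 1) * a"
  have "cos (real n * a) = cos (b - a)" "cos (real (Suc (Suc n)) * a) = cos (b + a)"
    by (simp_all add: b_def algebra_simps)
  then have "cos (real (Suc (Suc n)) * a) = 2 * cos a * cos b - cos (real n * a)"
    by (simp add: cos_add cos_diff)
  then show ?case using 3 by (simp add: b_def)
qed simp_all

lemma cheb_U_minus: "cheb_U n (- x) = (- 1) ^ n * cheb_U n x"
  by (induction n x rule: cheb_U.induct) (simp_all add: algebra_simps)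

lemma cheb_U_1: "cheb_U n 1 = real n + 1"
  by (induction n "1 :: real" rule: cheb_U.induct) simp_all

lemma continuous_on_cheb_U [continuous_intros]:
  "continuous_on A (f :: 'a :: t2_space \<Rightarrow> real) \<Longrightarrow> continuous_on A (\<lambda>x. cheb_U n (f x))"
  by (induction n "0 :: real" rule: cheb_U.induct) (auto intro!: continuous_intros)

lemma cheb_U_measurable [measurable]:
  "f \<in> borel_measurable M \<Longrightarrow> (\<lambda>x. cheb_U n (f x)) \<in> borel_measurable M"
  by (induction n "0 :: real" rule: cheb_U.induct) auto

text \<open>Closes the induction for the derivative of \<open>cheb_T\<close>: differentiating the
  recurrence leaves a term in \<open>cheb_T\<close>, which this turns back into
  \<open>cheb_U\<close>.\<close>

lemma cheb_T_eq: "cheb_T (Suc n) x = cheb_U (Suc n) x - x * cheb_U n x"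
proof (induction n x rule: cheb_U.induct)
  case (3 n x)
  have "cheb_T (Suc (Suc (Suc n))) x =
      2 * x * (cheb_U (Suc (Suc n)) x - x * cheb_U (Suc n) x) - (cheb_U (Suc n) x - x * cheb_U n x)"
    using 3 by (simp only: cheb_T.simps(3))
  also have "\<dots> = 2 * x * cheb_U (Suc (Suc n)) x - cheb_U (Suc n) x
      - x * (2 * x * cheb_U (Suc n) x - cheb_U n x)"
    by (simp add: algebra_simps del: cheb_U.simps)
  finally show ?case by (simp only: cheb_U.simps(3))
qed (simp_all add: algebra_simps)

lemma DERIV_cheb_T:
  "(cheb_T (Suc n) has_real_derivative (real n + 1) * cheb_U n x) (at x)"
proof (induction n rule: less_induct)
  case (less n)
  consider "n = 0" | "n = 1" | k where "n = Suc (Suc k)"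
    by (metis One_nat_def not0_implies_Suc)
  then show ?case
  proof cases
    case 1
    then show ?thesis by (auto intro!: derivative_eq_intros)
  next
    case 2
    have "((\<lambda>x. 2 * x * x - 1) has_real_derivative (1 + 1) * (2 * x)) (at x)"
      by (auto intro!: derivative_eq_intros)
    then show ?thesis using 2 by (simp add: fun_eq_iff)
  next
    case 3
    have "((\<lambda>x. 2 * x * cheb_T (Suc (Suc k)) x - cheb_T (Suc k) x) has_real_derivative
       2 * cheb_T (Suc (Suc k)) x + 2 * x * ((real (Suc k) + 1) * cheb_U (Suc k) x)
         - (real k + 1) * cheb_U k x) (at x)"
      using less[of "Suc k"] less[of k] 3
      by (auto intro!: derivative_eq_intros simp del: cheb_T.simps(3))
    moreover have "2 * cheb_T (Suc (Suc k)) x + 2 * x * ((real (Suc k) + 1) * cheb_U (Suc k) x)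
         - (real k + 1) * cheb_U k x = (real n + 1) * cheb_U n x"
      unfolding cheb_T_eq 3 by (simp add: algebra_simps)
    ultimately show ?thesis using 3 by simp
  qed
qed

text \<open>The real form of the geometric sum behind sin((n+1)a) / sin a. It exhibits the
  frequencies n, n-2, ..., -n and gives the bound n + 1 on [-1, 1].\<close>

lemma cheb_U_cos_sum: "cheb_U n (cos a) = (\<Sum>k\<le>n. cos ((real n - 2 * real k) * a))"
proof (induction n "cos a" rule: cheb_U.induct)
  case (3 n)
  let ?c = "\<lambda>q::real. cos (q * a)"
  have prod: "2 * cos a * ?c q = ?c (q + 1) + ?c (q - 1)" for q
    by (simp add: ring_distribs cos_add cos_diff)
  have A: "2 * cos a * (\<Sum>k\<le>Suc n. ?c (real (Suc n) - 2 * real k)) =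
      (\<Sum>k\<le>Suc n. ?c (real n + 2 - 2 * real k)) + (\<Sum>k\<le>Suc n. ?c (real n - 2 * real k))"
    by (simp only: sum_distrib_left sum.distrib[symmetric] prod) (simp add: algebra_simps)
  have B: "?c (real n - 2 * real (Suc n)) = ?c (real n + 2 - 2 * real (Suc (Suc n)))"
    by (rule arg_cong[of _ _ ?c]) simp
  have "cheb_U (Suc (Suc n)) (cos a) =
    2 * cos a * (\<Sum>k\<le>Suc n. ?c (real (Suc n) - 2 * real k)) - (\<Sum>k\<le>n. ?c (real n - 2 * real k))"
    using 3 by simp
  also have "\<dots> = (\<Sum>k\<le>Suc n. ?c (real n + 2 - 2 * real k)) + ?c (real n - 2 * real (Suc n))"
    unfolding A by simp
  also have "\<dots> = (\<Sum>k\<le>Suc (Suc n). ?c (real n + 2 - 2 * real k))"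
    unfolding B by simp
  finally show ?case by (simp add: algebra_simps)
qed simp_all

text \<open>Summands with \<open>2 * k > n\<close> vanish because \<open>n - k < k\<close> kills the
  binomial coefficient, so the truncated exponent does no harm. The powers of x are what is matched
  with the coefficients of \<open>zernike_radial\<close>.\<close>

lemma cheb_U_poly:
  "cheb_U n x = (\<Sum>k\<le>n. (- 1) ^ k * real ((n - k) choose k) * (2 * x) ^ (n - 2 * k))"
proof (induction n x rule: cheb_U.induct)
  case (3 n x)
  let ?t = "\<lambda>n k. (- 1) ^ k * real ((n - k) choose k) * (2 * x) ^ (n - 2 * k)"
  \<comment> \<open>Pascal's rule for the coefficients. The cases with \<open>2 * k\<close> at or
    above \<open>n\<close> are separate because subtraction on the naturals truncates there.\<close>
  have step: "?t (Suc (Suc n)) (Suc k) = 2 * x * ?t (Suc n) (Suc k) - ?t n k" if "k \<le> n" for k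
  proof (cases "2 * k < n")
    case True
    then have "Suc n - 2 * k = Suc (n - 2 * k)" "Suc (Suc n) - Suc k = Suc (n - k)"
      "Suc n - Suc k = n - k" "n - 2 * k = Suc (Suc n - 2 * Suc k)"
      "Suc (Suc n) - 2 * Suc k = n - 2 * k"
      by auto
    then show ?thesis by (simp add: algebra_simps)
  next
    case False
    then consider "n = 2 * k" | "n < 2 * k" by linarith
    then show ?thesis
    proof cases
      case 1
      then show ?thesis by simp
    next
      case 2
      then have "n - k < Suc k" "n - k < k" "Suc (n - k) < Suc k" using that by auto
      then show ?thesis
        using that by (simp add: Suc_diff_le binomial_eq_0)
    qed
  qed
  have "(\<Sum>k\<le>Suc (Suc n). ?t (Suc (Suc n)) k) =
     ?t (Suc (Suc n)) 0 + (\<Sum>k\<le>Suc n. ?t (Suc (Suc n)) (Suc k))"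
    by (subst sum.atMost_Suc_shift) simp
  also have "(\<Sum>k\<le>Suc n. ?t (Suc (Suc n)) (Suc k)) = (\<Sum>k\<le>n. ?t (Suc (Suc n)) (Suc k))"
    by simp
  also have "\<dots> = (\<Sum>k\<le>n. 2 * x * ?t (Suc n) (Suc k) - ?t n k)"
    by (intro sum.cong refl step) simp
  also have "\<dots> = 2 * x * (\<Sum>k\<le>n. ?t (Suc n) (Suc k)) - (\<Sum>k\<le>n. ?t n k)"
    by (simp only: sum_subtractf sum_distrib_left)
  also have "?t (Suc (Suc n)) 0 = 2 * x * ?t (Suc n) 0"
    by simp
  also have "2 * x * ?t (Suc n) 0 + (2 * x * (\<Sum>k\<le>n. ?t (Suc n) (Suc k)) - (\<Sum>k\<le>n. ?t n k))
     = 2 * x * (\<Sum>k\<le>Suc n. ?t (Suc n) k) - (\<Sum>k\<le>n. ?t n k)"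
    by (subst sum.atMost_Suc_shift[of "?t (Suc n)"]) (simp add: algebra_simps)
  finally show ?case using 3 by simp
qed simp_all

text \<open>The real part of the binomial expansion of (e^(ia) + e^(-ia))^p.\<close>

lemma cos_power_sum: "(2 * cos a) ^ p = (\<Sum>q\<le>p. real (p choose q) * cos ((real p - 2 * real q) * a))"
proof -
  have "complex_of_real ((2 * cos a) ^ p) = (cis a + cis (- a)) ^ p"
    by (simp add: complex_eq_iff cis.ctr flip: of_real_mult of_real_power)
  also have "\<dots> = (\<Sum>q\<le>p. of_nat (p choose q) * cis (- a) ^ q * cis a ^ (p - q))"
    by (subst add.commute) (rule binomial_ring)
  also have "\<dots> = (\<Sum>q\<le>p. of_nat (p choose q) * cis ((real p - 2 * real q) * a))"
  proof (intro sum.cong refl)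
    fix q assume "q \<in> {..p}"
    then have "real q * - a + real (p - q) * a = (real p - 2 * real q) * a"
      by (simp add: of_nat_diff algebra_simps)
    then show "of_nat (p choose q) * cis (- a) ^ q * cis a ^ (p - q) =
       of_nat (p choose q) * cis ((real p - 2 * real q) * a)"
      by (simp only: Complex.DeMoivre cis_mult mult.assoc)
  qed
  finally have "Re (complex_of_real ((2 * cos a) ^ p)) = Re \<dots>" by simp
  then show ?thesis by simp
qed

text \<open>The angular factor of \<open>zernike\<close>. For negative \<open>l\<close> the sine
  keeps the negative frequency, as the imaginary part of \<open>cis (l * t)\<close> does. The
  factors \<open>sqrt 2\<close> make every mean square over the circle equal to 1.\<close>

definition trig :: "int \<Rightarrow> real \<Rightarrow> real" where
  "trig l t = (if l > 0 then sqrt 2 * cos (real_of_int l * t) else if l = 0 then 1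
     else sqrt 2 * sin (real_of_int l * t))"

lemma trig_continuous [continuous_intros]:
  "continuous_on A (f :: 'a :: t2_space \<Rightarrow> real) \<Longrightarrow> continuous_on A (\<lambda>x. trig l (f x))"
  unfolding trig_def by (cases "l > 0"; cases "l = 0") (auto intro!: continuous_intros)

lemma trig_measurable [measurable]:
  "f \<in> borel_measurable M \<Longrightarrow> (\<lambda>x. trig l (f x)) \<in> borel_measurable M"
  unfolding trig_def by simp

lemma trig_add_pi: "trig l (t + pi) = (- 1) ^ nat \<bar>l\<bar> * trig l t"
proof -
  have c: "cos (real_of_int l * (t + pi)) = (- 1) ^ nat \<bar>l\<bar> * cos (real_of_int l * t)"
    and s: "sin (real_of_int l * (t + pi)) = (- 1) ^ nat \<bar>l\<bar> * sin (real_of_int l * t)"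
    by (simp_all only: ring_distribs cos_add sin_add cos_npi_int sin_npi_int mult.commute[of _ pi])
      (simp_all add: minus_one_power_iff even_nat_iff)
  show ?thesis unfolding trig_def c s by simp
qed

lemma abs_trig_le: "\<bar>trig l t\<bar> \<le> 2"
proof -
  have "sqrt 2 * \<bar>cos x\<bar> \<le> 2" "sqrt 2 * \<bar>sin x\<bar> \<le> 2" for x :: real
    using mult_mono[of "sqrt 2" 2 "\<bar>cos x\<bar>" 1] mult_mono[of "sqrt 2" 2 "\<bar>sin x\<bar>" 1]
      sqrt2_less_2 by auto
  then show ?thesis unfolding trig_def by (auto simp: abs_mult)
qed

abbreviation circ :: "real measure" where
  "circ \<equiv> restrict_space lborel {0..2 * pi}"

lemma finite_measure_circ: "finite_measure circ"
  by (rule finite_measureI) (simp add: space_restrict_space emeasure_restrict_space)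

lemma integral_circ_eq: "(\<integral>t. f t \<partial>circ) = (\<integral>t. f t * indicator {0..2 * pi} t \<partial>lborel)"
  for f :: "real \<Rightarrow> real"
  by (subst integral_restrict_space) (auto simp: mult.commute)

lemma integrable_circ:
  assumes "continuous_on UNIV f" shows "integrable circ (f :: real \<Rightarrow> real)"
proof -
  have "integrable lborel (\<lambda>x. indicator {0..2 * pi} x *\<^sub>R f x)"
    by (intro borel_integrable_compact) (auto intro: continuous_on_subset[OF assms])
  then show ?thesis by (subst integrable_restrict_space) auto
qed

lemma integral_circ_cos:
  "(\<integral>t. cos (real_of_int p * t + c) \<partial>circ) = (if p = 0 then 2 * pi * cos c else 0)"
proof (cases "p = 0")
  case False
  have "(\<integral>t. cos (real_of_int p * t + c) * indicator {0..2 * pi} t \<partial>lborel) =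
      sin (real_of_int p * (2 * pi) + c) / p - sin (real_of_int p * 0 + c) / p"
    using False
    by (intro integral_FTC_Icc_real) (auto intro!: derivative_eq_intros continuous_intros)
  also have "sin (real_of_int p * (2 * pi) + c) = sin c"
    using sin.plus_of_int[of c p] by (simp only: add.commute of_real_eq_id id_apply)
  finally show ?thesis using False by (simp add: integral_circ_eq)
qed (simp add: integral_circ_eq measure_restrict_space mult.commute)

text \<open>Convolution with a cosine of frequency \<open>p\<close> keeps the frequencies
  \<open>p\<close> and \<open>- p\<close> only. Both conditions hold at once when
  \<open>p = l = 0\<close>, which yields the factor 2 pi.\<close>

lemma integral_circ_cos_mult_trig:
  "(\<integral>t. cos (real_of_int p * (x - t)) * trig l t \<partial>circ) =
     ((if p = l then pi else 0) + (if p = - l then pi else 0)) * trig l x"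
proof -
  have int: "integrable circ (\<lambda>t. cos (real_of_int q * t + c))" for q c
    by (intro integrable_circ continuous_intros)
  have cc: "cos (real_of_int p * (x - t)) * cos (real_of_int l * t) =
     (cos (real_of_int (l - p) * t + p * x) + cos (real_of_int (l + p) * t + - (p * x))) / 2" for t
  proof -
    have "real_of_int (l - p) * t + p * x = l * t + p * (x - t)"
      "real_of_int (l + p) * t + - (p * x) = l * t - p * (x - t)"
      by (simp_all add: algebra_simps)
    then show ?thesis by (simp only: cos_add[of "_ * _" "_ * (_ - _)"] cos_diff) simp
  qed
  have cs: "cos (real_of_int p * (x - t)) * sin (real_of_int l * t) =
     (cos (real_of_int (l - p) * t + (p * x - pi / 2))
      + cos (real_of_int (l + p) * t + (- (p * x) - pi / 2))) / 2" for t
  proof -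
    have "real_of_int (l - p) * t + (p * x - pi / 2) = (l * t + p * (x - t)) - pi / 2"
      "real_of_int (l + p) * t + (- (p * x) - pi / 2) = (l * t - p * (x - t)) - pi / 2"
      by (simp_all add: algebra_simps)
    then show ?thesis by (simp only: cos_diff[of _ "pi / 2"]) (simp add: sin_add sin_diff)
  qed
  have C: "(\<integral>t. cos (real_of_int p * (x - t)) * cos (real_of_int l * t) \<partial>circ) =
     ((if p = l then pi else 0) + (if p = - l then pi else 0)) * cos (l * x)"
    by (simp only: cc integral_divide_zero Bochner_Integration.integral_add int integral_circ_cos)
      (auto simp: eq_neg_iff_add_eq_0[symmetric] add.commute[of l p])
  have S: "(\<integral>t. cos (real_of_int p * (x - t)) * sin (real_of_int l * t) \<partial>circ) =
     ((if p = l then pi else 0) + (if p = - l then pi else 0)) * sin (l * x)"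
    by (simp only: cs integral_divide_zero Bochner_Integration.integral_add int integral_circ_cos)
      (auto simp: cos_diff eq_neg_iff_add_eq_0[symmetric] add.commute[of l p])
  have "(\<integral>t. cos (real_of_int p * (x - t)) * (sqrt 2 * g t) \<partial>circ) =
     sqrt 2 * (\<integral>t. cos (real_of_int p * (x - t)) * g t \<partial>circ)" for g
    by (simp only: mult.left_commute[of _ "sqrt 2"] integral_mult_right_zero)
  note sq = this
  consider "l > 0" | "l = 0" | "l < 0" by linarith
  then show ?thesis
  proof cases
    case 1
    then have "trig l = (\<lambda>t. sqrt 2 * cos (real_of_int l * t))" by (auto simp: trig_def)
    then show ?thesis by (simp only: sq C, simp only: mult.left_commute)
  next
    case 2
    then show ?thesis using C by (simp add: trig_def)
  next
    case 3
    then have "trig l = (\<lambda>t. sqrt 2 * sin (real_of_int l * t))" by (auto simp: trig_def)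
    then show ?thesis by (simp only: sq S, simp only: mult.left_commute)
  qed
qed

lemma integral_trig_mult_trig:
  "(\<integral>t. trig l t * trig l' t \<partial>circ) = (if l = l' then 2 * pi else 0)"
proof -
  have int: "integrable circ (\<lambda>t. cos (real_of_int q * t + c))" for q c
    by (intro integrable_circ continuous_intros)
  define s where "s l = (if l > 0 then sqrt 2 else if l = 0 then 1 else sqrt 2)" for l :: int
  \<comment> \<open>Sines become cosines with phase pi/2, so one product formula covers all sign
    patterns. For opposite nonzero frequencies the phases differ by a quarter turn and the remaining
    cosine is 0.\<close>
  define c where "c l = (if l > 0 then 0 else if l = 0 then 0 else pi / 2)" for l :: int
  have tr: "trig l t = s l * cos (real_of_int l * t - c l)" for l t
    by (auto simp: trig_def s_def c_def cos_diff)
  have "trig l t * trig l' t = s l * s l' *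
     (cos (real_of_int (l - l') * t + (c l' - c l)) + cos (real_of_int (l + l') * t + (- c l - c l'))) / 2" for t
    unfolding tr by (simp add: cos_times_cos algebra_simps)
  then have "(\<integral>t. trig l t * trig l' t \<partial>circ) = s l * s l' *
     ((if l - l' = 0 then 2 * pi * cos (c l' - c l) else 0) + (if l + l' = 0 then 2 * pi * cos (- c l - c l') else 0)) / 2"
    by (simp only: integral_divide_zero integral_mult_right_zero Bochner_Integration.integral_add
          int integral_circ_cos)
  moreover have "s l * s l' * ((if l - l' = 0 then 2 * pi * cos (c l' - c l) else 0) +
      (if l + l' = 0 then 2 * pi * cos (- c l - c l') else 0)) / 2 = (if l = l' then 2 * pi else 0)"
    by (auto simp: s_def c_def)
  ultimately show ?thesis by simp
qed

text \<open>At most one \<open>q\<close> contributes. By the symmetry of binomial coefficients the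
  value depends on \<open>l\<close> through its absolute value, so that frequencies \<open>l\<close>
  and \<open>- l\<close> can be merged afterwards.\<close>

lemma sum_binomial_delta:
  "(\<Sum>q\<le>p. if int p - 2 * int q = l then c * real (p choose q) else 0) =
     (if nat \<bar>l\<bar> \<le> p \<and> even (int p - l) then c * real (p choose ((p - nat \<bar>l\<bar>) div 2)) else 0)"
proof (cases "nat \<bar>l\<bar> \<le> p \<and> even (int p - l)")
  case True
  then obtain r' where "int p - l = 2 * r'" by (metis evenE)
  moreover define r where "r = nat r'"
  ultimately have r: "int p - l = 2 * int r" "r \<le> p" using True by linarith+
  then have r': "int p - 2 * int q = l \<longleftrightarrow> q = r" for q by auto
  have "p choose r = p choose ((p - nat \<bar>l\<bar>) div 2)"
  proof (cases "l \<ge> 0")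
    case True
    then have "(p - nat \<bar>l\<bar>) div 2 = r" using r by linarith
    then show ?thesis by simp
  next
    case False
    then have "p - nat \<bar>l\<bar> = 2 * (p - r)" using r True by linarith
    then show ?thesis using r by (metis binomial_symmetric nonzero_mult_div_cancel_left zero_neq_numeral)
  qed
  then show ?thesis using True r by (simp add: r')
next
  case False
  have "int p - 2 * int q \<noteq> l" if "q \<le> p" for q
  proof
    assume *: "int p - 2 * int q = l"
    then have "int p - l = 2 * int q" "nat \<bar>l\<bar> \<le> p" using that by linarith+
    with False show False by (metis dvd_triv_left)
  qed
  then show ?thesis using False by (auto intro!: sum.neutral)
qed

lemma integral_cos_power_mult_trig:
  "(\<integral>t. (2 * cos (x - t)) ^ p * trig l t \<partial>circ) =
     (if nat \<bar>l\<bar> \<le> p \<and> even (int p - l) then 2 * pi * real (p choose ((p - nat \<bar>l\<bar>) div 2)) else 0) * trig l x"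
proof -
  have int: "integrable circ (\<lambda>t. cos (real_of_int q * (x - t)) * trig l t)" for q
    by (intro integrable_circ continuous_intros)
  have "(\<integral>t. (2 * cos (x - t)) ^ p * trig l t \<partial>circ) =
    (\<integral>t. (\<Sum>q\<le>p. real (p choose q) * (cos (real_of_int (int p - 2 * int q) * (x - t)) * trig l t)) \<partial>circ)"
    by (intro Bochner_Integration.integral_cong refl) (simp only: cos_power_sum sum_distrib_right mult.assoc, simp)
  also have "\<dots> = (\<Sum>q\<le>p. real (p choose q) *
      (((if int p - 2 * int q = l then pi else 0) + (if int p - 2 * int q = - l then pi else 0)) * trig l x))"
    using int by (simp only: Bochner_Integration.integral_sum integrable_mult_right
       integral_mult_right_zero integral_circ_cos_mult_trig)
  also have "\<dots> = ((\<Sum>q\<le>p. if int p - 2 * int q = l then pi * real (p choose q) else 0) +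
      (\<Sum>q\<le>p. if int p - 2 * int q = - l then pi * real (p choose q) else 0)) * trig l x"
    unfolding sum.distrib[symmetric] sum_distrib_right by (intro sum.cong) (auto simp: algebra_simps)
  also have "\<dots> = (if nat \<bar>l\<bar> \<le> p \<and> even (int p - l)
      then 2 * pi * real (p choose ((p - nat \<bar>l\<bar>) div 2)) else 0) * trig l x"
    by (simp only: sum_binomial_delta) simp
  finally show ?thesis .
qed

text \<open>Under the parity condition each of \<open>l\<close> and \<open>- l\<close> occurs
  exactly once among the frequencies m, m-2, ..., -m, and each occurrence contributes pi.\<close>

lemma integral_cheb_U_mult_trig:
  assumes "nat \<bar>l\<bar> \<le> m" "even (int m - l)"
  shows "(\<integral>t. cheb_U m (cos (x - t)) * trig l t \<partial>circ) = 2 * pi * trig l x"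
proof -
  have int: "integrable circ (\<lambda>t. cos (real_of_int q * (x - t)) * trig l t)" for q
    by (intro integrable_circ continuous_intros)
  have delta: "(\<Sum>k\<le>m. if int m - 2 * int k = l' then pi else 0) = pi"
    if l': "nat \<bar>l'\<bar> \<le> m" "even (int m - l')" for l'
  proof -
    obtain r' where "int m - l' = 2 * r'" using l' by (metis evenE)
    moreover define r where "r = nat r'"
    ultimately have r: "int m - l' = 2 * int r" "r \<le> m" using l' by linarith+
    then have r': "int m - 2 * int q = l' \<longleftrightarrow> q = r" for q by auto
    show ?thesis using r by (simp add: r')
  qed
  have "(\<integral>t. cheb_U m (cos (x - t)) * trig l t \<partial>circ) =
    (\<integral>t. (\<Sum>k\<le>m. cos (real_of_int (int m - 2 * int k) * (x - t)) * trig l t) \<partial>circ)"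
    by (intro Bochner_Integration.integral_cong refl) (simp only: cheb_U_cos_sum sum_distrib_right, simp)
  also have "\<dots> = (\<Sum>k\<le>m. ((if int m - 2 * int k = l then pi else 0) + (if int m - 2 * int k = - l then pi else 0)) * trig l x)"
    using int by (simp only: Bochner_Integration.integral_sum integral_circ_cos_mult_trig)
  also have "\<dots> = ((\<Sum>k\<le>m. if int m - 2 * int k = l then pi else 0) + (\<Sum>k\<le>m. if int m - 2 * int k = - l then pi else 0)) * trig l x"
    by (simp only: sum.distrib[symmetric] sum_distrib_right)
  finally show ?thesis using assms by (simp add: delta)
qed

text \<open>Expanding the ridge function in powers of the cosine leaves one monomial in
  \<open>r\<close> for each \<open>k\<close>. A power contains the frequency \<open>l\<close> only
  if its exponent is at least \<bar>l\<bar>, and the surviving products of binomials are the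
  coefficients of \<open>zernike_radial\<close>.\<close>

lemma integral_ridge_zernike:
  assumes "nat \<bar>l\<bar> \<le> m" "even (int m - l)"
  shows "(\<integral>t. cheb_U m (r * cos (x - t)) * trig l t \<partial>circ) =
     2 * pi * zernike_radial m (nat \<bar>l\<bar>) r * trig l x"
proof -
  define b where "b = nat \<bar>l\<bar>"
  have b: "b \<le> m" "even (m - b)" and par: "even (int p - l) \<longleftrightarrow> even (m - p)" if "p \<le> m" for p
    using assms that unfolding b_def by (auto simp: even_nat_iff)
  define h where "h = (m - b) div 2"
  have h: "m = b + 2 * h" using b[of 0] unfolding h_def by (auto elim!: evenE)
  have int: "integrable circ (\<lambda>t. (2 * cos (x - t)) ^ p * trig l t)" for p
    by (intro integrable_circ continuous_intros)
  define c where "c k = (- 1) ^ k * real ((m - k) choose k) * r ^ (m - 2 * k)" for k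
  have pw: "(2 * (r * y)) ^ p = r ^ p * (2 * y) ^ p" for y :: real and p
    by (simp add: power_mult_distrib)
  have "(\<integral>t. cheb_U m (r * cos (x - t)) * trig l t \<partial>circ) =
    (\<integral>t. (\<Sum>k\<le>m. c k * ((2 * cos (x - t)) ^ (m - 2 * k) * trig l t)) \<partial>circ)"
    by (intro Bochner_Integration.integral_cong refl)
      (simp only: cheb_U_poly sum_distrib_right c_def pw mult.assoc)
  also have "\<dots> = (\<Sum>k\<le>m. c k * (\<integral>t. (2 * cos (x - t)) ^ (m - 2 * k) * trig l t \<partial>circ))"
    using int by (simp only: Bochner_Integration.integral_sum integrable_mult_right integral_mult_right_zero)
  \<comment> \<open>Beyond \<open>h\<close> either the exponent \<open>m - 2 * k\<close> drops below
    \<bar>l\<bar>, so that the frequency is absent, or \<open>2 * k > m\<close> and the coefficient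
    is 0.\<close>
  also have "\<dots> = (\<Sum>k\<le>h. c k * (\<integral>t. (2 * cos (x - t)) ^ (m - 2 * k) * trig l t \<partial>circ))"
  proof (rule sum.mono_neutral_right)
    show "\<forall>k\<in>{..m} - {..h}. c k * (\<integral>t. (2 * cos (x - t)) ^ (m - 2 * k) * trig l t \<partial>circ) = 0"
    proof
      fix k assume k: "k \<in> {..m} - {..h}"
      show "c k * (\<integral>t. (2 * cos (x - t)) ^ (m - 2 * k) * trig l t \<partial>circ) = 0"
      proof (cases "2 * k \<le> m")
        case True
        then have "\<not> nat \<bar>l\<bar> \<le> m - 2 * k" using k h unfolding b_def[symmetric] by auto
        then show ?thesis by (simp only: integral_cos_power_mult_trig) simp
      next
        case False
        then have "m - k < k" by auto
        then show ?thesis by (simp add: c_def binomial_eq_0)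
      qed
    qed
  qed (use h in auto)
  also have "\<dots> = (\<Sum>k\<le>h. 2 * pi * ((- 1) ^ k * fact (m - k) /
        (fact k * fact ((m + b) div 2 - k) * fact ((m - b) div 2 - k)) * r ^ (m - 2 * k)) * trig l x)"
  proof (intro sum.cong refl)
    fix k assume "k \<in> {..h}"
    then have k: "k \<le> h" by simp
    have e: "even (int (m - 2 * k) - l)" using assms k h by (auto simp: of_nat_diff)
    have le: "nat \<bar>l\<bar> \<le> m - 2 * k" using k h unfolding b_def[symmetric] by auto
    have "(m - 2 * k - b) div 2 = h - k" "(m + b) div 2 - k = b + h - k" "(m - b) div 2 - k = h - k"
      "m - 2 * k - (h - k) = b + h - k" "m - k - k = m - 2 * k" "h - k \<le> m - 2 * k" "k \<le> m - k"
      using k h by auto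
    note idx = this
    \<comment> \<open>In the product of the two binomials the factor (m - 2k)! cancels, which leaves
      exactly the quotient of factorials in the Zernike coefficient.\<close>
    have "real ((m - 2 * k) choose (h - k)) = fact (m - 2 * k) / (fact (h - k) * fact (b + h - k))"
      using idx by (simp only: binomial_fact[OF idx(6)])
    moreover have "real ((m - k) choose k) = fact (m - k) / (fact k * fact (m - 2 * k))"
      using idx by (simp only: binomial_fact[OF idx(7)])
    ultimately have "c k * real ((m - 2 * k) choose ((m - 2 * k - b) div 2)) = (- 1) ^ k * fact (m - k) /
        (fact k * fact ((m + b) div 2 - k) * fact ((m - b) div 2 - k)) * r ^ (m - 2 * k)" (is "?L = ?R")
      unfolding idx c_def by simp
    moreover have "c k * ((2 * pi * real ((m - 2 * k) choose ((m - 2 * k - b) div 2))) * trig l x) = 2 * pi * ?L * trig l x"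
      by (simp only: mult_ac)
    ultimately show "c k * (\<integral>t. (2 * cos (x - t)) ^ (m - 2 * k) * trig l t \<partial>circ) = 2 * pi * ?R * trig l x"
      using e le unfolding integral_cos_power_mult_trig b_def[symmetric] by (simp only: simp_thms if_True)
  qed
  also have "\<dots> = 2 * pi * zernike_radial m b r * trig l x"
    unfolding zernike_radial_def sum_distrib_left sum_distrib_right h_def atMost_atLeast0 ..
  finally show ?thesis unfolding b_def .
qed

section \<open>Zernike functions as averages of ridge functions\<close>

definition zscale :: "nat \<times> nat \<Rightarrow> real" where
  "zscale i = sqrt ((real (fst i + snd i) + 1) / pi)"

abbreviation deg :: "nat \<times> nat \<Rightarrow> nat" where "deg i \<equiv> fst i + snd i"
abbreviation freq :: "nat \<times> nat \<Rightarrow> int" where "freq i \<equiv> int (fst i) - int (snd i)"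

lemma freq_deg: "nat \<bar>freq i\<bar> \<le> deg i" "even (int (deg i) - freq i)"
proof -
  show "nat \<bar>freq i\<bar> \<le> deg i" by linarith
  have "int (deg i) - freq i = 2 * int (snd i)" by simp
  then show "even (int (deg i) - freq i)" by (metis dvd_triv_left)
qed

text \<open>This representation replaces polar coordinates: the Radon transform of a ridge function is
  explicit, and so are the adjoint and the inner products.\<close>

lemma zernike_eq:
  "zernike i (x, y) = zscale i / (2 * pi) *
     (\<integral>t. cheb_U (deg i) (x * cos t + y * sin t) * trig (freq i) t \<partial>circ)"
proof -
  obtain j k where i: "i = (j, k)" by (cases i)
  define r \<theta> where "r = norm (x, y)" and "\<theta> = Arg (Complex x y)"
  have "cmod (Complex x y) = r" by (simp add: r_def norm_Pair complex_norm)
  then have rc: "Complex x y = rcis r \<theta>"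
    using rcis_cmod_Arg[of "Complex x y"] by (simp only: \<theta>_def)
  have "x = r * cos \<theta>" "y = r * sin \<theta>"
    using arg_cong[OF rc, of Re] arg_cong[OF rc, of Im] by (simp_all only: Re_rcis Im_rcis complex.sel)
  then have "x * cos t + y * sin t = r * cos (\<theta> - t)" for t
    by (simp add: cos_diff algebra_simps)
  then have I: "(\<integral>t. cheb_U (deg i) (x * cos t + y * sin t) * trig (freq i) t \<partial>circ) =
     2 * pi * zernike_radial (deg i) (nat \<bar>freq i\<bar>) r * trig (freq i) \<theta>"
    using integral_ridge_zernike[OF freq_deg] by simp
  have "pi powr (- 1 / 2) * real (j + k + 1) powr (1 / 2) = zscale i"
    by (simp add: zscale_def i powr_minus powr_half_sqrt real_sqrt_divide field_simps)
  then have "zernike i (x, y) = zscale i * zernike_radial (deg i) (nat \<bar>freq i\<bar>) r * trig (freq i) \<theta>"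
    unfolding zernike_def i Let_def zernike_complex_def r_def \<theta>_def
    by (auto simp: trig_def)
  then show ?thesis unfolding I by simp
qed

text \<open>An antiderivative is T_(m+1) divided by (m + 1) sin a. With u = cos b its arguments at
  the two ends of the chord are cos(b - a) and cos(b + a), and the difference of cosines factors
  into two sines. When sin a = 0 the integrand is constant and is evaluated directly.\<close>

lemma integral_cheb_U_chord:
  assumes "\<bar>u\<bar> \<le> 1"
  shows "(\<integral>t. cheb_U m (u * cos a + t * sin a) * indicator {- sqrt (1 - u\<^sup>2)..sqrt (1 - u\<^sup>2)} t \<partial>lborel) =
     2 * sqrt (1 - u\<^sup>2) * cheb_U m u * cheb_U m (cos a) / (real m + 1)"
proof -
  define s where "s = sqrt (1 - u\<^sup>2)"
  have s: "s \<ge> 0" using assms by (simp add: s_def abs_square_le_1)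
  show ?thesis
  proof (cases "sin a = 0")
    case True
    then have "cos a = 1 \<or> cos a = - 1"
      using sin_cos_squared_add[of a] by (simp add: power2_eq_1_iff)
    then show ?thesis unfolding s_def[symmetric] using True s
      by (auto simp: cheb_U_minus cheb_U_1 mult_ac)
  next
    case False
    define b where "b = arccos u"
    have b: "cos b = u" "sin b = s"
      using assms by (simp_all add: b_def s_def cos_arccos_abs sin_arccos_abs)
    let ?F = "\<lambda>t. cheb_T (Suc m) (u * cos a + t * sin a) / ((real m + 1) * sin a)"
    have "(\<integral>t. cheb_U m (u * cos a + t * sin a) * indicator {- s..s} t \<partial>lborel) = ?F s - ?F (- s)"
    proof (rule integral_FTC_Icc_real)
      fix t
      have "((\<lambda>t. u * cos a + t * sin a) has_real_derivative sin a) (at t)"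
        by (auto intro!: derivative_eq_intros)
      from DERIV_chain2[OF DERIV_cheb_T this]
      have "(?F has_real_derivative ((real m + 1) * cheb_U m (u * cos a + t * sin a) * sin a) / ((real m + 1) * sin a)) (at t)"
        by (rule DERIV_cdivide)
      also have "((real m + 1) * cheb_U m (u * cos a + t * sin a) * sin a) / ((real m + 1) * sin a) =
        cheb_U m (u * cos a + t * sin a)" using False by simp
      finally show "(?F has_real_derivative cheb_U m (u * cos a + t * sin a)) (at t)" .
      have "continuous_on UNIV (\<lambda>t. cheb_U m (u * cos a + t * sin a))"
        by (intro continuous_intros)
      then show "isCont (\<lambda>t. cheb_U m (u * cos a + t * sin a)) t"
        by (simp add: continuous_on_eq_continuous_at)
    qed (use s in simp)
    also have "u * cos a + s * sin a = cos (b - a)"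
      by (simp add: cos_diff b)
    also have "u * cos a + - s * sin a = cos (b + a)"
      by (simp add: cos_add b)
    also have "cheb_T (Suc m) (cos (b - a)) / ((real m + 1) * sin a) -
       cheb_T (Suc m) (cos (b + a)) / ((real m + 1) * sin a) =
       (cos (real (m + 1) * b - real (m + 1) * a) - cos (real (m + 1) * b + real (m + 1) * a)) / ((real m + 1) * sin a)"
      by (simp only: cheb_T_cos diff_divide_distrib) (simp add: algebra_simps)
    also have "\<dots> = 2 * (sin (real (m + 1) * b) * sin (real (m + 1) * a)) / ((real m + 1) * sin a)"
      by (simp only: cos_add cos_diff) simp
    also have "\<dots> = 2 * s * cheb_U m u * cheb_U m (cos a) / (real m + 1)"
      using False by (simp only: cheb_U_sin[symmetric] b) simp
    finally show ?thesis unfolding s_def .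
  qed
qed

text \<open>The strip offers only half of [-1, 1]. For equal parity the integrand is even in u, so
  orthogonality survives on [0, 1].\<close>

lemma integral_cheb_U_cheb_U:
  assumes "even (m + m')"
  shows "(\<integral>u. sqrt (1 - u\<^sup>2) * cheb_U m u * cheb_U m' u * indicator {0..1} u \<partial>lborel) =
    (if m = m' then pi / 4 else 0)"
proof -
  let ?f = "\<lambda>u. sqrt (1 - u\<^sup>2) * cheb_U m u * cheb_U m' u"
  let ?h = "\<lambda>x. (cos ((real m - real m') * (pi / 2 - x)) - cos ((real m + real m' + 2) * (pi / 2 - x))) / 2"
  have "(\<integral>u. ?f u * indicator {0..1} u \<partial>lborel) = (LBINT u=ereal 0..ereal 1. ?f u)"
    by (subst interval_integral_Icc) (auto simp: set_lebesgue_integral_def mult.commute)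
  \<comment> \<open>The substitution u = sin x preserves the orientation of the interval; y = pi/2 -
    x below restores u = cos y.\<close>
  also have "\<dots> = (LBINT x=ereal 0..ereal (pi / 2). cos x *\<^sub>R ?f (sin x))"
    by (subst interval_integral_substitution_finite)
      (auto intro!: derivative_eq_intros continuous_intros)
  also have "\<dots> = (LBINT x=ereal 0..ereal (pi / 2). ?h x)"
  proof (rule interval_integral_cong)
    fix x assume "x \<in> einterval (min (ereal 0) (ereal (pi / 2))) (max (ereal 0) (ereal (pi / 2)))"
    then have x: "0 < x" "x < pi / 2" by (auto simp: einterval_def min_def max_def)
    define y where "y = pi / 2 - x"
    have "cos x = sin y" "sin x = cos y" by (simp_all add: y_def sin_diff cos_diff)
    moreover have "sqrt (1 - (cos y)\<^sup>2) = sin y"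
      using x by (intro real_sqrt_unique) (auto simp: y_def sin_squared_eq intro!: sin_ge_zero)
    ultimately have "cos x *\<^sub>R ?f (sin x) = (sin y * cheb_U m (cos y)) * (sin y * cheb_U m' (cos y))"
      by (simp add: mult_ac)
    also have "\<dots> = sin (real (m + 1) * y) * sin (real (m' + 1) * y)"
      by (simp only: cheb_U_sin)
    also have "\<dots> = (cos (real (m + 1) * y - real (m' + 1) * y) - cos (real (m + 1) * y + real (m' + 1) * y)) / 2"
      by (rule sin_times_sin)
    also have "\<dots> = ?h x"
      unfolding y_def[symmetric] by (simp add: algebra_simps)
    finally show "cos x *\<^sub>R ?f (sin x) = ?h x" .
  qed
  also have "\<dots> = (\<integral>x. ?h x * indicator {0..pi / 2} x \<partial>lborel)"
    by (subst interval_integral_Icc) (auto simp: set_lebesgue_integral_def mult.commute)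
  also have "\<dots> = (if m = m' then pi / 4 else 0)"
  proof -
    let ?H = "\<lambda>x. ((if m = m' then x else - sin ((real m - real m') * (pi / 2 - x)) / (real m - real m'))
         + sin ((real m + real m' + 2) * (pi / 2 - x)) / (real m + real m' + 2)) / 2"
    \<comment> \<open>Equal parity makes both frequencies times pi/2 integer multiples of pi, so the
      boundary terms at x = 0 vanish.\<close>
    obtain p where p: "m + m' = 2 * p" using assms by (elim evenE)
    have p': "real m = 2 * real p - real m'" using arg_cong[OF p, of real] by simp
    have "(real m + real m' + 2) * (pi / 2) = real (p + 1) * pi"
      unfolding p' by (simp add: field_simps)
    then have z1: "sin ((real m + real m' + 2) * (pi / 2)) = 0" by (simp only: sin_npi)
    have "(real m - real m') * (pi / 2) = real_of_int (int p - int m') * pi"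
      unfolding p' by (simp add: field_simps)
    then have z2: "sin ((real m - real m') * (pi / 2)) = 0"
      by (simp only: mult.commute[of _ pi] sin_npi_int)
    have "(\<integral>x. ?h x * indicator {0..pi / 2} x \<partial>lborel) = ?H (pi / 2) - ?H 0"
    proof (rule integral_FTC_Icc_real)
      fix x
      show "(?H has_real_derivative ?h x) (at x)"
      proof -
        have D: "((\<lambda>x. - (sin (c * (pi / 2 - x)) / c)) has_real_derivative cos (c * (pi / 2 - x))) (at x)"
          if "c \<noteq> 0" for c
          using that by (auto intro!: derivative_eq_intros)
        have "((\<lambda>x. if m = m' then x else - (sin ((real m - real m') * (pi / 2 - x)) / (real m - real m')))
            has_real_derivative cos ((real m - real m') * (pi / 2 - x))) (at x)"
          using D[of "real m - real m'"] by (cases "m = m'") auto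
        moreover have "(if m = m' then z else - (y / c)) = (if m = m' then z else - y / c)" for y z c :: real
          by simp
        ultimately have "((\<lambda>x. if m = m' then x else - sin ((real m - real m') * (pi / 2 - x)) / (real m - real m'))
            has_real_derivative cos ((real m - real m') * (pi / 2 - x))) (at x)"
          by (simp only:)
        from DERIV_cdivide[OF DERIV_diff[OF this D[of "real m + real m' + 2"]], of 2]
        show ?thesis by (simp only: diff_minus_eq_add)
      qed
      show "isCont ?h x" by (intro continuous_intros) simp
    qed simp
    then show ?thesis using z1 z2 by auto
  qed
  finally show ?thesis .
qed

section \<open>Rotations of the plane and the Radon transform\<close>

text \<open>A rotation is a product of three shears, and shears preserve Lebesgue measure by Fubini and
  translation invariance on the line.\<close>

lemma distr_lborel_shear_fst:
  "distr lborel borel (\<lambda>(x, y). (x + k * y, y)) = (lborel :: (real \<times> real) measure)"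
proof (rule measure_eqI)
  fix A :: "(real \<times> real) set"
  assume "A \<in> sets (distr lborel borel (\<lambda>(x, y). (x + k * y, y)))"
  then have [measurable]: "A \<in> sets borel" by simp
  then have [measurable]: "A \<in> sets (lborel \<Otimes>\<^sub>M lborel)" by (metis lborel_prod sets_lborel)
  have [measurable]: "(\<lambda>(x, y). (x + k * y, y)) \<in> borel_measurable (borel :: (real \<times> real) measure)"
    by (simp add: borel_prod[symmetric])
  have "emeasure (distr lborel borel (\<lambda>(x, y). (x + k * y, y))) A =
     (\<integral>\<^sup>+ p. indicator A (case p of (x, y) \<Rightarrow> (x + k * y, y)) \<partial>(lborel \<Otimes>\<^sub>M lborel))"
    by (subst nn_integral_indicator[symmetric], simp, subst nn_integral_distr) (simp_all add: lborel_prod)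
  also have "\<dots> = (\<integral>\<^sup>+ y. \<integral>\<^sup>+ x. indicator A (x + k * y, y) \<partial>lborel \<partial>lborel)"
    by (subst lborel_pair.nn_integral_snd[symmetric]) simp_all
  also have "\<dots> = (\<integral>\<^sup>+ y. \<integral>\<^sup>+ x. indicator A (x, y) \<partial>lborel \<partial>lborel)"
  proof (rule nn_integral_cong)
    fix y :: real
    show "(\<integral>\<^sup>+ x. indicator A (x + k * y, y) \<partial>lborel) = (\<integral>\<^sup>+ x. indicator A (x, y) \<partial>lborel)"
      using nn_integral_real_affine[of "\<lambda>x. indicator A (x, y)" 1 "k * y"] by (simp add: add.commute)
  qed
  also have "\<dots> = (\<integral>\<^sup>+ p. indicator A p \<partial>(lborel \<Otimes>\<^sub>M lborel))"
    by (subst lborel_pair.nn_integral_snd[symmetric]) simp_all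
  also have "\<dots> = emeasure lborel A"
    by (simp add: lborel_prod)
  finally show "emeasure (distr lborel borel (\<lambda>(x, y). (x + k * y, y))) A = emeasure lborel A" .
qed simp

lemma distr_lborel_shear_snd:
  "distr lborel borel (\<lambda>(x, y). (x, y + k * x)) = (lborel :: (real \<times> real) measure)"
proof (rule measure_eqI)
  fix A :: "(real \<times> real) set"
  assume "A \<in> sets (distr lborel borel (\<lambda>(x, y). (x, y + k * x)))"
  then have [measurable]: "A \<in> sets borel" by simp
  then have [measurable]: "A \<in> sets (lborel \<Otimes>\<^sub>M lborel)" by (metis lborel_prod sets_lborel)
  have [measurable]: "(\<lambda>(x, y). (x, y + k * x)) \<in> borel_measurable (borel :: (real \<times> real) measure)"
    by (simp add: borel_prod[symmetric])
  have "emeasure (distr lborel borel (\<lambda>(x, y). (x, y + k * x))) A =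
     (\<integral>\<^sup>+ p. indicator A (case p of (x, y) \<Rightarrow> (x, y + k * x)) \<partial>(lborel \<Otimes>\<^sub>M lborel))"
    by (subst nn_integral_indicator[symmetric], simp, subst nn_integral_distr) (simp_all add: lborel_prod)
  also have "\<dots> = (\<integral>\<^sup>+ x. \<integral>\<^sup>+ y. indicator A (x, y + k * x) \<partial>lborel \<partial>lborel)"
    by (subst lborel.nn_integral_fst[symmetric]) simp_all
  also have "\<dots> = (\<integral>\<^sup>+ x. \<integral>\<^sup>+ y. indicator A (x, y) \<partial>lborel \<partial>lborel)"
  proof (rule nn_integral_cong)
    fix x :: real
    show "(\<integral>\<^sup>+ y. indicator A (x, y + k * x) \<partial>lborel) = (\<integral>\<^sup>+ y. indicator A (x, y) \<partial>lborel)"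
      using nn_integral_real_affine[of "\<lambda>y. indicator A (x, y)" 1 "k * x"] by (simp add: add.commute)
  qed
  also have "\<dots> = (\<integral>\<^sup>+ p. indicator A p \<partial>(lborel \<Otimes>\<^sub>M lborel))"
    by (subst lborel.nn_integral_fst[symmetric]) simp_all
  also have "\<dots> = emeasure lborel A"
    by (simp add: lborel_prod)
  finally show "emeasure (distr lborel borel (\<lambda>(x, y). (x, y + k * x))) A = emeasure lborel A" .
qed simp

text \<open>Maps the pair of line coordinates to a point: \<open>u\<close> is the signed distance of
  the line from the origin in direction \<phi>, and \<open>t\<close> is the position on it. These
  are the points at which \<open>radon\<close> integrates.\<close>

definition rot :: "real \<Rightarrow> real \<times> real \<Rightarrow> real \<times> real" where
  "rot \<phi> = (\<lambda>(u, t). (u * cos \<phi> - t * sin \<phi>, u * sin \<phi> + t * cos \<phi>))"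

lemma rot_measurable [measurable]:
  assumes [measurable]: "f \<in> borel_measurable M" "g \<in> borel_measurable M"
  shows "(\<lambda>x. rot (f x) (g x)) \<in> borel_measurable M"
proof -
  have [measurable]: "(\<lambda>p. rot (fst p) (snd p)) \<in> borel_measurable borel"
    unfolding rot_def case_prod_beta
    by (intro borel_measurable_continuous_onI continuous_intros)
  have "(\<lambda>x. (f x, g x)) \<in> borel_measurable M" by measurable
  from measurable_compose[OF this \<open>(\<lambda>p. rot (fst p) (snd p)) \<in> borel_measurable borel\<close>]
  show ?thesis by simp
qed

lemma distr_lborel_rot: "distr lborel borel (rot \<phi>) = lborel"
proof -
  have A: "distr lborel borel (\<lambda>(x, y). (c * x - s * y, s * x + c * y)) = (lborel :: (real \<times> real) measure)"
    if cs: "c\<^sup>2 + s\<^sup>2 = 1" "c \<noteq> - 1" for c s :: real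
  proof -
    \<comment> \<open>For the angle \<phi> this is -tan(\<phi>/2), the slope of the two outer
      shears. It breaks down at the half turn.\<close>
    define k where "k = - s / (1 + c)"
    have c1: "1 + c \<noteq> 0" using cs by auto
    have "s * s = (1 + c) * (1 - c)" using cs by (simp add: power2_eq_square algebra_simps)
    then have sk: "1 + s * k = c" using c1 by (simp add: k_def field_simps)
    have kc: "k * (1 + c) = - s" using c1 by (simp add: k_def)
    let ?S1 = "\<lambda>(x, y). (x + k * y, y :: real)" and ?S2 = "\<lambda>(x :: real, y). (x, y + s * x)"
    have [measurable]: "?S1 \<in> borel_measurable borel" "?S2 \<in> borel_measurable borel"
      by (simp_all add: borel_prod[symmetric])
    have "(\<lambda>(x, y). (c * x - s * y, s * x + c * y)) = ?S1 \<circ> (?S2 \<circ> ?S1)"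
    proof (rule ext, clarify)
      fix x y :: real
      have "y + s * (x + k * y) = s * x + (1 + s * k) * y"
        "x + k * y + k * (y + s * (x + k * y)) = (1 + s * k) * x + (k * (1 + (1 + s * k))) * y"
        by (simp_all add: algebra_simps)
      then show "(c * x - s * y, s * x + c * y) = (?S1 \<circ> (?S2 \<circ> ?S1)) (x, y)"
        unfolding sk kc by simp
    qed
    then have "distr lborel borel (\<lambda>(x, y). (c * x - s * y, s * x + c * y)) =
       distr (distr (distr lborel borel ?S1) borel ?S2) borel ?S1"
      by (simp add: distr_distr)
    then show ?thesis by (simp only: distr_lborel_shear_fst distr_lborel_shear_snd)
  qed
  show ?thesis
  proof (cases "cos \<phi> = - 1")
    case False
    then show ?thesis using A[of "cos \<phi>" "sin \<phi>"]
      by (simp add: rot_def case_prod_beta mult.commute)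
  next
    case True
    then have s: "sin \<phi> = 0" using sin_cos_squared_add[of \<phi>] by simp
    \<comment> \<open>The half turn is treated as the square of the quarter turn, to which the shear
      decomposition applies.\<close>
    let ?q = "\<lambda>(x, y). (0 * x - 1 * y, 1 * x + 0 * y :: real)"
    have [measurable]: "?q \<in> borel_measurable borel"
      by (simp add: borel_prod[symmetric])
    have "rot \<phi> = ?q \<circ> ?q" using True s by (auto simp: rot_def)
    then have "distr lborel borel (rot \<phi>) = distr (distr lborel borel ?q) borel ?q"
      by (simp only:) (rule distr_distr[symmetric], measurable)
    then show ?thesis using A[of 0 1] by simp
  qed
qed

lemma borel_measurable_fst [measurable]: "fst \<in> borel_measurable (borel :: (real \<times> real) measure)"
  by (intro borel_measurable_continuous_onI continuous_intros)

lemma borel_measurable_snd [measurable]: "snd \<in> borel_measurable (borel :: (real \<times> real) measure)"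
  by (intro borel_measurable_continuous_onI continuous_intros)

lemma integral_lborel_rot:
  fixes f :: "real \<times> real \<Rightarrow> real"
  assumes [measurable]: "f \<in> borel_measurable borel"
  shows "(\<integral>p. f (rot \<phi> p) \<partial>lborel) = (\<integral>p. f p \<partial>lborel)"
proof -
  have "(\<integral>p. f p \<partial>lborel) = (\<integral>p. f p \<partial>distr lborel borel (rot \<phi>))" by (simp only: distr_lborel_rot)
  also have "\<dots> = (\<integral>p. f (rot \<phi> p) \<partial>lborel)" by (rule integral_distr) measurable
  finally show ?thesis ..
qed

lemma nn_integral_lborel_rot:
  fixes f :: "real \<times> real \<Rightarrow> ennreal"
  assumes [measurable]: "f \<in> borel_measurable borel"
  shows "(\<integral>\<^sup>+p. f (rot \<phi> p) \<partial>lborel) = (\<integral>\<^sup>+p. f p \<partial>lborel)"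
proof -
  have "(\<integral>\<^sup>+p. f p \<partial>lborel) = (\<integral>\<^sup>+p. f p \<partial>distr lborel borel (rot \<phi>))" by (simp only: distr_lborel_rot)
  also have "\<dots> = (\<integral>\<^sup>+p. f (rot \<phi> p) \<partial>lborel)" by (rule nn_integral_distr) measurable
  finally show ?thesis ..
qed

lemma norm_rot: "norm (rot \<phi> p) = norm p"
proof -
  have "(u * cos \<phi> - t * sin \<phi>)\<^sup>2 + (u * sin \<phi> + t * cos \<phi>)\<^sup>2 = (u\<^sup>2 + t\<^sup>2) * (sin \<phi> * sin \<phi> + cos \<phi> * cos \<phi>)" for u t
    unfolding power2_eq_square by (simp add: algebra_simps del: sin_cos_squared_add3)
  moreover have "sin \<phi> * sin \<phi> + cos \<phi> * cos \<phi> = 1" by (simp flip: power2_eq_square)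
  ultimately show ?thesis by (simp add: rot_def norm_prod_def case_prod_beta)
qed

lemma rot_inner: "fst (rot \<phi> p) * cos \<phi> + snd (rot \<phi> p) * sin \<phi> = fst p"
proof -
  have "fst (rot \<phi> p) * cos \<phi> + snd (rot \<phi> p) * sin \<phi> = fst p * (sin \<phi> * sin \<phi> + cos \<phi> * cos \<phi>)"
    unfolding rot_def case_prod_beta by (simp add: algebra_simps del: sin_cos_squared_add3)
  moreover have "sin \<phi> * sin \<phi> + cos \<phi> * cos \<phi> = 1" by (simp flip: power2_eq_square)
  ultimately show ?thesis by simp
qed

lemma inner_dir_le:
  assumes "norm (p :: real \<times> real) \<le> 1" shows "\<bar>fst p * cos \<phi> + snd p * sin \<phi>\<bar> \<le> 1"
proof -
  have "norm (rot (- \<phi>) p) \<le> 1" using assms by (simp add: norm_rot)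
  moreover have "fst (rot (- \<phi>) p) = fst p * cos \<phi> + snd p * sin \<phi>" by (simp add: rot_def case_prod_beta)
  ultimately show ?thesis
    using norm_fst_le[of "fst (rot (- \<phi>) p)" "snd (rot (- \<phi>) p)"]
    by (metis order_trans prod.collapse real_norm_def)
qed

text \<open>For a fixed direction the variables (u, t) are rotated into x, whereupon u becomes the
  inner product of x with that direction; the angular integral is then taken inside. A bound of
  \<open>V\<close> for \<bar>u\<bar> at most 1 suffices because \<open>F\<close> lives on the unit
  disk. Pairing \<open>radon\<close> with a bounded function thus becomes pairing \<open>F\<close>
  with a back projection.\<close>

lemma radon_fubini:
  fixes F V :: "real \<times> real \<Rightarrow> real"
  assumes F: "integrable lborel F" and supp: "\<And>x. norm x > 1 \<Longrightarrow> F x = 0"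
    and V[measurable]: "V \<in> borel_measurable borel"
    and bd: "\<And>u \<phi>. \<bar>u\<bar> \<le> 1 \<Longrightarrow> \<bar>V (u, \<phi>)\<bar> \<le> B"
  shows "integrable lborel (\<lambda>p. indicator {0..2 * pi} (snd p) * V p * (\<integral>t. F (rot (snd p) (fst p, t)) \<partial>lborel))"
    and "(\<integral>p. indicator {0..2 * pi} (snd p) * V p * (\<integral>t. F (rot (snd p) (fst p, t)) \<partial>lborel) \<partial>lborel) =
     (\<integral>x. F x * (\<integral>\<phi>. V (fst x * cos \<phi> + snd x * sin \<phi>, \<phi>) \<partial>circ) \<partial>lborel)"
proof -
  have [measurable]: "F \<in> borel_measurable borel" using F by simp
  let ?I = "indicator {0..2 * pi} :: real \<Rightarrow> real"
  define K where "K \<phi> p = ?I \<phi> * V (fst p, \<phi>) * F (rot \<phi> p)" for \<phi> p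
  have [measurable]: "(\<lambda>x. K (f x) (g x)) \<in> borel_measurable M"
    if [measurable]: "f \<in> borel_measurable M" "g \<in> borel_measurable M" for f g and M :: "'a measure"
    unfolding K_def by measurable
  have B: "B \<ge> 0" using bd[of 0 0] by simp
  have K_le: "norm (K \<phi> p) \<le> B * (?I \<phi> * norm (F (rot \<phi> p)))" for \<phi> p
  proof (cases "norm p > 1")
    case True
    then show ?thesis using B by (simp add: K_def supp norm_rot)
  next
    case False
    then have "\<bar>fst p\<bar> \<le> 1" using norm_fst_le[of "fst p" "snd p"] by simp
    then show ?thesis using bd[of "fst p" \<phi>] B
      by (auto simp: K_def abs_mult indicator_def intro!: mult_right_mono)
  qed
  have FI: "(\<integral>\<^sup>+p. norm (F p) \<partial>lborel) < \<infinity>" using F by (simp add: integrable_iff_bounded)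
  have KB: "(\<integral>\<^sup>+\<phi>. ennreal (B * ?I \<phi>) * (\<integral>\<^sup>+p. norm (F p) \<partial>lborel) \<partial>lborel) < \<infinity>"
  proof -
    have "(\<integral>\<^sup>+\<phi>. ennreal (B * ?I \<phi>) * (\<integral>\<^sup>+p. norm (F p) \<partial>lborel) \<partial>lborel) =
       (\<integral>\<^sup>+\<phi>. ennreal B * indicator {0..2 * pi} \<phi> \<partial>lborel) * (\<integral>\<^sup>+p. norm (F p) \<partial>lborel)"
      by (subst nn_integral_multc[symmetric]) (auto intro!: nn_integral_cong simp: indicator_def)
    also have "\<dots> < \<infinity>"
      using FI by (simp add: nn_integral_cmult_indicator ennreal_mult_less_top)
    finally show ?thesis .
  qed
  have KI: "(\<integral>\<^sup>+\<phi>. \<integral>\<^sup>+p. norm (K \<phi> p) \<partial>lborel \<partial>lborel) < \<infinity>"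
  proof -
    have "(\<integral>\<^sup>+\<phi>. \<integral>\<^sup>+p. norm (K \<phi> p) \<partial>lborel \<partial>lborel) \<le>
      (\<integral>\<^sup>+\<phi>. \<integral>\<^sup>+p. ennreal (B * ?I \<phi>) * norm (F (rot \<phi> p)) \<partial>lborel \<partial>lborel)"
      using K_le B by (intro nn_integral_mono) (simp add: mult.assoc flip: ennreal_mult)
    also have "\<dots> = (\<integral>\<^sup>+\<phi>. ennreal (B * ?I \<phi>) * (\<integral>\<^sup>+p. norm (F p) \<partial>lborel) \<partial>lborel)"
      using nn_integral_lborel_rot[of "\<lambda>p. ennreal (norm (F p))"]
      by (intro nn_integral_cong) (simp add: nn_integral_cmult)
    also have "\<dots> < \<infinity>" by (rule KB)
    finally show ?thesis .
  qed
  have K\<phi>: "integrable lborel (K \<phi>)" for \<phi>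
  proof (rule Bochner_Integration.integrable_bound)
    have "integrable (distr lborel borel (rot \<phi>)) F" by (simp only: distr_lborel_rot F)
    then have "integrable lborel (\<lambda>p. F (rot \<phi> p))" by (subst (asm) integrable_distr_eq) simp_all
    then show "integrable lborel (\<lambda>p. B * (?I \<phi> * norm (F (rot \<phi> p))))" by simp
    show "AE p in lborel. norm (K \<phi> p) \<le> norm (B * (?I \<phi> * norm (F (rot \<phi> p))))"
      using K_le B by (auto simp: abs_mult)
  qed (simp add: K_def)
  have J: "(\<integral>u. \<integral>t. K \<phi> (u, t) \<partial>lborel \<partial>lborel) = (\<integral>p. K \<phi> p \<partial>lborel)" for \<phi>
    using lborel_pair.integral_fst'[of "K \<phi>"] K\<phi>[of \<phi>] by (simp add: lborel_prod)
  \<comment> \<open>On slices where the integral diverges it has the default value 0, so the bound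
    holds there too.\<close>
  have inner_le: "ennreal (norm (\<integral>t. K \<phi> (u, t) \<partial>lborel)) \<le> (\<integral>\<^sup>+t. norm (K \<phi> (u, t)) \<partial>lborel)" for \<phi> u
    by (cases "integrable lborel (\<lambda>t. K \<phi> (u, t))")
      (use integral_norm_bound_ennreal[of lborel "\<lambda>t. K \<phi> (u, t)"] in \<open>simp_all add: not_integrable_integral_eq\<close>)
  let ?G = "\<lambda>u \<phi>. \<integral>t. K \<phi> (u, t) \<partial>lborel"
  have Gint: "integrable (lborel \<Otimes>\<^sub>M lborel) (case_prod ?G)"
  proof (rule integrableI_bounded)
    show Gm: "case_prod ?G \<in> borel_measurable (lborel \<Otimes>\<^sub>M lborel)"
      unfolding case_prod_beta by measurable
    have "(\<integral>\<^sup>+p. norm (case_prod ?G p) \<partial>(lborel \<Otimes>\<^sub>M lborel)) = (\<integral>\<^sup>+\<phi>. \<integral>\<^sup>+u. norm (?G u \<phi>) \<partial>lborel \<partial>lborel)"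
      by (subst lborel_pair.nn_integral_snd[symmetric]) (use Gm in simp_all)
    also have "\<dots> \<le> (\<integral>\<^sup>+\<phi>. \<integral>\<^sup>+u. \<integral>\<^sup>+t. norm (K \<phi> (u, t)) \<partial>lborel \<partial>lborel \<partial>lborel)"
      by (intro nn_integral_mono inner_le)
    also have "\<dots> = (\<integral>\<^sup>+\<phi>. \<integral>\<^sup>+p. norm (K \<phi> p) \<partial>lborel \<partial>lborel)"
      by (intro nn_integral_cong, subst lborel.nn_integral_fst) (simp_all add: lborel_prod)
    finally show "(\<integral>\<^sup>+p. norm (case_prod ?G p) \<partial>(lborel \<Otimes>\<^sub>M lborel)) < \<infinity>" using KI by (rule le_less_trans)
  qed
  define K' where "K' \<phi> x = ?I \<phi> * V (fst x * cos \<phi> + snd x * sin \<phi>, \<phi>) * F x" for \<phi> x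
  have K'_le: "norm (K' \<phi> x) \<le> B * ?I \<phi> * norm (F x)" for \<phi> x
  proof (cases "norm x > 1")
    case False
    then have "\<bar>fst x * cos \<phi> + snd x * sin \<phi>\<bar> \<le> 1" by (simp add: inner_dir_le)
    then show ?thesis using bd[of "fst x * cos \<phi> + snd x * sin \<phi>" \<phi>] B
      by (auto simp: K'_def abs_mult indicator_def intro!: mult_right_mono)
  qed (use B in \<open>simp add: K'_def supp\<close>)
  have K'int: "integrable (lborel \<Otimes>\<^sub>M lborel) (case_prod K')"
  proof (rule integrableI_bounded)
    show Km: "case_prod K' \<in> borel_measurable (lborel \<Otimes>\<^sub>M lborel)"
      unfolding case_prod_beta K'_def by measurable
    have "(\<integral>\<^sup>+p. norm (case_prod K' p) \<partial>(lborel \<Otimes>\<^sub>M lborel)) = (\<integral>\<^sup>+\<phi>. \<integral>\<^sup>+x. norm (K' \<phi> x) \<partial>lborel \<partial>lborel)"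
      by (subst lborel.nn_integral_fst[symmetric]) (use Km in simp_all)
    also have "\<dots> \<le> (\<integral>\<^sup>+\<phi>. \<integral>\<^sup>+x. ennreal (B * ?I \<phi>) * norm (F x) \<partial>lborel \<partial>lborel)"
      using K'_le B by (intro nn_integral_mono) (simp flip: ennreal_mult)
    also have "\<dots> = (\<integral>\<^sup>+\<phi>. ennreal (B * ?I \<phi>) * (\<integral>\<^sup>+p. norm (F p) \<partial>lborel) \<partial>lborel)"
      by (intro nn_integral_cong) (simp add: nn_integral_cmult)
    also have "\<dots> < \<infinity>" by (rule KB)
    finally show "(\<integral>\<^sup>+p. norm (case_prod K' p) \<partial>(lborel \<Otimes>\<^sub>M lborel)) < \<infinity>" .
  qed
  have "(\<integral>p. ?I (snd p) * V p * (\<integral>t. F (rot (snd p) (fst p, t)) \<partial>lborel) \<partial>lborel) =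
     (\<integral>p. case_prod ?G p \<partial>(lborel \<Otimes>\<^sub>M lborel))"
    unfolding lborel_prod by (intro Bochner_Integration.integral_cong refl) (simp add: K_def case_prod_beta)
  also have "\<dots> = (\<integral>\<phi>. \<integral>u. ?G u \<phi> \<partial>lborel \<partial>lborel)"
    by (rule lborel_pair.integral_snd[OF Gint, symmetric])
  also have "\<dots> = (\<integral>\<phi>. \<integral>x. K' \<phi> x \<partial>lborel \<partial>lborel)"
  proof (intro Bochner_Integration.integral_cong refl)
    fix \<phi>
    have "K' \<phi> \<in> borel_measurable borel" unfolding K'_def by measurable
    from integral_lborel_rot[OF this, of \<phi>]
    have "(\<integral>p. K \<phi> p \<partial>lborel) = (\<integral>x. K' \<phi> x \<partial>lborel)"
      by (simp add: K'_def K_def rot_inner)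
    then show "(\<integral>u. ?G u \<phi> \<partial>lborel) = (\<integral>x. K' \<phi> x \<partial>lborel)"
      unfolding J .
  qed
  also have "\<dots> = (\<integral>x. \<integral>\<phi>. K' \<phi> x \<partial>lborel \<partial>lborel)"
    using lborel_pair.integral_fst'[OF K'int] lborel_pair.integral_snd[OF K'int] by simp
  also have "\<dots> = (\<integral>x. F x * (\<integral>\<phi>. V (fst x * cos \<phi> + snd x * sin \<phi>, \<phi>) \<partial>circ) \<partial>lborel)"
    unfolding integral_circ_eq integral_mult_right_zero[symmetric]
    by (intro Bochner_Integration.integral_cong refl) (simp add: K'_def mult_ac)
  finally show "(\<integral>p. ?I (snd p) * V p * (\<integral>t. F (rot (snd p) (fst p, t)) \<partial>lborel) \<partial>lborel) =
     (\<integral>x. F x * (\<integral>\<phi>. V (fst x * cos \<phi> + snd x * sin \<phi>, \<phi>) \<partial>circ) \<partial>lborel)" .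
  show "integrable lborel (\<lambda>p. ?I (snd p) * V p * (\<integral>t. F (rot (snd p) (fst p, t)) \<partial>lborel))"
    using Gint by (simp add: K_def case_prod_beta' lborel_prod)
qed

section \<open>Inner products of square-integrable functions\<close>

lemma integrable_L2_mult:
  assumes f: "f \<in> L2 M" and g: "g \<in> L2 M"
  shows "integrable M (\<lambda>x. f x * g x)"
proof (rule Bochner_Integration.integrable_bound)
  show "integrable M (\<lambda>x. (f x)\<^sup>2 + (g x)\<^sup>2)" using f g by (simp add: L2_def)
  show "(\<lambda>x. f x * g x) \<in> borel_measurable M" using f g by (auto simp: L2_def)
  have "\<bar>a * b\<bar> \<le> a\<^sup>2 + b\<^sup>2" for a b :: real
  proof -
    have "2 * (\<bar>a\<bar> * \<bar>b\<bar>) \<le> \<bar>a\<bar>\<^sup>2 + \<bar>b\<bar>\<^sup>2" using sum_squares_bound[of "\<bar>a\<bar>" "\<bar>b\<bar>"] by simp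
    moreover have "0 \<le> \<bar>a\<bar> * \<bar>b\<bar>" by simp
    ultimately show ?thesis unfolding abs_mult power2_abs by linarith
  qed
  then show "AE x in M. norm (f x * g x) \<le> norm ((f x)\<^sup>2 + (g x)\<^sup>2)"
    by (intro AE_I2) (smt (verit) real_norm_def zero_le_power2)
qed

lemma L2_scale: "f \<in> L2 M \<Longrightarrow> (\<lambda>x. c * f x) \<in> L2 M"
  by (auto simp: L2_def power_mult_distrib)

lemma L2_add: "f \<in> L2 M \<Longrightarrow> g \<in> L2 M \<Longrightarrow> (\<lambda>x. f x + g x) \<in> L2 M"
  using integrable_L2_mult[of f M g] by (auto simp: L2_def power2_sum mult.assoc)

lemma L2_diff: "f \<in> L2 M \<Longrightarrow> g \<in> L2 M \<Longrightarrow> (\<lambda>x. f x - g x) \<in> L2 M"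
  using L2_add[of f M "\<lambda>x. - 1 * g x"] L2_scale[of g M "- 1"] by simp

lemma L2_zero: "(\<lambda>x. 0) \<in> L2 M" by (simp add: L2_def)

lemma L2_sum: "(\<And>i. i \<in> I \<Longrightarrow> f i \<in> L2 M) \<Longrightarrow> (\<lambda>x. \<Sum>i\<in>I. f i x) \<in> L2 M"
  by (induction I rule: infinite_finite_induct) (auto simp: L2_zero intro: L2_add)

lemma l2_inner_commute: "l2_inner M f g = l2_inner M g f"
  by (simp add: l2_inner_def mult.commute)

lemma l2_inner_add: "f \<in> L2 M \<Longrightarrow> g \<in> L2 M \<Longrightarrow> h \<in> L2 M \<Longrightarrow>
    l2_inner M (\<lambda>x. f x + g x) h = l2_inner M f h + l2_inner M g h"
  by (simp add: l2_inner_def ring_distribs integrable_L2_mult)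

lemma l2_inner_diff: "f \<in> L2 M \<Longrightarrow> g \<in> L2 M \<Longrightarrow> h \<in> L2 M \<Longrightarrow>
    l2_inner M (\<lambda>x. f x - g x) h = l2_inner M f h - l2_inner M g h"
  by (simp add: l2_inner_def left_diff_distrib integrable_L2_mult)

lemma l2_inner_diff_right: "f \<in> L2 M \<Longrightarrow> g \<in> L2 M \<Longrightarrow> h \<in> L2 M \<Longrightarrow>
    l2_inner M h (\<lambda>x. f x - g x) = l2_inner M h f - l2_inner M h g"
  by (simp add: l2_inner_def right_diff_distrib integrable_L2_mult)

lemma l2_inner_scale: "l2_inner M (\<lambda>x. c * f x) g = c * l2_inner M f g"
  by (simp add: l2_inner_def mult.assoc)

lemma l2_inner_scale_right: "l2_inner M f (\<lambda>x. c * g x) = c * l2_inner M f g"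
  by (simp add: l2_inner_def mult.left_commute)

lemma l2_inner_sum:
  assumes "\<And>i. i \<in> I \<Longrightarrow> f i \<in> L2 M" "g \<in> L2 M"
  shows "l2_inner M (\<lambda>x. \<Sum>i\<in>I. f i x) g = (\<Sum>i\<in>I. l2_inner M (f i) g)"
  using assms
proof (induction I rule: infinite_finite_induct)
  case (insert i I)
  then show ?case by (simp add: l2_inner_add L2_sum)
qed (simp_all add: l2_inner_def)

lemma l2_norm_sq: "(l2_norm M f)\<^sup>2 = l2_inner M f f"
  by (simp add: l2_norm_def l2_inner_def)

lemma l2_inner_self_nonneg: "0 \<le> l2_inner M f f"
  by (simp add: l2_inner_def)

lemma l2_norm_nonneg: "0 \<le> l2_norm M f"
  by (simp add: l2_norm_def l2_inner_self_nonneg)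

lemma l2_inner_cong_AE:
  assumes "AE x in M. f x = f' x" "AE x in M. g x = g' x"
    and "f \<in> borel_measurable M" "f' \<in> borel_measurable M" "g \<in> borel_measurable M" "g' \<in> borel_measurable M"
  shows "l2_inner M f g = l2_inner M f' g'"
  unfolding l2_inner_def using assms by (intro integral_cong_AE) auto

lemma l2_cauchy_schwarz:
  assumes f: "f \<in> L2 M" and g: "g \<in> L2 M"
  shows "\<bar>l2_inner M f g\<bar> \<le> l2_norm M f * l2_norm M g"
proof -
  define a b c where "a = l2_inner M f f" and "b = l2_inner M f g" and "c = l2_inner M g g"
  have q: "0 \<le> a - 2 * t * b + t\<^sup>2 * c" for t
  proof -
    have tg: "(\<lambda>x. t * g x) \<in> L2 M" by (rule L2_scale[OF g])
    have "l2_inner M (\<lambda>x. f x - t * g x) (\<lambda>x. f x - t * g x) = a - 2 * t * b + t\<^sup>2 * c"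
      using f g tg L2_diff[OF f tg]
      by (simp add: l2_inner_diff l2_inner_diff_right l2_inner_scale l2_inner_scale_right a_def b_def c_def
          l2_inner_commute[of M g f] power2_eq_square algebra_simps)
    then show ?thesis using l2_inner_self_nonneg by metis
  qed
  have c: "c \<ge> 0" "a \<ge> 0" by (simp_all add: c_def a_def l2_inner_self_nonneg)
  have "b\<^sup>2 \<le> a * c"
  proof (cases "c = 0")
    case True
    have "b = 0"
    proof (rule ccontr)
      assume "b \<noteq> 0"
      \<comment> \<open>This \<open>t\<close> makes the form equal to -1: with c = 0 it is a - 2tb,
        which can be nonnegative for all t only if b = 0.\<close>
      then show False using q[of "(a + 1) / (2 * b)"] True by (simp add: field_simps)
    qed
    then show ?thesis using True by simp
  next
    case False
    then show ?thesis using q[of "b / c"] c by (simp add: field_simps power2_eq_square)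
  qed
  then have "\<bar>b\<bar> \<le> sqrt (a * c)" by (metis real_sqrt_abs real_sqrt_le_mono)
  then show ?thesis by (simp add: a_def b_def c_def l2_norm_def real_sqrt_mult)
qed

section \<open>The measures on the disk and on the strip\<close>

lemma finite_measure_disk: "finite_measure disk"
  unfolding disk_def
  by (rule finite_measureI) (simp add: space_restrict_space emeasure_restrict_space, metis bounded_cball emeasure_bounded_finite infinity_ennreal_def less_irrefl)

lemma space_disk: "space disk = cball 0 1"
  by (simp add: disk_def space_restrict_space)

lemma disk_measurable_iff:
  fixes f :: "real \<times> real \<Rightarrow> real"
  shows "f \<in> borel_measurable disk \<longleftrightarrow> (\<lambda>x. indicator (cball 0 1) x * f x) \<in> borel_measurable borel"
  unfolding disk_def by (subst borel_measurable_restrict_space_iff) auto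

lemma integral_disk:
  fixes f :: "real \<times> real \<Rightarrow> real"
  shows "(\<integral>x. f x \<partial>disk) = (\<integral>x. indicator (cball 0 1) x * f x \<partial>lborel)"
  unfolding disk_def by (subst integral_restrict_space) auto

lemma integrable_disk_iff:
  fixes f :: "real \<times> real \<Rightarrow> real"
  shows "integrable disk f \<longleftrightarrow> integrable lborel (\<lambda>x. indicator (cball 0 1) x * f x)"
  unfolding disk_def by (subst integrable_restrict_space) auto

lemma L2_disk_integrable: "f \<in> L2 disk \<Longrightarrow> integrable disk f"
proof -
  assume f: "f \<in> L2 disk"
  interpret finite_measure disk by (rule finite_measure_disk)
  have "(\<lambda>x. 1) \<in> L2 disk" by (simp add: L2_def)
  from integrable_L2_mult[OF f this] show ?thesis by simp
qed

lemma L2_disk_bounded: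
  assumes "f \<in> borel_measurable borel" "\<And>x. norm x \<le> 1 \<Longrightarrow> \<bar>f x\<bar> \<le> B"
  shows "f \<in> L2 disk"
proof -
  interpret finite_measure disk by (rule finite_measure_disk)
  have m: "f \<in> borel_measurable disk" unfolding disk_def
    by (intro measurable_restrict_space1) (simp add: assms(1))
  have "\<bar>f x\<bar>\<^sup>2 \<le> B\<^sup>2" if "norm x \<le> 1" for x
    using assms(2)[OF that] by (intro power_mono) auto
  then have "integrable disk (\<lambda>x. (f x)\<^sup>2)"
    using m by (intro integrable_const_bound[of _ "B\<^sup>2"]) (auto intro!: AE_I2 simp: space_disk)
  then show ?thesis using m by (simp add: L2_def)
qed

abbreviation strip :: "(real \<times> real) set" where "strip \<equiv> {0..1} \<times> {0..2 * pi}"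

definition nu_weight :: "real \<times> real \<Rightarrow> real" where "nu_weight p = 2 / pi * sqrt (1 - (fst p)\<^sup>2)"

lemma nu_weight_measurable [measurable]: "nu_weight \<in> borel_measurable borel"
  unfolding nu_weight_def by measurable

lemma strip_sets: "strip \<in> sets borel"
  by (intro borel_closed closed_Times) auto

lemma nu_eq: "nu = density (restrict_space lborel strip) (\<lambda>p. ennreal (nu_weight p))"
  by (simp add: nu_def nu_weight_def case_prod_beta')

lemma nu_weight_nonneg: "p \<in> strip \<Longrightarrow> 0 \<le> nu_weight p"
  by (auto simp: nu_weight_def abs_square_le_1)

lemma nu_measurable: "f \<in> borel_measurable borel \<Longrightarrow> f \<in> borel_measurable nu"
  unfolding nu_eq by (auto intro: measurable_restrict_space1)

lemma integral_nu:
  fixes f :: "real \<times> real \<Rightarrow> real"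
  assumes [measurable]: "f \<in> borel_measurable borel"
  shows "(\<integral>p. f p \<partial>nu) = (\<integral>p. indicator strip p * (nu_weight p * f p) \<partial>lborel)"
proof -
  have "(\<integral>p. f p \<partial>nu) = (\<integral>p. nu_weight p * f p \<partial>restrict_space lborel strip)"
    unfolding nu_eq using nu_weight_nonneg
    by (intro integral_real_density)
      (auto intro!: measurable_restrict_space1 AE_I2 simp: space_restrict_space)
  also have "\<dots> = (\<integral>p. indicator strip p * (nu_weight p * f p) \<partial>lborel)"
    using strip_sets by (subst integral_restrict_space) auto
  finally show ?thesis .
qed

lemma AE_nu: "(AE p in lborel. p \<in> strip \<longrightarrow> P p) \<Longrightarrow> Measurable.pred borel P \<Longrightarrow> AE p in nu. P p"
  unfolding nu_eq using strip_sets
  by (subst AE_density) (auto intro!: measurable_restrict_space1 simp: AE_restrict_space_iff)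

lemma finite_measure_nu: "finite_measure nu"
proof (rule finite_measureI)
  have "emeasure nu (space nu) = (\<integral>\<^sup>+p. ennreal (nu_weight p) \<partial>restrict_space lborel strip)"
    unfolding nu_eq
    by (subst emeasure_density)
      (use sets.top[of "restrict_space lborel strip"] in
        \<open>auto intro!: nn_integral_cong measurable_restrict_space1 simp: space_restrict_space\<close>)
  also have "\<dots> \<le> (\<integral>\<^sup>+p. ennreal (2 / pi) \<partial>restrict_space lborel strip)"
    by (intro nn_integral_mono ennreal_leI)
      (auto simp: space_restrict_space nu_weight_def mult_le_cancel_left1 divide_simps)
  also have "\<dots> < \<infinity>"
    using strip_sets
    by (simp add: emeasure_restrict_space space_restrict_space lborel_prod[symmetric] lborel.emeasure_pair_measure_Times
        ennreal_mult_less_top flip: ennreal_mult)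
  finally show "emeasure nu (space nu) \<noteq> \<infinity>" by simp
qed

lemma L2_nu_bounded:
  assumes "f \<in> borel_measurable borel" "\<And>p. p \<in> strip \<Longrightarrow> \<bar>f p\<bar> \<le> B"
  shows "f \<in> L2 nu"
proof -
  interpret finite_measure nu by (rule finite_measure_nu)
  have sp: "space nu = strip" by (simp add: nu_eq space_restrict_space)
  have m: "f \<in> borel_measurable nu" using assms(1) by (rule nu_measurable)
  have "\<bar>f x\<bar>\<^sup>2 \<le> B\<^sup>2" if "x \<in> strip" for x
    using assms(2)[OF that] by (intro power_mono) auto
  then have "integrable nu (\<lambda>x. (f x)\<^sup>2)"
    using m by (intro integrable_const_bound[of _ "B\<^sup>2"]) (auto intro!: AE_I2 simp: sp)
  then show ?thesis using m by (simp add: L2_def)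
qed

lemma abs_cheb_U_le:
  assumes "\<bar>x\<bar> \<le> 1" shows "\<bar>cheb_U n x\<bar> \<le> real n + 1"
proof -
  have "cheb_U n x = (\<Sum>k\<le>n. cos ((real n - 2 * real k) * arccos x))"
    using assms by (subst cheb_U_cos_sum[symmetric]) (simp add: cos_arccos_abs)
  also have "\<bar>\<dots>\<bar> \<le> (\<Sum>k\<le>n. \<bar>cos ((real n - 2 * real k) * arccos x)\<bar>)" by (rule sum_abs)
  also have "\<dots> \<le> (\<Sum>k\<le>n. 1)" by (intro sum_mono) simp
  finally show ?thesis by simp
qed

lemma abs_integral_circ_le:
  assumes "\<And>t. \<bar>f t\<bar> \<le> B" shows "\<bar>\<integral>t. f t \<partial>circ\<bar> \<le> B * (2 * pi)"
proof (cases "integrable circ f")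
  case True
  interpret finite_measure circ by (rule finite_measure_circ)
  have "\<bar>\<integral>t. f t \<partial>circ\<bar> \<le> (\<integral>t. \<bar>f t\<bar> \<partial>circ)" by (rule integral_abs_bound)
  also have "\<dots> \<le> (\<integral>t. B \<partial>circ)" using True assms by (intro integral_mono) auto
  also have "\<dots> = B * (2 * pi)" by (simp add: space_restrict_space measure_restrict_space)
  finally show ?thesis .
next
  case False
  have "0 \<le> B" using assms[of 0] by linarith
  then show ?thesis using False by (simp add: not_integrable_integral_eq)
qed

lemma zernike_measurable [measurable]: "zernike i \<in> borel_measurable borel"
proof -
  have "zernike i = (\<lambda>p. zscale i / (2 * pi) *
     (\<integral>t. cheb_U (deg i) (fst p * cos t + snd p * sin t) * trig (freq i) t * indicator {0..2 * pi} t \<partial>lborel))"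
    by (rule ext) (metis (no_types, lifting) integral_circ_eq prod.collapse zernike_eq Bochner_Integration.integral_cong)
  also have "\<dots> \<in> borel_measurable borel" by measurable
  finally show ?thesis .
qed

lemma zscale_pos: "zscale i > 0"
  by (simp add: zscale_def)

lemma zscale_sq: "zscale i * zscale i = (real (deg i) + 1) / pi"
  by (simp add: zscale_def)

text \<open>The second half of the circle cancels the first. This removes the odd part that arises
  when functions on u > 0 are extended by zero to both signs of u.\<close>

lemma integral_circ_antiperiodic:
  fixes f :: "real \<Rightarrow> real"
  assumes f: "integrable circ f" and anti: "\<And>t. f (t + pi) = - f t"
  shows "(\<integral>t. f t \<partial>circ) = 0"
proof -
  have int: "integrable lborel (\<lambda>t. f t * indicator {0..2 * pi} t)"
    using f by (subst (asm) integrable_restrict_space) (auto simp: mult.commute)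
  then have int': "integrable lborel (\<lambda>t. f t * indicator {0..2 * pi} t * indicator A t)" if "A \<in> sets borel" for A
    using integrable_real_mult_indicator[of A lborel] that by simp
  have [simp]: "f t * indicator {0..2 * pi} t * indicator {0..<pi} t = f t * indicator {0..<pi} t"
    "f t * indicator {0..2 * pi} t * indicator {pi..2 * pi} t = f t * indicator {pi..2 * pi} t"
    "f t * indicator {0..2 * pi} t * indicator {0..pi} t = f t * indicator {0..pi} t" for t
    by (auto simp: indicator_def)
  have "(\<integral>t. f t \<partial>circ) = (\<integral>t. f t * indicator {0..<pi} t + f t * indicator {pi..2 * pi} t \<partial>lborel)"
    unfolding integral_circ_eq by (intro Bochner_Integration.integral_cong) (auto simp: indicator_def)
  also have "\<dots> = (\<integral>t. f t * indicator {0..<pi} t \<partial>lborel) + (\<integral>t. f t * indicator {pi..2 * pi} t \<partial>lborel)"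
    using int'[of "{0..<pi}"] int'[of "{pi..2 * pi}"] by (intro Bochner_Integration.integral_add) simp_all
  also have "(\<integral>t. f t * indicator {pi..2 * pi} t \<partial>lborel) =
      (\<integral>t. f (pi + t) * indicator {pi..2 * pi} (pi + t) \<partial>lborel)"
    using lborel_integral_real_affine[of 1 "\<lambda>t. f t * indicator {pi..2 * pi} t" pi] by simp
  also have "\<dots> = (\<integral>t. - (f t * indicator {0..pi} t) \<partial>lborel)"
    using anti by (intro Bochner_Integration.integral_cong) (auto simp: indicator_def add.commute)
  also have "\<dots> = - (\<integral>t. f t * indicator {0..pi} t \<partial>lborel)" by simp
  also have "(\<integral>t. f t * indicator {0..pi} t \<partial>lborel) = (\<integral>t. f t * indicator {0..<pi} t \<partial>lborel)"
  proof (rule integral_cong_AE)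
    show "AE t in lborel. f t * indicator {0..pi} t = f t * indicator {0..<pi} t"
      using AE_lborel_singleton[of pi] by eventually_elim (auto simp: indicator_def)
  qed (use int'[of "{0..<pi}"] int'[of "{0..pi}"] in simp_all)
  finally show ?thesis by simp
qed

lemma AE_fst_neq: "AE p in (lborel :: (real \<times> real) measure). fst p \<noteq> c"
proof (rule AE_I)
  show "{p \<in> space lborel. \<not> fst p \<noteq> c} \<subseteq> {c} \<times> UNIV" by auto
  have "emeasure (lborel \<Otimes>\<^sub>M lborel) ({c} \<times> (UNIV :: real set)) = 0"
    by (subst lborel.emeasure_pair_measure_Times) auto
  then show "emeasure lborel ({c} \<times> (UNIV :: real set)) = 0" by (simp add: lborel_prod)
  show "{c} \<times> UNIV \<in> sets lborel" by (auto intro!: borel_closed closed_Times)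
qed

text \<open>The chord is the part of the line inside the disk. Trading the limits, which depend on
  \<open>u\<close>, for an indicator of the disk prepares for Fubini. For \<bar>u\<bar> > 1 the
  identity persists: \<open>sqrt\<close> of a negative number is negative, so the interval is
  empty.\<close>

lemma radon_eq:
  "radon f (u, \<phi>) = pi / (2 * sqrt (1 - u\<^sup>2)) *
     (\<integral>t. indicator (cball 0 1) (rot \<phi> (u, t)) * f (rot \<phi> (u, t)) \<partial>lborel)"
proof -
  have "t \<in> {- sqrt (1 - u\<^sup>2)..sqrt (1 - u\<^sup>2)} \<longleftrightarrow> rot \<phi> (u, t) \<in> cball 0 1" for t
  proof -
    have "t \<in> {- sqrt (1 - u\<^sup>2)..sqrt (1 - u\<^sup>2)} \<longleftrightarrow> sqrt (t\<^sup>2) \<le> sqrt (1 - u\<^sup>2)" by auto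
    also have "\<dots> \<longleftrightarrow> u\<^sup>2 + t\<^sup>2 \<le> 1" unfolding real_sqrt_le_iff by linarith
    also have "\<dots> \<longleftrightarrow> rot \<phi> (u, t) \<in> cball 0 1" by (simp add: norm_rot norm_Pair)
    finally show ?thesis .
  qed
  then have "indicator {- sqrt (1 - u\<^sup>2)..sqrt (1 - u\<^sup>2)} t = (indicator (cball 0 1) (rot \<phi> (u, t)) :: real)" for t
    by (simp add: indicator_def)
  then show ?thesis
    by (simp add: radon_def set_lebesgue_integral_def rot_def)
qed

lemma radon_measurable:
  assumes "f \<in> borel_measurable disk" shows "radon f \<in> borel_measurable borel"
proof -
  have [measurable]: "(\<lambda>x. indicator (cball 0 1) x * f x) \<in> borel_measurable borel"
    using assms by (simp add: disk_measurable_iff)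
  have "radon f = (\<lambda>p. pi / (2 * sqrt (1 - (fst p)\<^sup>2)) *
     (\<integral>t. indicator (cball 0 1) (rot (snd p) (fst p, t)) * f (rot (snd p) (fst p, t)) \<partial>lborel))"
    by (rule ext) (metis prod.collapse radon_eq)
  also have "\<dots> \<in> borel_measurable borel"
  proof -
    have "(\<lambda>p. (\<lambda>x. indicator (cball 0 1) x * f x) (rot (snd (fst p)) (fst (fst p), snd p))) \<in> borel_measurable (borel \<Otimes>\<^sub>M lborel)"
      by (rule measurable_compose[of _ _ borel]) measurable
    then have [measurable]: "(\<lambda>(q, t). indicator (cball 0 1) (rot (snd q) (fst q, t)) * f (rot (snd q) (fst q, t))) \<in> borel_measurable (borel \<Otimes>\<^sub>M lborel)"
      by (simp add: case_prod_beta')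
    show ?thesis by measurable
  qed
  finally show ?thesis .
qed

section \<open>Singular functions of the Radon transform\<close>

definition singular_fun :: "nat \<times> nat \<Rightarrow> real \<times> real \<Rightarrow> real" where
  "singular_fun i p = cheb_U (deg i) (fst p) * trig (freq i) (snd p)"

lemma singular_fun_measurable [measurable]: "singular_fun i \<in> borel_measurable borel"
  unfolding singular_fun_def by measurable

lemma abs_singular_fun_le: "\<bar>fst p\<bar> \<le> 1 \<Longrightarrow> \<bar>singular_fun i p\<bar> \<le> (real (deg i) + 1) * 2"
  unfolding singular_fun_def abs_mult by (intro mult_mono abs_cheb_U_le abs_trig_le) auto

text \<open>The arguments (u, \<phi>) and (-u, \<phi> + pi) describe the same line. The signs
  produced by the two factors cancel because degree and frequency have equal parity.\<close>

lemma singular_fun_antipodal: "singular_fun i (- u, \<phi> + pi) = singular_fun i (u, \<phi>)"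
proof -
  have "even (deg i + nat \<bar>freq i\<bar>)" using freq_deg[of i] by (simp add: even_nat_iff)
  then have "(- 1) ^ deg i * (- 1) ^ nat \<bar>freq i\<bar> = (1 :: real)" by (simp flip: power_add)
  then show ?thesis by (simp add: singular_fun_def cheb_U_minus trig_add_pi)
qed

lemma zernike_eq_singular_fun:
  "zernike i x = zscale i / (2 * pi) * (\<integral>\<phi>. singular_fun i (fst x * cos \<phi> + snd x * sin \<phi>, \<phi>) \<partial>circ)"
  using zernike_eq[of i "fst x" "snd x"] by (simp add: singular_fun_def)

lemma abs_zernike_le: "norm x \<le> 1 \<Longrightarrow> \<bar>zernike i x\<bar> \<le> zscale i * ((real (deg i) + 1) * 2)"
proof -
  assume x: "norm x \<le> 1"
  have "\<bar>\<integral>\<phi>. singular_fun i (fst x * cos \<phi> + snd x * sin \<phi>, \<phi>) \<partial>circ\<bar> \<le> (real (deg i) + 1) * 2 * (2 * pi)"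
    by (intro abs_integral_circ_le abs_singular_fun_le) (simp add: inner_dir_le[OF x])
  then have "zscale i / (2 * pi) * \<bar>\<integral>\<phi>. singular_fun i (fst x * cos \<phi> + snd x * sin \<phi>, \<phi>) \<partial>circ\<bar> \<le>
      zscale i / (2 * pi) * ((real (deg i) + 1) * 2 * (2 * pi))"
    using zscale_pos[of i] by (intro mult_left_mono) auto
  then show ?thesis unfolding zernike_eq_singular_fun abs_mult using zscale_pos[of i] by simp
qed

lemma zernike_L2: "zernike i \<in> L2 disk"
  by (rule L2_disk_bounded[OF zernike_measurable abs_zernike_le])

text \<open>The density of \<open>nu\<close> cancels the prefactor of \<open>radon\<close>, which
  leaves the plain line integral of an integrable function. At u = 1 the density is 0, so the
  default value of \<open>radon\<close> is harmless.\<close>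

lemma radon_integrable:
  assumes f: "f \<in> L2 disk" shows "integrable nu (radon f)"
proof -
  define F where "F x = indicator (cball 0 1) x * f x" for x
  have Fint: "integrable lborel F"
    using L2_disk_integrable[OF f] by (simp add: integrable_disk_iff F_def[abs_def])
  have rm: "radon f \<in> borel_measurable borel" using radon_measurable f by (auto simp: L2_def)
  define J where "J p = (\<integral>t. F (rot (snd p) (fst p, t)) \<partial>lborel)" for p
  have "integrable lborel (\<lambda>p. indicator {0..2 * pi} (snd p) * 1 * J p)"
    unfolding J_def by (rule radon_fubini(1)[where V = "\<lambda>_. 1" and B = 1, OF Fint]) (auto simp: F_def)
  then have "integrable lborel (\<lambda>p. indicator strip p * (nu_weight p * radon f p))"
  proof (rule Bochner_Integration.integrable_bound)
    show "(\<lambda>p. indicator strip p * (nu_weight p * radon f p)) \<in> borel_measurable lborel"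
      using rm strip_sets by (intro borel_measurable_times borel_measurable_indicator) auto
    show "AE p in lborel. norm (indicator strip p * (nu_weight p * radon f p)) \<le> norm (indicator {0..2 * pi} (snd p) * 1 * J p)"
    proof (rule AE_I2)
      fix p :: "real \<times> real"
      obtain u \<phi> where u: "p = (u, \<phi>)" by (cases p)
      consider "p \<notin> strip" | "p \<in> strip" "u < 1" | "p \<in> strip" "u = 1" using u by fastforce
      then show "norm (indicator strip p * (nu_weight p * radon f p)) \<le> norm (indicator {0..2 * pi} (snd p) * 1 * J p)"
      proof cases
        case 1
        then show ?thesis by simp
      next
        case 2
        then have "u\<^sup>2 < 1" using u by (simp add: abs_square_less_1)
        then have "nu_weight p * radon f p = J p"
          by (simp add: u nu_weight_def radon_eq J_def F_def)
        then show ?thesis using 2 u by simp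
      next
        case 3
        then show ?thesis using u by (simp add: nu_weight_def)
      qed
    qed
  qed
  then have "integrable (restrict_space lborel strip) (\<lambda>p. nu_weight p *\<^sub>R radon f p)"
    using strip_sets by (subst integrable_restrict_space) auto
  then show ?thesis
    unfolding nu_eq using nu_weight_nonneg rm
    by (subst integrable_density) (auto intro!: measurable_restrict_space1 AE_I2 simp: space_restrict_space)
qed

text \<open>Identifies the adjoint on \<open>singular_fun i\<close> as a multiple of
  \<open>zernike i\<close>. Fubini turns the pairing into an average of
  \<open>singular_fun i\<close> over those directions in which x has positive component; by
  antipodal symmetry this is half the full average, and the full average is the ridge representation
  of \<open>zernike i\<close>.\<close>

lemma l2_inner_radon_singular_fun:
  assumes f: "f \<in> L2 disk"
  shows "l2_inner nu (radon f) (singular_fun i) = pi / zscale i * l2_inner disk f (zernike i)"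
proof -
  define F where "F x = indicator (cball 0 1) x * f x" for x
  have Fint: "integrable lborel F"
    using L2_disk_integrable[OF f] by (simp add: integrable_disk_iff F_def[abs_def])
  have [measurable]: "radon f \<in> borel_measurable borel" "F \<in> borel_measurable borel"
    using radon_measurable f Fint by (auto simp: L2_def)
  \<comment> \<open>The factor is the indicator of u > 0, up to the value 1/2 at u = 0. Its constant
    part gives half of the full average and its sign part is antiperiodic, hence integrates to
    0.\<close>
  define V where "V p = (1 / 2 + sgn (fst p) / 2) * singular_fun i p" for p
  have [measurable]: "V \<in> borel_measurable borel" unfolding V_def by measurable
  have Vb: "\<bar>V (u, \<phi>)\<bar> \<le> (real (deg i) + 1) * 2" if "\<bar>u\<bar> \<le> 1" for u \<phi>
  proof -
    have "\<bar>1 / 2 + sgn u / 2\<bar> \<le> 1" by (simp add: sgn_if)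
    then have "\<bar>V (u, \<phi>)\<bar> \<le> 1 * ((real (deg i) + 1) * 2)"
      unfolding V_def abs_mult using that by (intro mult_mono abs_singular_fun_le) auto
    then show ?thesis by simp
  qed
  define J where "J p = (\<integral>t. F (rot (snd p) (fst p, t)) \<partial>lborel)" for p
  have [measurable]: "J \<in> borel_measurable borel" unfolding J_def by measurable
  have "l2_inner nu (radon f) (singular_fun i) = (\<integral>p. indicator strip p * (nu_weight p * (radon f p * singular_fun i p)) \<partial>lborel)"
    unfolding l2_inner_def by (rule integral_nu) measurable
  also have "\<dots> = (\<integral>p. indicator {0..2 * pi} (snd p) * V p * J p \<partial>lborel)"
  proof (rule integral_cong_AE)
    \<comment> \<open>Two null lines are excluded: u = 0, where \<open>V\<close> carries the factor
      1/2, and u = 1, where \<open>radon\<close> has its default value.\<close>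
    show "AE p in lborel. indicator strip p * (nu_weight p * (radon f p * singular_fun i p)) = indicator {0..2 * pi} (snd p) * V p * J p"
      using AE_fst_neq[of 0] AE_fst_neq[of 1]
    proof eventually_elim
      fix p :: "real \<times> real" assume p: "fst p \<noteq> 0" "fst p \<noteq> 1"
      obtain u \<phi> where u: "p = (u, \<phi>)" by (cases p)
      consider "u < 0" | "0 < u" "u < 1" | "u > 1" using p u by fastforce
      then show "indicator strip p * (nu_weight p * (radon f p * singular_fun i p)) = indicator {0..2 * pi} (snd p) * V p * J p"
      proof cases
        case 1
        then show ?thesis using u by (auto simp: V_def)
      next
        case 2
        then have "u\<^sup>2 < 1" by (simp add: abs_square_less_1)
        then have "nu_weight p * radon f p = J p"
          by (simp add: u nu_weight_def radon_eq J_def F_def)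
        moreover have "indicator strip p = (indicator {0..2 * pi} (snd p) :: real)" "V p = singular_fun i p"
          using 2 u by (auto simp: indicator_def V_def)
        ultimately show ?thesis by (simp add: mult_ac)
      next
        case 3
        have "F (rot \<phi> (u, t)) = 0" for t
        proof -
          have "norm (u, t) > 1" using 3 norm_fst_le[of u t] by simp
          then show ?thesis by (simp add: F_def norm_rot)
        qed
        then have "J p = 0" by (simp add: J_def u)
        moreover have "indicator strip p = (0 :: real)" using 3 u by auto
        ultimately show ?thesis by simp
      qed
    qed
  qed (use strip_sets in measurable)
  also have "\<dots> = (\<integral>x. F x * (\<integral>\<phi>. V (fst x * cos \<phi> + snd x * sin \<phi>, \<phi>) \<partial>circ) \<partial>lborel)"
    unfolding J_def by (rule radon_fubini(2)[where V = V, OF Fint _ _ Vb]) (auto simp: F_def)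
  also have "\<dots> = (\<integral>x. F x * (pi / zscale i * zernike i x) \<partial>lborel)"
  proof (intro Bochner_Integration.integral_cong refl)
    fix x
    show "F x * (\<integral>\<phi>. V (fst x * cos \<phi> + snd x * sin \<phi>, \<phi>) \<partial>circ) = F x * (pi / zscale i * zernike i x)"
    proof (cases "norm x \<le> 1")
      case True
      interpret finite_measure circ by (rule finite_measure_circ)
      let ?u = "\<lambda>\<phi>. fst x * cos \<phi> + snd x * sin \<phi>"
      have b: "\<bar>singular_fun i (?u \<phi>, \<phi>)\<bar> \<le> (real (deg i) + 1) * 2" for \<phi>
        by (intro abs_singular_fun_le) (simp add: inner_dir_le[OF True])
      have m: "(\<lambda>\<phi>. singular_fun i (?u \<phi>, \<phi>)) \<in> borel_measurable circ" "(\<lambda>\<phi>. sgn (?u \<phi>) * singular_fun i (?u \<phi>, \<phi>)) \<in> borel_measurable circ"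
        by (auto intro!: measurable_restrict_space1)
      have i1: "integrable circ (\<lambda>\<phi>. singular_fun i (?u \<phi>, \<phi>))"
        using b m by (intro integrable_const_bound[of _ "(real (deg i) + 1) * 2"]) auto
      have i2: "integrable circ (\<lambda>\<phi>. sgn (?u \<phi>) * singular_fun i (?u \<phi>, \<phi>))"
        using b m by (intro integrable_const_bound[of _ "(real (deg i) + 1) * 2"]) (auto simp: abs_mult sgn_if)
      have z: "(\<integral>\<phi>. sgn (?u \<phi>) * singular_fun i (?u \<phi>, \<phi>) \<partial>circ) = 0"
      proof (rule integral_circ_antiperiodic[OF i2])
        fix t
        have "?u (t + pi) = - ?u t" by simp
        then show "sgn (?u (t + pi)) * singular_fun i (?u (t + pi), t + pi) = - (sgn (?u t) * singular_fun i (?u t, t))"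
          by (simp only: singular_fun_antipodal sgn_minus mult_minus_left)
      qed
      have "(\<integral>\<phi>. V (?u \<phi>, \<phi>) \<partial>circ) = (\<integral>\<phi>. 1 / 2 * singular_fun i (?u \<phi>, \<phi>) + 1 / 2 * (sgn (?u \<phi>) * singular_fun i (?u \<phi>, \<phi>)) \<partial>circ)"
        by (intro Bochner_Integration.integral_cong refl) (simp add: V_def algebra_simps)
      also have "\<dots> = 1 / 2 * (\<integral>\<phi>. singular_fun i (?u \<phi>, \<phi>) \<partial>circ)"
        using i1 i2 z by (subst Bochner_Integration.integral_add) simp_all
      also have "\<dots> = pi / zscale i * zernike i x"
        using zscale_pos[of i] by (simp add: zernike_eq_singular_fun)
      finally show ?thesis by simp
    qed (simp add: F_def)
  qed
  also have "\<dots> = (\<integral>x. pi / zscale i * (indicator (cball 0 1) x * (f x * zernike i x)) \<partial>lborel)"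
    by (intro Bochner_Integration.integral_cong refl) (simp add: F_def)
  also have "\<dots> = pi / zscale i * l2_inner disk f (zernike i)"
    by (simp only: integral_mult_right_zero l2_inner_def integral_disk)
  finally show ?thesis .
qed

text \<open>After exchanging the chord integral with the average over directions, the chord identity
  separates u from the angle, and the remaining convolution with \<open>cheb_U\<close> reproduces
  \<open>trig\<close>. The strict bound keeps away from the division by zero at the end of the range
  of u.\<close>

lemma radon_zernike:
  assumes u: "\<bar>u\<bar> < 1"
  shows "radon (zernike i) (u, \<phi>) = pi * zscale i / (real (deg i) + 1) * singular_fun i (u, \<phi>)"
proof -
  define s where "s = sqrt (1 - u\<^sup>2)"
  have s: "s > 0" using u by (simp add: s_def abs_square_less_1)
  let ?g = "\<lambda>t \<psi>. cheb_U (deg i) (u * cos (\<psi> - \<phi>) + t * sin (\<psi> - \<phi>))"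
  let ?m = "deg i" and ?l = "freq i"
  have z: "zernike i (rot \<phi> (u, t)) = zscale i / (2 * pi) * (\<integral>\<psi>. ?g t \<psi> * trig ?l \<psi> \<partial>circ)" for t
  proof -
    have "(u * cos \<phi> - t * sin \<phi>) * cos \<psi> + (u * sin \<phi> + t * cos \<phi>) * sin \<psi> =
        u * cos (\<psi> - \<phi>) + t * sin (\<psi> - \<phi>)" for \<psi>
      by (simp add: cos_diff sin_diff algebra_simps)
    then show ?thesis unfolding rot_def by (simp add: zernike_eq)
  qed
  define K where "K p = indicator ({- s..s} \<times> {0..2 * pi}) p *\<^sub>R (?g (fst p) (snd p) * trig ?l (snd p))" for p :: "real \<times> real"
  have Kint: "integrable (lborel \<Otimes>\<^sub>M lborel) K"
    unfolding lborel_prod K_def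
    by (intro borel_integrable_compact compact_Times continuous_intros) auto
  have "radon (zernike i) (u, \<phi>) = pi / (2 * s) * (\<integral>t. indicator {- s..s} t * zernike i (rot \<phi> (u, t)) \<partial>lborel)"
    by (simp add: radon_def set_lebesgue_integral_def s_def rot_def)
  also have "(\<integral>t. indicator {- s..s} t * zernike i (rot \<phi> (u, t)) \<partial>lborel) =
      (\<integral>t. zscale i / (2 * pi) * (\<integral>\<psi>. K (t, \<psi>) \<partial>lborel) \<partial>lborel)"
    unfolding z integral_circ_eq K_def
    by (intro Bochner_Integration.integral_cong refl)
      (simp add: indicator_times mult_ac flip: integral_mult_right_zero)
  also have "\<dots> = zscale i / (2 * pi) * (\<integral>t. \<integral>\<psi>. K (t, \<psi>) \<partial>lborel \<partial>lborel)"
    by simp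
  also have "(\<integral>t. \<integral>\<psi>. K (t, \<psi>) \<partial>lborel \<partial>lborel) = (\<integral>\<psi>. \<integral>t. K (t, \<psi>) \<partial>lborel \<partial>lborel)"
    using lborel_pair.integral_fst'[OF Kint] lborel_pair.integral_snd[of "\<lambda>x y. K (x, y)"] Kint by simp
  also have "\<dots> = (\<integral>\<psi>. trig ?l \<psi> * indicator {0..2 * pi} \<psi> * (\<integral>t. ?g t \<psi> * indicator {- s..s} t \<partial>lborel) \<partial>lborel)"
    unfolding K_def
    by (intro Bochner_Integration.integral_cong refl)
      (simp add: indicator_times mult_ac flip: integral_mult_right_zero)
  also have "\<dots> = (\<integral>\<psi>. 2 * s * cheb_U ?m u / (real ?m + 1) *
       (cheb_U ?m (cos (\<phi> - \<psi>)) * trig ?l \<psi> * indicator {0..2 * pi} \<psi>) \<partial>lborel)"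
  proof (intro Bochner_Integration.integral_cong refl)
    fix \<psi>
    have c: "cos (\<psi> - \<phi>) = cos (\<phi> - \<psi>)" by (metis cos_minus minus_diff_eq)
    have "(\<integral>t. ?g t \<psi> * indicator {- s..s} t \<partial>lborel) = 2 * s * cheb_U ?m u * cheb_U ?m (cos (\<phi> - \<psi>)) / (real ?m + 1)"
      using integral_cheb_U_chord[of u ?m "\<psi> - \<phi>"] u unfolding s_def c by simp
    then show "trig ?l \<psi> * indicator {0..2 * pi} \<psi> * (\<integral>t. ?g t \<psi> * indicator {- s..s} t \<partial>lborel) =
       2 * s * cheb_U ?m u / (real ?m + 1) * (cheb_U ?m (cos (\<phi> - \<psi>)) * trig ?l \<psi> * indicator {0..2 * pi} \<psi>)"
      by simp
  qed
  also have "\<dots> = 2 * s * cheb_U ?m u / (real ?m + 1) * (2 * pi * trig ?l \<phi>)"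
    using integral_cheb_U_mult_trig[OF freq_deg, of i \<phi>] by (simp only: integral_mult_right_zero integral_circ_eq)
  finally show ?thesis using s by (simp add: singular_fun_def field_simps)
qed

lemma AE_strip_lt_1: "AE p in lborel. p \<in> strip \<longrightarrow> \<bar>fst p\<bar> < 1"
  using AE_fst_neq[of 1] by eventually_elim auto

lemma l2_inner_nu_radon_zernike:
  assumes q: "q \<in> borel_measurable borel"
  shows "l2_inner nu q (radon (zernike i)) = pi * zscale i / (real (deg i) + 1) * l2_inner nu q (singular_fun i)"
proof -
  have m: "radon (zernike i) \<in> borel_measurable borel"
    using radon_measurable zernike_L2 by (auto simp: L2_def)
  have "AE p in lborel. p \<in> strip \<longrightarrow> radon (zernike i) p = pi * zscale i / (real (deg i) + 1) * singular_fun i p"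
    using AE_strip_lt_1 by eventually_elim (metis prod.collapse radon_zernike)
  then have "AE p in nu. radon (zernike i) p = pi * zscale i / (real (deg i) + 1) * singular_fun i p"
    using m by (intro AE_nu) simp_all
  then have "l2_inner nu q (radon (zernike i)) = l2_inner nu q (\<lambda>p. pi * zscale i / (real (deg i) + 1) * singular_fun i p)"
    using m q by (intro l2_inner_cong_AE) (auto intro!: nu_measurable)
  then show ?thesis by (simp only: l2_inner_scale_right)
qed

definition eigval :: "nat \<times> nat \<Rightarrow> real" where
  "eigval i = pi\<^sup>2 / (real (deg i) + 1)"

text \<open>The eigenvalue is the product of the constants in the two preceding computations, pi *
  zscale / (m + 1) for the transform and pi / zscale for its adjoint.\<close>

lemma radon_zernike_adjoint:
  assumes f: "f \<in> L2 disk"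
  shows "l2_inner nu (radon f) (radon (zernike i)) = eigval i * l2_inner disk f (zernike i)"
proof -
  have "radon f \<in> borel_measurable borel" using radon_measurable f by (auto simp: L2_def)
  then show ?thesis
    using zscale_pos[of i] by (simp add: l2_inner_nu_radon_zernike l2_inner_radon_singular_fun[OF f] eigval_def power2_eq_square)
qed

text \<open>The integral factors. The angular factor forces equal frequencies, hence degrees of
  equal parity, and only then does orthogonality over the half range of u apply. The value is 2/pi *
  pi/4 * 2 pi.\<close>

lemma l2_inner_singular_fun: "l2_inner nu (singular_fun i) (singular_fun j) = (if i = j then pi else 0)"
proof -
  let ?w = "\<lambda>u. sqrt (1 - u\<^sup>2) * cheb_U (deg i) u * cheb_U (deg j) u * indicator {0..1} u"
  let ?t = "\<lambda>\<phi>. trig (freq i) \<phi> * trig (freq j) \<phi> * indicator {0..2 * pi} \<phi>"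
  have i1: "integrable lborel ?w"
  proof -
    have "integrable lborel (\<lambda>u. indicator {0..1} u *\<^sub>R (sqrt (1 - u\<^sup>2) * cheb_U (deg i) u * cheb_U (deg j) u))"
      by (intro borel_integrable_compact continuous_intros) auto
    then show ?thesis by (simp add: mult.commute)
  qed
  have i2: "integrable lborel ?t"
  proof -
    have "integrable lborel (\<lambda>u. indicator {0..2 * pi} u *\<^sub>R (trig (freq i) u * trig (freq j) u))"
      by (intro borel_integrable_compact continuous_intros) auto
    then show ?thesis by (simp add: mult.commute)
  qed
  have "l2_inner nu (singular_fun i) (singular_fun j) = (\<integral>p. indicator strip p * (nu_weight p * (singular_fun i p * singular_fun j p)) \<partial>lborel)"
    unfolding l2_inner_def by (rule integral_nu) measurable
  also have "\<dots> = (\<integral>p. 2 / pi * (?w (fst p) * ?t (snd p)) \<partial>(lborel \<Otimes>\<^sub>M lborel))"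
    unfolding lborel_prod
    by (intro Bochner_Integration.integral_cong refl) (auto simp: singular_fun_def nu_weight_def indicator_def)
  also have "\<dots> = 2 / pi * (\<integral>u. \<integral>\<phi>. ?w u * ?t \<phi> \<partial>lborel \<partial>lborel)"
  proof -
    have "integrable (lborel \<Otimes>\<^sub>M lborel) (\<lambda>p. ?w (fst p) * ?t (snd p))"
    proof (rule lborel_pair.Fubini_integrable)
      show "(\<lambda>p. ?w (fst p) * ?t (snd p)) \<in> borel_measurable (lborel \<Otimes>\<^sub>M lborel)" by measurable
      show "integrable lborel (\<lambda>u. \<integral>\<phi>. norm (?w (fst (u, \<phi>)) * ?t (snd (u, \<phi>))) \<partial>lborel)"
        using integrable_norm[OF i1] by (simp only: norm_mult fst_conv snd_conv integral_mult_right_zero integrable_mult_left)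
      show "AE u in lborel. integrable lborel (\<lambda>\<phi>. ?w (fst (u, \<phi>)) * ?t (snd (u, \<phi>)))"
        using i2 by (simp only: fst_conv snd_conv integrable_mult_right AE_I2 simp_thms eventually_True)
    qed
    from lborel_pair.integral_fst'[OF this] show ?thesis by simp
  qed
  also have "\<dots> = 2 / pi * ((\<integral>u. ?w u \<partial>lborel) * (\<integral>\<phi>. ?t \<phi> \<partial>lborel))"
    by simp
  also have "(\<integral>\<phi>. ?t \<phi> \<partial>lborel) = (if freq i = freq j then 2 * pi else 0)"
    using integral_trig_mult_trig[of "freq i" "freq j"] by (simp only: integral_circ_eq)
  also have "2 / pi * ((\<integral>u. ?w u \<partial>lborel) * (if freq i = freq j then 2 * pi else 0)) = (if i = j then pi else 0)"
  proof (cases "freq i = freq j")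
    case True
    then have "even (deg i + deg j)" using freq_deg(2)[of i] freq_deg(2)[of j] by auto
    from integral_cheb_U_cheb_U[OF this]
    have "(\<integral>u. ?w u \<partial>lborel) = (if deg i = deg j then pi / 4 else 0)" .
    moreover have "deg i = deg j \<longleftrightarrow> i = j" using True by (auto simp: prod_eq_iff)
    ultimately show ?thesis using True by simp
  qed auto
  finally show ?thesis .
qed

text \<open>The pairing of \<open>radon (zernike i)\<close> with \<open>singular_fun j\<close> is
  evaluated in two ways, by the adjoint and by the explicit transform. This moves the inner product
  from the disk to the strip.\<close>

lemma zernike_orthonormal: "l2_inner disk (zernike i) (zernike j) = (if i = j then 1 else 0)"
proof -
  have "pi / zscale j * l2_inner disk (zernike i) (zernike j) = l2_inner nu (radon (zernike i)) (singular_fun j)"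
    by (rule l2_inner_radon_singular_fun[OF zernike_L2, symmetric])
  also have "\<dots> = pi * zscale i / (real (deg i) + 1) * l2_inner nu (singular_fun i) (singular_fun j)"
    using l2_inner_nu_radon_zernike[OF singular_fun_measurable, of j i] by (simp add: l2_inner_commute)
  finally have E: "pi / zscale j * l2_inner disk (zernike i) (zernike j) =
      pi * zscale i / (real (deg i) + 1) * l2_inner nu (singular_fun i) (singular_fun j)" .
  have "l2_inner disk (zernike i) (zernike j) = zscale j / pi * (pi / zscale j * l2_inner disk (zernike i) (zernike j))"
    using zscale_pos[of j] by simp
  also have "\<dots> = zscale j * zscale i / (real (deg i) + 1) * (if i = j then 1 else 0) * pi"
    unfolding E l2_inner_singular_fun by simp
  also have "\<dots> = (if i = j then 1 else 0)"
    by (auto simp: zscale_sq)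
  finally show ?thesis .
qed

lemma abs_radon_zernike_le:
  assumes p: "p \<in> strip"
  shows "\<bar>radon (zernike i) p\<bar> \<le> pi * zscale i / (real (deg i) + 1) * ((real (deg i) + 1) * 2)"
proof -
  let ?c = "pi * zscale i / (real (deg i) + 1)"
  have c: "?c \<ge> 0" using zscale_pos[of i] by simp
  show ?thesis
  proof (cases "fst p = 1")
    case True
    then have "radon (zernike i) p = 0" by (simp add: radon_def case_prod_beta)
    moreover have "0 \<le> ?c * ((real (deg i) + 1) * 2)"
      by (intro mult_nonneg_nonneg[OF c]) auto
    ultimately show ?thesis by simp
  next
    case False
    then have u: "\<bar>fst p\<bar> < 1" using p by auto
    then have "\<bar>radon (zernike i) p\<bar> = ?c * \<bar>singular_fun i p\<bar>"
      using radon_zernike[of "fst p" i "snd p"] zscale_pos[of i] by (simp add: abs_mult)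
    also have "\<dots> \<le> ?c * ((real (deg i) + 1) * 2)"
      using u c by (intro mult_left_mono abs_singular_fun_le) auto
    finally show ?thesis .
  qed
qed

lemma radon_zernike_L2: "radon (zernike i) \<in> L2 nu"
  using radon_measurable zernike_L2 abs_radon_zernike_le
  by (intro L2_nu_bounded[where B = "pi * zscale i / (real (deg i) + 1) * ((real (deg i) + 1) * 2)"]) (auto simp: L2_def)

text \<open>Boundedness of the second factor on the strip combines with integrability of
  \<open>radon f\<close>.\<close>

lemma integrable_radon_mult_zernike:
  assumes f: "f \<in> L2 disk" shows "integrable nu (\<lambda>p. radon f p * radon (zernike i) p)"
proof (rule Bochner_Integration.integrable_bound)
  let ?B = "pi * zscale i / (real (deg i) + 1) * ((real (deg i) + 1) * 2)"
  show "integrable nu (\<lambda>p. radon f p * ?B)" by (intro integrable_mult_left radon_integrable f)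
  have "radon f \<in> borel_measurable borel" "radon (zernike i) \<in> borel_measurable borel"
    using radon_measurable f zernike_L2 by (auto simp: L2_def)
  then show "(\<lambda>p. radon f p * radon (zernike i) p) \<in> borel_measurable nu"
    by (intro nu_measurable borel_measurable_times)
  show "AE p in nu. norm (radon f p * radon (zernike i) p) \<le> norm (radon f p * ?B)"
  proof (rule AE_I2)
    fix p assume "p \<in> space nu"
    then have "p \<in> strip" by (simp add: nu_eq space_restrict_space)
    then have "\<bar>radon (zernike i) p\<bar> \<le> \<bar>?B\<bar>" using abs_radon_zernike_le[of p i] by linarith
    then show "norm (radon f p * radon (zernike i) p) \<le> norm (radon f p * ?B)"
      unfolding real_norm_def abs_mult[of "radon f p"] by (intro mult_left_mono) auto
  qed
qed

text \<open>Zernike functions are bounded on the disk, so each line integral converges and linearity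
  holds at every point, not just almost everywhere.\<close>

lemma radon_sum_zernike:
  assumes "finite I"
  shows "radon (\<lambda>x. \<Sum>i\<in>I. c i * zernike i x) p = (\<Sum>i\<in>I. c i * radon (zernike i) p)"
proof -
  obtain u \<phi> where p: "p = (u, \<phi>)" by (cases p)
  let ?z = "\<lambda>i t. indicator (cball 0 1) (rot \<phi> (u, t)) * zernike i (rot \<phi> (u, t))"
  have int: "integrable lborel (?z i)" for i
  proof (rule Bochner_Integration.integrable_bound)
    let ?B = "zscale i * ((real (deg i) + 1) * 2)"
    have "integrable lborel (\<lambda>t. indicator {- 1..1 :: real} t *\<^sub>R ?B)"
      by (intro borel_integrable_compact continuous_intros) auto
    then show "integrable lborel (\<lambda>t :: real. indicator {- 1..1} t * ?B)" by (simp only: real_scaleR_def)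
    have "(\<lambda>t. rot \<phi> (u, t)) \<in> borel_measurable lborel" by measurable
    then show "?z i \<in> borel_measurable lborel"
      by (rule measurable_compose[where g = "\<lambda>x. indicator (cball 0 1) x * zernike i x"])
        (intro borel_measurable_times borel_measurable_indicator zernike_measurable borel_closed closed_cball)
    show "AE t in lborel. norm (?z i t) \<le> norm (indicator {- 1..1} t * ?B)"
    proof (rule AE_I2)
      fix t
      show "norm (?z i t) \<le> norm (indicator {- 1..1} t * ?B)"
      proof (cases "norm (rot \<phi> (u, t)) \<le> 1")
        case True
        then have "\<bar>t\<bar> \<le> 1" using norm_snd_le[of t u] by (simp add: norm_rot)
        moreover have "?B \<ge> 0" using zscale_pos[of i] by simp
        ultimately show ?thesis using abs_zernike_le[OF True, of i] True by (auto simp: abs_le_iff)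
      qed simp
    qed
  qed
  show ?thesis unfolding p radon_eq
    by (simp add: sum_distrib_left int mult.left_commute[of _ "c _"])
qed

section \<open>White noise\<close>

lemma char_eq_cos_sin:
  assumes "finite_measure M" "sets M = sets borel"
  shows "char M t = Complex (\<integral>x. cos (t * x) \<partial>M) (\<integral>x. sin (t * x) \<partial>M)"
proof -
  interpret finite_measure M by fact
  have [measurable_cong]: "sets M = sets borel" by fact
  have i: "integrable M (\<lambda>x. iexp (t * x))"
    by (intro integrable_const_bound[of _ 1]) auto
  show ?thesis unfolding char_def
    by (rule complex_eqI)
      (simp_all only: integral_Re[OF i, symmetric] integral_Im[OF i, symmetric] complex.sel,
       simp_all add: Re_exp Im_exp)
qed

text \<open>Extends the uniqueness theorem from probability measures. The total mass is the value at
  t = 0, and after dividing by it both measures become distributions; mass zero is treated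
  apart.\<close>

lemma finite_measure_eqI_char:
  fixes M N :: "real measure"
  assumes M: "finite_measure M" "sets M = sets borel" and N: "finite_measure N" "sets N = sets borel"
    and eq: "\<And>t. char M t = char N t"
  shows "M = N"
proof -
  interpret M: finite_measure M by fact
  interpret N: finite_measure N by fact
  have sp: "space M = UNIV" "space N = UNIV" using M N by (auto dest: sets_eq_imp_space_eq)
  define c where "c = measure M UNIV"
  have c: "c = measure N UNIV"
    using eq[of 0] M N sp by (simp add: char_eq_cos_sin c_def)
  have c0: "c \<ge> 0" by (simp add: c_def)
  have em: "emeasure M UNIV = ennreal c" "emeasure N UNIV = ennreal c"
    by (simp_all add: c_def M.emeasure_eq_measure) (simp add: c N.emeasure_eq_measure flip: c_def)
  show ?thesis
  proof (cases "c = 0")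
    case True
    have "emeasure M A = 0" "emeasure N A = 0" for A
      using emeasure_space[of M A] emeasure_space[of N A] em True sp by auto
    then show ?thesis using M N by (intro measure_eqI) auto
  next
    case False
    let ?d = "\<lambda>M. density M (\<lambda>_. ennreal (1 / c))"
    have d: "real_distribution (?d M)" if M: "finite_measure M" "sets M = sets borel" and em: "emeasure M UNIV = ennreal c" for M
    proof -
      have "space M = UNIV" using M by (auto dest: sets_eq_imp_space_eq)
      then have "emeasure (?d M) (space (?d M)) = ennreal (1 / c) * ennreal c"
        using em M by (subst emeasure_density_const) auto
      also have "\<dots> = 1" using False c0 by (simp flip: ennreal_mult)
      finally show ?thesis using M \<open>space M = UNIV\<close>
        by (intro real_distribution.intro prob_spaceI real_distribution_axioms.intro) auto
    qed
    have ch: "char (?d M) t = complex_of_real (1 / c) * char M t" if "sets M = sets borel" for M t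
    proof -
      have [measurable_cong]: "sets M = sets borel" by fact
      have "char (?d M) t = (CLINT x|M. (1 / c) *\<^sub>R iexp (t * x))"
        unfolding char_def using c0 by (subst integral_density) auto
      then show ?thesis by (simp add: char_def scaleR_conv_of_real)
    qed
    have "?d M = ?d N"
      using d[OF M em(1)] d[OF N em(2)] ch[OF M(2)] ch[OF N(2)] eq by (intro Levy_uniqueness) auto
    show ?thesis
    proof (rule measure_eqI)
      fix A assume A: "A \<in> sets M"
      have "emeasure (?d M) A = emeasure (?d N) A" using \<open>?d M = ?d N\<close> by simp
      then have "ennreal (1 / c) * emeasure M A = ennreal (1 / c) * emeasure N A"
        using A M N by (simp add: emeasure_density_const)
      then have "ennreal c * (ennreal (1 / c) * emeasure M A) = ennreal c * (ennreal (1 / c) * emeasure N A)" by simp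
      then show "emeasure M A = emeasure N A"
        using False c0 by (simp flip: mult.assoc ennreal_mult)
    qed (use M N in simp)
  qed
qed

text \<open>Applies uniqueness to the laws of \<open>X\<close> and \<open>Y\<close> under the
  densities \<open>w\<close> and \<open>v\<close>. The free phase \<open>c\<close> packs real and
  imaginary parts into one real identity: c = 0 gives the cosine, c = -pi/2 the sine.\<close>

lemma weighted_law_eqI:
  fixes w X :: "'a \<Rightarrow> real" and v Y :: "'b \<Rightarrow> real"
  assumes M: "finite_measure M" and N: "finite_measure N"
    and [measurable]: "w \<in> borel_measurable M" "X \<in> borel_measurable M" "v \<in> borel_measurable N" "Y \<in> borel_measurable N"
    and w: "\<And>x. 0 \<le> w x" "\<And>x. w x \<le> B" and v: "\<And>x. 0 \<le> v x" "\<And>x. v x \<le> B"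
    and eq: "\<And>t c. (\<integral>x. w x * cos (t * X x + c) \<partial>M) = (\<integral>x. v x * cos (t * Y x + c) \<partial>N)"
    and A: "A \<in> sets borel"
  shows "(\<integral>x. w x * indicator A (X x) \<partial>M) = (\<integral>x. v x * indicator A (Y x) \<partial>N)"
proof -
  let ?D = "\<lambda>M w X. distr (density M (\<lambda>x. ennreal (w x))) borel X"
  have fin: "finite_measure (?D M w X)"
    if M: "finite_measure M" and [measurable]: "w \<in> borel_measurable M" "X \<in> borel_measurable M"
      and w: "\<And>x. 0 \<le> w x" "\<And>x. w x \<le> B" for M :: "'c measure" and w X :: "'c \<Rightarrow> real" and B
  proof -
    interpret finite_measure M by fact
    have "emeasure (density M (\<lambda>x. ennreal (w x))) (space M) \<le> (\<integral>\<^sup>+x. ennreal B \<partial>M)"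
    proof (subst emeasure_density)
      show "(\<integral>\<^sup>+x. ennreal (w x) * indicator (space M) x \<partial>M) \<le> (\<integral>\<^sup>+x. ennreal B \<partial>M)"
        using w by (intro nn_integral_mono) (simp add: ennreal_leI)
    qed simp_all
    also have "\<dots> < \<infinity>"
    proof -
      have "emeasure M (space M) < top"
        using emeasure_finite[of "space M"] by (metis infinity_ennreal_def top.not_eq_extremum)
      then show ?thesis by (simp add: ennreal_mult_less_top)
    qed
    finally show ?thesis by (intro finite_measure.finite_measure_distr finite_measureI) auto
  qed
  have fM: "finite_measure (?D M w X)" by (rule fin[OF M _ _ w]) measurable
  have fN: "finite_measure (?D N v Y)" by (rule fin[OF N _ _ v]) measurable
  have int: "(\<integral>x. g x \<partial>?D M w X) = (\<integral>x. w x * g (X x) \<partial>M)"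
    if [measurable]: "w \<in> borel_measurable M" "X \<in> borel_measurable M" "g \<in> borel_measurable borel" and w: "\<And>x. 0 \<le> w x"
    for M :: "'c measure" and w X :: "'c \<Rightarrow> real" and g :: "real \<Rightarrow> real"
    using w by (subst integral_distr) (auto simp: integral_real_density)
  have sin: "sin y = cos (y + - (pi / 2))" for y :: real by (simp add: cos_diff)
  have "?D M w X = ?D N v Y"
  proof (rule finite_measure_eqI_char[OF fM _ fN])
    fix t
    have c: "(\<integral>x. cos (t * x) \<partial>?D M w X) = (\<integral>x. cos (t * x) \<partial>?D N v Y)"
      using eq[of t 0] w v by (subst (1 2) int) auto
    have s: "(\<integral>x. sin (t * x) \<partial>?D M w X) = (\<integral>x. sin (t * x) \<partial>?D N v Y)"
      using eq[of t "- (pi / 2)"] w v unfolding sin by (subst (1 2) int) auto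
    show "char (?D M w X) t = char (?D N v Y) t"
      by (simp only: char_eq_cos_sin[OF fM] char_eq_cos_sin[OF fN] sets_distr c s)
  qed simp_all
  then have "(\<integral>x. indicator A x \<partial>?D M w X) = (\<integral>x. indicator A x \<partial>?D N v Y :: real)" by simp
  then show ?thesis using A w v by (subst (asm) (1 2) int) auto
qed

text \<open>The coordinates are added one at a time. Adding \<open>j\<close> only needs uniqueness of characteristic functions
  on the line, applied to the laws of \<open>X j\<close> under the nonnegative weights \<open>G\<close> and \<open>G * (1 + cos (S + c))\<close>,
  where \<open>G\<close> is the product of the indicators already present.\<close>

lemma cramer_wold_finite:
  fixes X :: "'i \<Rightarrow> 'a \<Rightarrow> real" and Y :: "'i \<Rightarrow> 'b \<Rightarrow> real"
  assumes M: "prob_space M" and N: "prob_space N" and K: "finite K"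
    and X: "\<And>k. k \<in> K \<Longrightarrow> X k \<in> borel_measurable M" and Y: "\<And>k. k \<in> K \<Longrightarrow> Y k \<in> borel_measurable N"
    and eq: "\<And>t c. (\<integral>x. cos ((\<Sum>k\<in>K. t k * X k x) + c) \<partial>M) = (\<integral>x. cos ((\<Sum>k\<in>K. t k * Y k x) + c) \<partial>N)"
    and A: "\<And>k. k \<in> K \<Longrightarrow> A k \<in> sets borel"
    and J: "J \<subseteq> K"
  shows "(\<integral>x. (\<Prod>j\<in>J. indicator (A j) (X j x)) * cos ((\<Sum>k\<in>K. t k * X k x) + c) \<partial>M) =
    (\<integral>x. (\<Prod>j\<in>J. indicator (A j) (Y j x)) * cos ((\<Sum>k\<in>K. t k * Y k x) + c) \<partial>N)"
proof -
  interpret M: prob_space M by fact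
  interpret N: prob_space N by fact
  have "finite J" using J K finite_subset by blast
  then show ?thesis using J
  proof (induction J arbitrary: t c rule: finite_induct)
    case empty
    then show ?case using eq by simp
  next
    case (insert j J)
    define G where "G x = (\<Prod>j\<in>J. indicator (A j) (X j x) :: real)" for x
    define H where "H x = (\<Prod>j\<in>J. indicator (A j) (Y j x) :: real)" for x
    define S where "S t x = (\<Sum>k\<in>K. t k * X k x)" for t x
    define T where "T t x = (\<Sum>k\<in>K. t k * Y k x)" for t x
    have [measurable]: "X j \<in> borel_measurable M" "Y j \<in> borel_measurable N" "A j \<in> sets borel"
      using insert X Y A by auto
    have [measurable]: "G \<in> borel_measurable M" "H \<in> borel_measurable N"
      unfolding G_def H_def using X Y A insert
      by (auto intro!: borel_measurable_prod borel_measurable_indicator' measurable_sets)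
    have [measurable]: "S t \<in> borel_measurable M" "T t \<in> borel_measurable N" for t
      unfolding S_def T_def using X Y by auto
    have GH: "0 \<le> G x" "G x \<le> 1" "0 \<le> H y" "H y \<le> 1" for x y
      unfolding G_def H_def by (auto intro!: prod_nonneg prod_le_1 simp: indicator_le_1)
    have IH: "(\<integral>x. G x * cos (S t x + c) \<partial>M) = (\<integral>x. H x * cos (T t x + c) \<partial>N)" for t c
      unfolding G_def H_def S_def T_def using insert by simp
    have iG: "integrable M (\<lambda>x. G x * cos (S t x + c))" for t c
    proof (rule M.integrable_const_bound[of _ 1])
      show "AE x in M. norm (G x * cos (S t x + c)) \<le> 1"
        using GH by (intro AE_I2) (auto simp: abs_mult intro!: mult_le_one)
    qed measurable
    have iH: "integrable N (\<lambda>x. H x * cos (T t x + c))" for t c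
    proof (rule N.integrable_const_bound[of _ 1])
      show "AE x in N. norm (H x * cos (T t x + c)) \<le> 1"
        using GH by (intro AE_I2) (auto simp: abs_mult intro!: mult_le_one)
    qed measurable
    define e where "e r = (\<lambda>k. if k = j then r else 0 :: real)" for r
    have Se: "S (e r) x = r * X j x" "T (e r) y = r * Y j y" for r x y
      unfolding S_def T_def e_def using insert K by (simp_all add: if_distrib[of "\<lambda>z. z * _"] cong: if_cong)
    have Sadd: "S (\<lambda>k. a k + b k) x = S a x + S b x" "T (\<lambda>k. a k + b k) y = T a y + T b y" for a b x y
      unfolding S_def T_def by (simp_all add: ring_distribs sum.distrib)
    have Sdiff: "S (\<lambda>k. a k - b k) x = S a x - S b x" "T (\<lambda>k. a k - b k) y = T a y - T b y" for a b x y
      unfolding S_def T_def by (simp_all add: left_diff_distrib sum_subtractf)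
    have base: "(\<integral>x. G x * indicator (A j) (X j x) \<partial>M) = (\<integral>x. H x * indicator (A j) (Y j x) \<partial>N)"
      using IH[of "e _"] GH
      by (intro weighted_law_eqI[where B = 1] M.finite_measure_axioms N.finite_measure_axioms) (auto simp: Se)
    have "(\<integral>x. (G x * (1 + cos (S t x + c))) * indicator (A j) (X j x) \<partial>M) =
       (\<integral>x. (H x * (1 + cos (T t x + c))) * indicator (A j) (Y j x) \<partial>N)"
    proof (rule weighted_law_eqI[where B = 2])
      fix r d
      \<comment> \<open>Product to sum: multiplying by a cosine in the new coordinate only produces
        cosines with shifted frequencies and phases, for which the induction hypothesis is
        available.\<close>
      have tr: "g * (1 + cos (s + c)) * cos (y + d) =
         g * cos (y + d) + (1 / 2) * (g * cos ((s + y) + (c + d))) + (1 / 2) * (g * cos ((s - y) + (c - d)))" for g s y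
      proof -
        have "cos (s + c) * cos (y + d) = (cos ((s + c) - (y + d)) + cos ((s + c) + (y + d))) / 2"
          by (rule cos_times_cos)
        also have "(s + c) - (y + d) = (s - y) + (c - d)" by simp
        also have "(s + c) + (y + d) = (s + y) + (c + d)" by simp
        finally have "cos (s + c) * cos (y + d) = (cos ((s - y) + (c - d)) + cos ((s + y) + (c + d))) / 2" .
        then have "g * (cos (s + c) * cos (y + d)) = g * ((cos ((s - y) + (c - d)) + cos ((s + y) + (c + d))) / 2)" by simp
        then show ?thesis by (simp only: ring_distribs mult_1_right mult.assoc add_divide_distrib times_divide_eq_right)
      qed
      have "(\<integral>x. G x * (1 + cos (S t x + c)) * cos (r * X j x + d) \<partial>M) =
        (\<integral>x. G x * cos (S (e r) x + d) \<partial>M) + 1 / 2 * (\<integral>x. G x * cos (S (\<lambda>k. t k + e r k) x + (c + d)) \<partial>M)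
          + 1 / 2 * (\<integral>x. G x * cos (S (\<lambda>k. t k - e r k) x + (c - d)) \<partial>M)"
        using iG[of "e r" d] iG[of "\<lambda>k. t k + e r k" "c + d"] iG[of "\<lambda>k. t k - e r k" "c - d"]
        by (simp only: tr Se[symmetric] Sadd[symmetric] Sdiff[symmetric] Bochner_Integration.integral_add
            integrable_mult_right Bochner_Integration.integrable_add integral_mult_right_zero)
      also have "\<dots> = (\<integral>x. H x * cos (T (e r) x + d) \<partial>N) + 1 / 2 * (\<integral>x. H x * cos (T (\<lambda>k. t k + e r k) x + (c + d)) \<partial>N)
          + 1 / 2 * (\<integral>x. H x * cos (T (\<lambda>k. t k - e r k) x + (c - d)) \<partial>N)"
        by (simp only: IH)
      also have "\<dots> = (\<integral>x. H x * (1 + cos (T t x + c)) * cos (r * Y j x + d) \<partial>N)"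
        using iH[of "e r" d] iH[of "\<lambda>k. t k + e r k" "c + d"] iH[of "\<lambda>k. t k - e r k" "c - d"]
        by (simp only: tr Se[symmetric] Sadd[symmetric] Sdiff[symmetric] Bochner_Integration.integral_add
            integrable_mult_right Bochner_Integration.integrable_add integral_mult_right_zero)
      finally show "(\<integral>x. G x * (1 + cos (S t x + c)) * cos (r * X j x + d) \<partial>M) =
         (\<integral>x. H x * (1 + cos (T t x + c)) * cos (r * Y j x + d) \<partial>N)" .
    next
      have u: "0 \<le> 1 + cos y" "1 + cos y \<le> 2" for y :: real using cos_ge_minus_one[of y] cos_le_one[of y] by linarith+
      show "0 \<le> G x * (1 + cos (S t x + c))" "0 \<le> H y * (1 + cos (T t y + c))" for x y
        using GH u by simp_all
      show "G x * (1 + cos (S t x + c)) \<le> 2" for x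
        using mult_mono[OF GH(2) u(2)[of "S t x + c"]] u(1)[of "S t x + c"] by simp
      show "H x * (1 + cos (T t x + c)) \<le> 2" for x
        using mult_mono[OF GH(4) u(2)[of "T t x + c"]] u(1)[of "T t x + c"] by simp
    qed (use M.finite_measure_axioms N.finite_measure_axioms in measurable)
    moreover have "(\<integral>x. (G x * (1 + cos (S t x + c))) * indicator (A j) (X j x) \<partial>M) =
       (\<integral>x. G x * indicator (A j) (X j x) \<partial>M) + (\<integral>x. indicator (A j) (X j x) * G x * cos (S t x + c) \<partial>M)"
    proof (subst Bochner_Integration.integral_add[symmetric])
      show "integrable M (\<lambda>x. G x * indicator (A j) (X j x))"
        using GH by (intro M.integrable_const_bound[of _ 1]) (auto intro!: AE_I2 simp: indicator_def)
      show "integrable M (\<lambda>x. indicator (A j) (X j x) * G x * cos (S t x + c))"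
        using GH by (intro M.integrable_const_bound[of _ 1]) (auto intro!: AE_I2 mult_le_one simp: indicator_def abs_mult)
    qed (auto intro!: Bochner_Integration.integral_cong simp: algebra_simps)
    moreover have "(\<integral>x. (H x * (1 + cos (T t x + c))) * indicator (A j) (Y j x) \<partial>N) =
       (\<integral>x. H x * indicator (A j) (Y j x) \<partial>N) + (\<integral>x. indicator (A j) (Y j x) * H x * cos (T t x + c) \<partial>N)"
    proof (subst Bochner_Integration.integral_add[symmetric])
      show "integrable N (\<lambda>x. H x * indicator (A j) (Y j x))"
        using GH by (intro N.integrable_const_bound[of _ 1]) (auto intro!: AE_I2 simp: indicator_def)
      show "integrable N (\<lambda>x. indicator (A j) (Y j x) * H x * cos (T t x + c))"
        using GH by (intro N.integrable_const_bound[of _ 1]) (auto intro!: AE_I2 mult_le_one simp: indicator_def abs_mult)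
    qed (auto intro!: Bochner_Integration.integral_cong simp: algebra_simps)
    \<comment> \<open>Subtracting \<open>base\<close> removes the 1 that had been added to make the
      weight nonnegative.\<close>
    ultimately have "(\<integral>x. indicator (A j) (X j x) * G x * cos (S t x + c) \<partial>M) =
       (\<integral>x. indicator (A j) (Y j x) * H x * cos (T t x + c) \<partial>N)"
      using base by simp
    then show ?case using insert by (simp add: G_def H_def S_def T_def)
  qed
qed

text \<open>The index set may be uncountable, as for observations indexed by all of
  \<open>L2 nu\<close>; the product sigma-algebra is generated by cylinders over finite index sets,
  so the finite version decides.\<close>

lemma cramer_wold:
  fixes X :: "'i \<Rightarrow> 'a \<Rightarrow> real" and Y :: "'i \<Rightarrow> 'b \<Rightarrow> real"
  assumes M: "prob_space M" and N: "prob_space N"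
    and X: "\<And>k. k \<in> I \<Longrightarrow> X k \<in> borel_measurable M" and Y: "\<And>k. k \<in> I \<Longrightarrow> Y k \<in> borel_measurable N"
    and eq: "\<And>K t c. finite K \<Longrightarrow> K \<subseteq> I \<Longrightarrow>
      (\<integral>x. cos ((\<Sum>k\<in>K. t k * X k x) + c) \<partial>M) = (\<integral>x. cos ((\<Sum>k\<in>K. t k * Y k x) + c) \<partial>N)"
  shows "distr M (\<Pi>\<^sub>M k\<in>I. borel) (\<lambda>x. \<lambda>k\<in>I. X k x) = distr N (\<Pi>\<^sub>M k\<in>I. borel) (\<lambda>x. \<lambda>k\<in>I. Y k x)"
proof -
  interpret M: prob_space M by fact
  interpret N: prob_space N by fact
  let ?B = "\<Pi>\<^sub>M k\<in>I. (borel :: real measure)"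
  have [measurable]: "(\<lambda>x. \<lambda>k\<in>I. X k x) \<in> measurable M ?B" "(\<lambda>x. \<lambda>k\<in>I. Y k x) \<in> measurable N ?B"
    using X Y by (auto intro!: measurable_restrict)
  show ?thesis
  proof (rule measure_eqI_PiM_infinite)
    show "finite_measure (distr M ?B (\<lambda>x. \<lambda>k\<in>I. X k x))"
      by (rule M.finite_measure_distr) measurable
    fix J and A :: "'i \<Rightarrow> real set"
    assume J: "finite J" "J \<subseteq> I" and A: "\<And>i. i \<in> J \<Longrightarrow> A i \<in> sets borel"
    have E: "emeasure (distr M ?B (\<lambda>x. \<lambda>k\<in>I. X k x)) (prod_emb I (\<lambda>_. borel) J (Pi\<^sub>E J A)) =
       ennreal (\<integral>x. (\<Prod>j\<in>J. indicator (A j) (X j x)) \<partial>M)"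
      if M: "prob_space M" and X: "\<And>k. k \<in> I \<Longrightarrow> X k \<in> borel_measurable M" for M :: "'c measure" and X
    proof -
      interpret M': prob_space M by fact
      have [measurable]: "(\<lambda>x. \<lambda>k\<in>I. X k x) \<in> measurable M ?B"
        using X by (auto intro!: measurable_restrict)
      have s: "prod_emb I (\<lambda>_. borel) J (Pi\<^sub>E J A) \<in> sets ?B"
        using J A by (intro sets_PiM_I) auto
      let ?E = "(\<lambda>x. \<lambda>k\<in>I. X k x) -` prod_emb I (\<lambda>_. borel) J (Pi\<^sub>E J A) \<inter> space M"
      have "emeasure (distr M ?B (\<lambda>x. \<lambda>k\<in>I. X k x)) (prod_emb I (\<lambda>_. borel) J (Pi\<^sub>E J A)) = emeasure M ?E"
        using s by (subst emeasure_distr) auto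
      also have "\<dots> = ennreal (\<integral>x. indicator ?E x \<partial>M)"
        by (simp add: M'.emeasure_eq_measure)
      also have "(\<integral>x. indicator ?E x \<partial>M) = (\<integral>x. (\<Prod>j\<in>J. indicator (A j) (X j x)) \<partial>M :: real)"
      proof (intro Bochner_Integration.integral_cong refl)
        fix x assume x: "x \<in> space M"
        have "x \<in> ?E \<longleftrightarrow> (\<forall>j\<in>J. X j x \<in> A j)"
          using x J by (auto simp: prod_emb_def PiE_iff extensional_def restrict_def)
        then show "indicator ?E x = (\<Prod>j\<in>J. indicator (A j) (X j x) :: real)"
          using J by (auto simp: indicator_def prod.If_cases)
      qed
      finally show ?thesis .
    qed
    \<comment> \<open>With zero frequencies and phase the cosine is 1 and the identity compares the
      probabilities of the cylinder.\<close>
    have "(\<integral>x. (\<Prod>j\<in>J. indicator (A j) (X j x)) * cos ((\<Sum>k\<in>J. 0 * X k x) + 0) \<partial>M) =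
       (\<integral>x. (\<Prod>j\<in>J. indicator (A j) (Y j x)) * cos ((\<Sum>k\<in>J. 0 * Y k x) + 0) \<partial>N)"
      using J A X Y by (intro cramer_wold_finite[OF M N] eq) auto
    then show "emeasure (distr M ?B (\<lambda>x. \<lambda>k\<in>I. X k x)) (prod_emb I (\<lambda>_. borel) J (Pi\<^sub>E J A)) =
      emeasure (distr N ?B (\<lambda>x. \<lambda>k\<in>I. Y k x)) (prod_emb I (\<lambda>_. borel) J (Pi\<^sub>E J A))"
      using E[OF M X] E[OF N Y] by simp
  qed simp_all
qed

section \<open>Normal variables\<close>

abbreviation SN :: "real measure" where "SN \<equiv> std_normal_distribution"

lemma distributed_normal_integral:
  fixes g :: "real \<Rightarrow> real"
  assumes X: "distributed P lborel X (\<lambda>x. ennreal (normal_density 0 \<sigma> x))" and s: "\<sigma> > 0"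
    and g: "g \<in> borel_measurable borel"
  shows "(\<integral>\<omega>. g (X \<omega>) \<partial>P) = (\<integral>x. std_normal_density x * g (\<sigma> * x) \<partial>lborel)"
proof -
  have "(\<integral>\<omega>. g (X \<omega>) \<partial>P) = (\<integral>x. normal_density 0 \<sigma> x * g x \<partial>lborel)"
    using distributed_integral[OF X, of g] g by (simp add: normal_density_nonneg)
  also have "\<dots> = \<bar>\<sigma>\<bar> *\<^sub>R (\<integral>x. normal_density 0 \<sigma> (0 + \<sigma> * x) * g (0 + \<sigma> * x) \<partial>lborel)"
    using s by (intro lborel_integral_real_affine) simp
  also have "\<dots> = (\<integral>x. \<sigma> * (normal_density 0 \<sigma> (\<sigma> * x) * g (\<sigma> * x)) \<partial>lborel)"
    using s by simp
  also have "\<dots> = (\<integral>x. std_normal_density x * g (\<sigma> * x) \<partial>lborel)"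
  proof (intro Bochner_Integration.integral_cong refl)
    fix x
    have "\<sigma> * normal_density 0 \<sigma> (\<sigma> * x) = std_normal_density x"
      using s by (simp add: normal_density_def power_mult_distrib real_sqrt_mult)
    then show "\<sigma> * (normal_density 0 \<sigma> (\<sigma> * x) * g (\<sigma> * x)) = std_normal_density x * g (\<sigma> * x)"
      by (simp flip: mult.assoc)
  qed
  finally show ?thesis .
qed

lemma integral_SN_cos: "(\<integral>x. cos (a * x + c) \<partial>SN) = exp (- a\<^sup>2 / 2) * cos c"
proof -
  interpret real_distribution SN by (rule real_dist_normal_dist)
  have ch: "char SN a = Complex (\<integral>x. cos (a * x) \<partial>SN) (\<integral>x. sin (a * x) \<partial>SN)"
    by (rule char_eq_cos_sin[OF finite_measure_axioms]) simp
  have "(\<integral>x. cos (a * x) \<partial>SN) = exp (- a\<^sup>2 / 2)" "(\<integral>x. sin (a * x) \<partial>SN) = 0"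
    using arg_cong[OF ch, of Re] arg_cong[OF ch, of Im] by (simp_all add: char_std_normal_distribution)
  moreover have "integrable SN (\<lambda>x. cos (a * x) * cos c)" "integrable SN (\<lambda>x. sin (a * x) * sin c)"
    by (auto intro!: integrable_const_bound[of _ 1] simp: abs_mult mult_le_one)
  ultimately show ?thesis by (simp add: cos_add)
qed

lemma normal_rv_cos:
  assumes "prob_space P" "normal_rv P X 0 v" "v \<ge> 0"
  shows "(\<integral>\<omega>. cos (X \<omega> + c) \<partial>P) = exp (- v / 2) * cos c"
proof -
  interpret prob_space P by fact
  show ?thesis
  proof (cases "v = 0")
    case True
    then have "X \<in> borel_measurable P" "AE \<omega> in P. X \<omega> = 0" using assms by (auto simp: normal_rv_def)
    then have "(\<integral>\<omega>. cos (X \<omega> + c) \<partial>P) = (\<integral>\<omega>. cos c \<partial>P)"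
      by (intro integral_cong_AE) auto
    then show ?thesis using True by (simp add: prob_space)
  next
    case False
    then have "(\<integral>\<omega>. cos (X \<omega> + c) \<partial>P) = (\<integral>x. std_normal_density x * cos (sqrt v * x + c) \<partial>lborel)"
      using assms by (intro distributed_normal_integral[where g = "\<lambda>x. cos (x + c)"]) (auto simp: normal_rv_def)
    also have "\<dots> = (\<integral>x. cos (sqrt v * x + c) \<partial>SN)"
      by (subst integral_density) (auto simp: normal_density_nonneg)
    finally show ?thesis using assms(3) by (simp add: integral_SN_cos)
  qed
qed

lemma normal_rv_second_moment:
  assumes "normal_rv P X 0 v" "v \<ge> 0"
  shows "integrable P (\<lambda>\<omega>. (X \<omega>)\<^sup>2)" "(\<integral>\<omega>. (X \<omega>)\<^sup>2 \<partial>P) = v"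
proof -
  have "integrable P (\<lambda>\<omega>. (X \<omega>)\<^sup>2) \<and> (\<integral>\<omega>. (X \<omega>)\<^sup>2 \<partial>P) = v"
  proof (cases "v = 0")
    case True
    then have X: "X \<in> borel_measurable P" "AE \<omega> in P. X \<omega> = 0" using assms by (auto simp: normal_rv_def)
    then have ae: "AE \<omega> in P. (X \<omega>)\<^sup>2 = 0" by auto
    have "integrable P (\<lambda>\<omega>. (X \<omega>)\<^sup>2) \<longleftrightarrow> integrable P (\<lambda>\<omega>. 0 :: real)"
      using X ae by (intro integrable_cong_AE) auto
    moreover have "(\<integral>\<omega>. (X \<omega>)\<^sup>2 \<partial>P) = (\<integral>\<omega>. 0 \<partial>P)"
      using X ae by (intro integral_cong_AE) auto
    ultimately show ?thesis using True by simp
  next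
    case False
    then have X: "distributed P lborel X (\<lambda>x. ennreal (normal_density 0 (sqrt v) x))" and s: "sqrt v > 0"
      using assms by (auto simp: normal_rv_def)
    have "has_bochner_integral lborel (\<lambda>x. normal_density 0 (sqrt v) x * (x - 0) ^ (2 * 1))
        (fact (2 * 1) / ((2 / (sqrt v)\<^sup>2) ^ 1 * fact 1))"
      by (rule normal_moment_even[OF s])
    then have "has_bochner_integral lborel (\<lambda>x. normal_density 0 (sqrt v) x * x\<^sup>2) v"
      using assms False by simp
    then have "integrable lborel (\<lambda>x. normal_density 0 (sqrt v) x * x\<^sup>2)" "(\<integral>x. normal_density 0 (sqrt v) x * x\<^sup>2 \<partial>lborel) = v"
      by (auto simp: has_bochner_integral_iff)
    then show ?thesis
      using distributed_integral[OF X, of "\<lambda>x. x\<^sup>2"] distributed_integrable[OF X, of "\<lambda>x. x\<^sup>2"]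
      by (simp add: normal_density_nonneg)
  qed
  then show "integrable P (\<lambda>\<omega>. (X \<omega>)\<^sup>2)" "(\<integral>\<omega>. (X \<omega>)\<^sup>2 \<partial>P) = v" by auto
qed

section \<open>Linearity and splitting of the white noise\<close>

lemma white_noise_prob: "white_noise P W \<Longrightarrow> prob_space P"
  by (simp add: white_noise_def)

lemma white_noise_pair:
  assumes "white_noise P W" "f \<in> L2 nu" "g \<in> L2 nu"
  shows "normal_rv P (\<lambda>\<omega>. a * W f \<omega> + b * W g \<omega>) 0
    (a\<^sup>2 * l2_inner nu f f + 2 * a * b * l2_inner nu f g + b\<^sup>2 * l2_inner nu g g)"
  using assms by (simp add: white_noise_def centered_gaussian_pair_def l2_norm_sq)

lemma white_noise_normal:
  assumes "white_noise P W" "f \<in> L2 nu"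
  shows "normal_rv P (W f) 0 (l2_inner nu f f)"
  using white_noise_pair[OF assms assms(2), of 1 0] by simp

lemma white_noise_measurable:
  assumes "white_noise P W" "f \<in> L2 nu"
  shows "W f \<in> borel_measurable P"
  using white_noise_normal[OF assms] by (simp add: normal_rv_def)

text \<open>Polarization of the variances of \<open>W f\<close>, \<open>W g\<close> and their sum,
  all of which the pairwise Gaussian property supplies.\<close>

lemma white_noise_cov:
  assumes W: "white_noise P W" and f: "f \<in> L2 nu" and g: "g \<in> L2 nu"
  shows "integrable P (\<lambda>\<omega>. W f \<omega> * W g \<omega>)" "(\<integral>\<omega>. W f \<omega> * W g \<omega> \<partial>P) = l2_inner nu f g"
proof -
  have var: "f \<in> L2 nu \<Longrightarrow> integrable P (\<lambda>\<omega>. (W f \<omega>)\<^sup>2) \<and> (\<integral>\<omega>. (W f \<omega>)\<^sup>2 \<partial>P) = l2_inner nu f f" for f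
    using normal_rv_second_moment[OF white_noise_normal[OF W]] l2_inner_self_nonneg by blast
  have eq: "l2_inner nu (\<lambda>x. f x + g x) (\<lambda>x. f x + g x) = l2_inner nu f f + 2 * l2_inner nu f g + l2_inner nu g g"
    unfolding l2_inner_add[OF f g L2_add[OF f g]]
      l2_inner_commute[of nu f "\<lambda>x. f x + g x"] l2_inner_commute[of nu g "\<lambda>x. f x + g x"]
      l2_inner_add[OF f g f] l2_inner_add[OF f g g] l2_inner_commute[of nu g f] by simp
  have "0 \<le> 1\<^sup>2 * l2_inner nu f f + 2 * 1 * 1 * l2_inner nu f g + 1\<^sup>2 * l2_inner nu g g"
    using l2_inner_self_nonneg[of nu "\<lambda>x. f x + g x"] unfolding eq by simp
  note S = normal_rv_second_moment[OF white_noise_pair[OF W f g] this]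
  have sq: "W f \<omega> * W g \<omega> = ((1 * W f \<omega> + 1 * W g \<omega>)\<^sup>2 - (W f \<omega>)\<^sup>2 - (W g \<omega>)\<^sup>2) / 2" for \<omega>
    by (simp add: power2_sum)
  show "integrable P (\<lambda>\<omega>. W f \<omega> * W g \<omega>)"
    unfolding sq using S var[OF f] var[OF g] by auto
  show "(\<integral>\<omega>. W f \<omega> * W g \<omega> \<partial>P) = l2_inner nu f g"
    unfolding sq using S var[OF f] var[OF g] by simp
qed

text \<open>White noise is only assumed to be Gaussian in pairs. It is nevertheless almost surely linear, because
  the variance of the defect vanishes, and hence jointly Gaussian.\<close>

lemma white_noise_linear2:
  assumes W: "white_noise P W" and f: "f \<in> L2 nu" and g: "g \<in> L2 nu"
  shows "AE \<omega> in P. W (\<lambda>x. a * f x + b * g x) \<omega> = a * W f \<omega> + b * W g \<omega>"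
proof -
  let ?h = "\<lambda>x. a * f x + b * g x"
  have h: "?h \<in> L2 nu" by (intro L2_add L2_scale f g)
  define D where "D \<omega> = W ?h \<omega> - (a * W f \<omega> + b * W g \<omega>)" for \<omega>
  have D2: "(D \<omega>)\<^sup>2 = W ?h \<omega> * W ?h \<omega> + a\<^sup>2 * (W f \<omega> * W f \<omega>) + b\<^sup>2 * (W g \<omega> * W g \<omega>) + 2 * a * b * (W f \<omega> * W g \<omega>)
      - 2 * a * (W f \<omega> * W ?h \<omega>) - 2 * b * (W g \<omega> * W ?h \<omega>)" for \<omega>
    unfolding D_def by (simp add: power2_eq_square algebra_simps)
  note int = white_noise_cov(1)[OF W h h] white_noise_cov(1)[OF W f f] white_noise_cov(1)[OF W g g]
    white_noise_cov(1)[OF W f g] white_noise_cov(1)[OF W f h] white_noise_cov(1)[OF W g h]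
  have i: "integrable P (\<lambda>\<omega>. (D \<omega>)\<^sup>2)" unfolding D2 using int by auto
  have lin: "l2_inner nu ?h k = a * l2_inner nu f k + b * l2_inner nu g k" if "k \<in> L2 nu" for k
    using l2_inner_add[OF L2_scale[OF f, of a] L2_scale[OF g, of b] that] by (simp add: l2_inner_scale)
  have "(\<integral>\<omega>. (D \<omega>)\<^sup>2 \<partial>P) = l2_inner nu ?h ?h + a\<^sup>2 * l2_inner nu f f + b\<^sup>2 * l2_inner nu g g + 2 * a * b * l2_inner nu f g
      - 2 * a * l2_inner nu f ?h - 2 * b * l2_inner nu g ?h"
    unfolding D2 using int
    by (simp add: white_noise_cov(2)[OF W] f g h)
  also have "\<dots> = 0"
    unfolding l2_inner_commute[of nu f ?h] l2_inner_commute[of nu g ?h] lin[OF h] lin[OF f] lin[OF g]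
      l2_inner_commute[of nu g f] by (simp add: power2_eq_square algebra_simps)
  finally have "(\<integral>\<omega>. (D \<omega>)\<^sup>2 \<partial>P) = 0" .
  then have "AE \<omega> in P. (D \<omega>)\<^sup>2 = 0"
    using i by (subst (asm) integral_nonneg_eq_0_iff_AE) auto
  then show ?thesis by eventually_elim (simp add: D_def)
qed

lemma white_noise_linear:
  assumes W: "white_noise P W" and "finite K" and "\<And>k. k \<in> K \<Longrightarrow> f k \<in> L2 nu"
  shows "AE \<omega> in P. W (\<lambda>x. \<Sum>k\<in>K. t k * f k x) \<omega> = (\<Sum>k\<in>K. t k * W (f k) \<omega>)"
  using assms(2,3)
proof (induction K rule: finite_induct)
  case empty
  show ?case using white_noise_linear2[OF W L2_zero L2_zero, of 0 0] by simp
next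
  case (insert k K)
  have fk: "f k \<in> L2 nu" and s: "(\<lambda>x. \<Sum>k\<in>K. t k * f k x) \<in> L2 nu"
    using insert by (auto intro!: L2_sum L2_scale)
  have "AE \<omega> in P. W (\<lambda>x. \<Sum>k\<in>K. t k * f k x) \<omega> = (\<Sum>k\<in>K. t k * W (f k) \<omega>)"
    using insert by auto
  with white_noise_linear2[OF W fk s, of "t k" 1] show ?case
    by eventually_elim (use insert in simp)
qed

text \<open>For a finite combination g, put \<alpha> = <g, e>. By Pythagoras the squared norm of g
  is \<alpha>^2 plus that of the residual, so both sides have the same characteristic function. The
  component along \<open>e\<close> is replaced by a fresh coordinate of a product space, which makes
  its independence of the remainder part of the construction.\<close>

lemma white_noise_split:
  assumes W: "white_noise P W" and e: "e \<in> L2 nu" and e1: "l2_inner nu e e = 1"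
  shows "distr P data_space (\<lambda>\<omega>. \<lambda>h\<in>L2 nu. W h \<omega>) =
    distr (SN \<Otimes>\<^sub>M P) data_space (\<lambda>(\<xi>, \<omega>). \<lambda>h\<in>L2 nu. l2_inner nu h e * \<xi> + W (\<lambda>x. h x - l2_inner nu h e * e x) \<omega>)"
proof -
  interpret P: prob_space P using W by (rule white_noise_prob)
  interpret S: real_distribution SN by (rule real_dist_normal_dist)
  interpret SP: pair_prob_space SN P ..
  define R where "R h = (\<lambda>x. h x - l2_inner nu h e * e x)" for h
  have R: "R h \<in> L2 nu" if "h \<in> L2 nu" for h
    unfolding R_def by (intro L2_diff L2_scale that e)
  have Wm: "W h \<in> borel_measurable P" if "h \<in> L2 nu" for h
    by (rule white_noise_measurable[OF W that])
  define Y where "Y h p = l2_inner nu h e * fst p + W (R h) (snd p)" for h p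
  have "distr P data_space (\<lambda>\<omega>. \<lambda>h\<in>L2 nu. W h \<omega>) = distr (SN \<Otimes>\<^sub>M P) data_space (\<lambda>p. \<lambda>h\<in>L2 nu. Y h p)"
    unfolding data_space_def
  proof (rule cramer_wold[OF P.prob_space_axioms SP.prob_space_axioms Wm])
    show Ym: "Y h \<in> borel_measurable (SN \<Otimes>\<^sub>M P)" if "h \<in> L2 nu" for h
      using Wm[OF R[OF that]] unfolding Y_def by measurable
    fix K t c assume K: "finite K" "K \<subseteq> L2 nu"
    define g where "g = (\<lambda>x. \<Sum>h\<in>K. t h * h x)"
    have g: "g \<in> L2 nu" unfolding g_def using K by (intro L2_sum L2_scale) auto
    define \<alpha> where "\<alpha> = l2_inner nu g e"
    have \<alpha>: "\<alpha> = (\<Sum>h\<in>K. t h * l2_inner nu h e)"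
    proof -
      have "\<alpha> = (\<Sum>h\<in>K. l2_inner nu (\<lambda>x. t h * h x) e)"
        unfolding \<alpha>_def g_def using K e by (intro l2_inner_sum L2_scale) auto
      then show ?thesis by (simp add: l2_inner_scale)
    qed
    have Rg: "R g = (\<lambda>x. \<Sum>h\<in>K. t h * R h x)"
      unfolding R_def \<alpha>_def[symmetric] by (simp add: \<alpha> g_def sum_subtractf right_diff_distrib sum_distrib_right mult.assoc)
    have gg: "l2_inner nu (R g) (R g) = l2_inner nu g g - \<alpha>\<^sup>2"
    proof -
      have ae: "(\<lambda>x. \<alpha> * e x) \<in> L2 nu" by (rule L2_scale[OF e])
      have "l2_inner nu (R g) (R g) = l2_inner nu (\<lambda>x. g x - \<alpha> * e x) (\<lambda>x. g x - \<alpha> * e x)"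
        by (simp add: R_def \<alpha>_def)
      also have "\<dots> = (l2_inner nu g g - \<alpha> * l2_inner nu g e) - \<alpha> * (l2_inner nu e g - \<alpha> * l2_inner nu e e)"
        by (simp only: l2_inner_diff[OF g ae L2_diff[OF g ae]] l2_inner_diff_right[OF g ae g] l2_inner_diff_right[OF g ae e]
            l2_inner_scale l2_inner_scale_right)
      also have "\<dots> = l2_inner nu g g - \<alpha>\<^sup>2"
        unfolding e1 l2_inner_commute[of nu e g] \<alpha>_def[symmetric] by (simp add: power2_eq_square)
      finally show ?thesis .
    qed
    have "(\<integral>\<omega>. cos ((\<Sum>h\<in>K. t h * W h \<omega>) + c) \<partial>P) = (\<integral>\<omega>. cos (W g \<omega> + c) \<partial>P)"
    proof (rule integral_cong_AE)
      have "AE \<omega> in P. W g \<omega> = (\<Sum>h\<in>K. t h * W h \<omega>)"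
        unfolding g_def using K by (intro white_noise_linear[OF W, of K "\<lambda>h. h"]) auto
      then show "AE \<omega> in P. cos ((\<Sum>h\<in>K. t h * W h \<omega>) + c) = cos (W g \<omega> + c)"
        by eventually_elim simp
    qed (use K Wm g in \<open>auto intro!: borel_measurable_sum borel_measurable_times borel_measurable_add simp: subset_iff\<close>)
    also have "\<dots> = exp (- l2_inner nu g g / 2) * cos c"
      by (intro normal_rv_cos white_noise_normal W g l2_inner_self_nonneg P.prob_space_axioms)
    finally have L: "(\<integral>\<omega>. cos ((\<Sum>h\<in>K. t h * W h \<omega>) + c) \<partial>P) = exp (- l2_inner nu g g / 2) * cos c" .
    have m: "(\<lambda>p. cos ((\<Sum>h\<in>K. t h * Y h p) + c)) \<in> borel_measurable (SN \<Otimes>\<^sub>M P)"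
      using Ym K by (auto intro!: borel_measurable_sum borel_measurable_times borel_measurable_add measurable_compose[OF _ borel_measurable_cos] simp: subset_iff)
    have i: "integrable (SN \<Otimes>\<^sub>M P) (\<lambda>p. cos ((\<Sum>h\<in>K. t h * Y h p) + c))"
      using m by (intro SP.integrable_const_bound[of _ 1]) auto
    have "(\<integral>p. cos ((\<Sum>h\<in>K. t h * Y h p) + c) \<partial>(SN \<Otimes>\<^sub>M P)) =
        (\<integral>\<xi>. \<integral>\<omega>. cos ((\<Sum>h\<in>K. t h * Y h (\<xi>, \<omega>)) + c) \<partial>P \<partial>SN)"
      by (rule SP.integral_fst'[OF i, symmetric])
    also have "\<dots> = (\<integral>\<xi>. exp (- l2_inner nu (R g) (R g) / 2) * cos (\<alpha> * \<xi> + c) \<partial>SN)"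
    proof (intro Bochner_Integration.integral_cong refl)
      fix \<xi>
      have s: "(\<Sum>h\<in>K. t h * Y h (\<xi>, \<omega>)) = \<alpha> * \<xi> + (\<Sum>h\<in>K. t h * W (R h) \<omega>)" for \<omega>
        by (simp add: Y_def \<alpha> sum_distrib_right ring_distribs sum.distrib mult.assoc)
      have "(\<integral>\<omega>. cos ((\<Sum>h\<in>K. t h * Y h (\<xi>, \<omega>)) + c) \<partial>P) = (\<integral>\<omega>. cos (W (R g) \<omega> + (\<alpha> * \<xi> + c)) \<partial>P)"
      proof (rule integral_cong_AE)
        have "AE \<omega> in P. W (R g) \<omega> = (\<Sum>h\<in>K. t h * W (R h) \<omega>)"
          unfolding Rg using K R by (intro white_noise_linear[OF W]) auto
        then show "AE \<omega> in P. cos ((\<Sum>h\<in>K. t h * Y h (\<xi>, \<omega>)) + c) = cos (W (R g) \<omega> + (\<alpha> * \<xi> + c))"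
          unfolding s by eventually_elim (simp add: algebra_simps)
        show "(\<lambda>\<omega>. cos ((\<Sum>h\<in>K. t h * Y h (\<xi>, \<omega>)) + c)) \<in> borel_measurable P"
          unfolding s using K Wm R by (auto intro!: borel_measurable_sum borel_measurable_times borel_measurable_add measurable_compose[OF _ borel_measurable_cos] simp: subset_iff)
        show "(\<lambda>\<omega>. cos (W (R g) \<omega> + (\<alpha> * \<xi> + c))) \<in> borel_measurable P"
          using Wm[OF R[OF g]] by measurable
      qed
      then show "(\<integral>\<omega>. cos ((\<Sum>h\<in>K. t h * Y h (\<xi>, \<omega>)) + c) \<partial>P) = exp (- l2_inner nu (R g) (R g) / 2) * cos (\<alpha> * \<xi> + c)"
        using normal_rv_cos[OF P.prob_space_axioms white_noise_normal[OF W R[OF g]] l2_inner_self_nonneg] by simp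
    qed
    also have "\<dots> = exp (- l2_inner nu (R g) (R g) / 2) * (exp (- \<alpha>\<^sup>2 / 2) * cos c)"
      by (simp add: integral_SN_cos)
    also have "\<dots> = exp (- l2_inner nu g g / 2) * cos c"
      unfolding gg mult.assoc[symmetric] exp_add[symmetric] by (simp add: field_simps)
    finally show "(\<integral>\<omega>. cos ((\<Sum>h\<in>K. t h * W h \<omega>) + c) \<partial>P) = (\<integral>p. cos ((\<Sum>h\<in>K. t h * Y h p) + c) \<partial>(SN \<Otimes>\<^sub>M P))"
      using L by simp
  qed
  then show ?thesis unfolding Y_def R_def case_prod_beta' .
qed

section \<open>The lower bound\<close>

text \<open>All normal densities with unit variance and mean in [0, 1] lie above the value of the
  standard density at 1 on the interval [0, 1]. This common minorant does the work of a bound on the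
  distance between the two hypotheses.\<close>

lemma nn_integral_SN_shift_ge:
  assumes [measurable]: "G \<in> borel_measurable borel" and \<nu>: "0 \<le> \<nu>" "\<nu> \<le> 1"
  shows "(\<integral>\<^sup>+\<xi>. G \<xi> * (indicator {0..1} \<xi> * ennreal (std_normal_density 1)) \<partial>lborel) \<le> (\<integral>\<^sup>+\<xi>. G (\<xi> + \<nu>) \<partial>SN)"
proof -
  have "(\<integral>\<^sup>+\<xi>. G (\<xi> + \<nu>) \<partial>SN) = (\<integral>\<^sup>+\<xi>. ennreal (std_normal_density \<xi>) * G (\<xi> + \<nu>) \<partial>lborel)"
    by (subst nn_integral_density) auto
  also have "\<dots> = (\<integral>\<^sup>+\<xi>. ennreal (std_normal_density (\<xi> - \<nu>)) * G \<xi> \<partial>lborel)"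
    using nn_integral_real_affine[of "\<lambda>\<xi>. ennreal (std_normal_density \<xi>) * G (\<xi> + \<nu>)" 1 "- \<nu>"]
    by (simp add: add.commute)
  also have "\<dots> \<ge> (\<integral>\<^sup>+\<xi>. G \<xi> * (indicator {0..1} \<xi> * ennreal (std_normal_density 1)) \<partial>lborel)"
  proof (intro nn_integral_mono)
    fix \<xi> :: real
    show "G \<xi> * (indicator {0..1} \<xi> * ennreal (std_normal_density 1)) \<le> ennreal (std_normal_density (\<xi> - \<nu>)) * G \<xi>"
    proof (cases "\<xi> \<in> {0..1}")
      case True
      then have "(\<xi> - \<nu>)\<^sup>2 \<le> 1" using \<nu> by (simp add: abs_square_le_1 abs_le_iff)
      then have "std_normal_density 1 \<le> std_normal_density (\<xi> - \<nu>)"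
        by (simp add: std_normal_density_def divide_right_mono)
      then show ?thesis using True by (simp add: mult.commute mult_left_mono ennreal_leI)
    qed simp
  qed
  finally show ?thesis .
qed

lemma observation_in_space: "observation W n f \<omega> \<in> space data_space"
  by (simp add: observation_def data_space_def space_PiM)

text \<open>A signal in direction \<open>e\<close> can be absorbed into the normal coordinate.
  Relative to noise of level n^(-1/2) a displacement by \<open>m\<close> is a shift by
  \<open>sqrt n * m\<close>, and \<open>b\<close> is the part of the signal left unshifted.\<close>

lemma nn_integral_observation:
  assumes W: "white_noise P W" and n: "n > 0" and e: "e \<in> L2 nu" and e1: "l2_inner nu e e = 1"
    and shift: "\<And>h. h \<in> L2 nu \<Longrightarrow> l2_inner nu h (radon f) = b h + m * l2_inner nu h e"
    and F[measurable]: "F \<in> borel_measurable data_space"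
  shows "(\<integral>\<^sup>+\<omega>. F (observation W n f \<omega>) \<partial>P) = (\<integral>\<^sup>+\<omega>. \<integral>\<^sup>+\<xi>.
     F (\<lambda>h\<in>L2 nu. b h + real n powr (- 1 / 2) * (l2_inner nu h e * (\<xi> + sqrt (real n) * m) + W (\<lambda>x. h x - l2_inner nu h e * e x) \<omega>)) \<partial>SN \<partial>P)"
proof -
  interpret P: prob_space P using W by (rule white_noise_prob)
  interpret S: real_distribution SN by (rule real_dist_normal_dist)
  interpret SP: pair_prob_space SN P ..
  let ?c = "real n powr (- 1 / 2)"
  have c: "?c * sqrt (real n) = 1"
    using n by (simp add: powr_minus powr_half_sqrt)
  define R where "R h = (\<lambda>x. h x - l2_inner nu h e * e x)" for h
  have R: "R h \<in> L2 nu" if "h \<in> L2 nu" for h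
    unfolding R_def by (intro L2_diff L2_scale that e)
  have Wm: "W h \<in> borel_measurable P" if "h \<in> L2 nu" for h
    by (rule white_noise_measurable[OF W that])
  define \<Phi> where "\<Phi> y = (\<lambda>h\<in>L2 nu. l2_inner nu h (radon f) + ?c * y h)" for y :: "(real \<times> real \<Rightarrow> real) \<Rightarrow> real"
  have [measurable]: "\<Phi> \<in> measurable data_space data_space"
    unfolding \<Phi>_def data_space_def by measurable
  have Wd[measurable]: "(\<lambda>\<omega>. \<lambda>h\<in>L2 nu. W h \<omega>) \<in> measurable P data_space"
    unfolding data_space_def using Wm by (intro measurable_restrict)
  define Y where "Y = (\<lambda>(\<xi>, \<omega>). \<lambda>h\<in>L2 nu. l2_inner nu h e * \<xi> + W (R h) \<omega>)"
  have Yd[measurable]: "Y \<in> measurable (SN \<Otimes>\<^sub>M P) data_space"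
    unfolding data_space_def Y_def case_prod_beta'
  proof (rule measurable_restrict)
    fix h assume "h \<in> L2 nu"
    then have [measurable]: "W (R h) \<in> borel_measurable P" by (intro Wm R)
    show "(\<lambda>x. l2_inner nu h e * fst x + W (R h) (snd x)) \<in> borel_measurable (SN \<Otimes>\<^sub>M P)" by measurable
  qed
  have FY: "(\<lambda>p. F (\<Phi> (Y p))) \<in> borel_measurable (SN \<Otimes>\<^sub>M P)" by measurable
  have "(\<integral>\<^sup>+\<omega>. F (observation W n f \<omega>) \<partial>P) = (\<integral>\<^sup>+\<omega>. F (\<Phi> (\<lambda>h\<in>L2 nu. W h \<omega>)) \<partial>P)"
    by (intro nn_integral_cong arg_cong[of _ _ F]) (auto simp: observation_def \<Phi>_def)
  also have "\<dots> = (\<integral>\<^sup>+y. F (\<Phi> y) \<partial>distr P data_space (\<lambda>\<omega>. \<lambda>h\<in>L2 nu. W h \<omega>))"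
    by (subst nn_integral_distr) auto
  also have "\<dots> = (\<integral>\<^sup>+y. F (\<Phi> y) \<partial>distr (SN \<Otimes>\<^sub>M P) data_space Y)"
    using white_noise_split[OF W e e1] by (simp only: Y_def R_def)
  also have "\<dots> = (\<integral>\<^sup>+p. F (\<Phi> (Y p)) \<partial>(SN \<Otimes>\<^sub>M P))"
    by (subst nn_integral_distr) auto
  also have "\<dots> = (\<integral>\<^sup>+\<omega>. \<integral>\<^sup>+\<xi>. F (\<Phi> (Y (\<xi>, \<omega>))) \<partial>SN \<partial>P)"
    by (rule SP.nn_integral_snd[OF FY, symmetric])
  also have "\<dots> = (\<integral>\<^sup>+\<omega>. \<integral>\<^sup>+\<xi>.
     F (\<lambda>h\<in>L2 nu. b h + ?c * (l2_inner nu h e * (\<xi> + sqrt (real n) * m) + W (R h) \<omega>)) \<partial>SN \<partial>P)"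
  proof (intro nn_integral_cong arg_cong[of _ _ F])
    fix \<omega> \<xi>
    have "m = ?c * sqrt (real n) * m" using c by simp
    then have "b h + m * l2_inner nu h e + ?c * (l2_inner nu h e * \<xi> + W (R h) \<omega>) =
       b h + ?c * (l2_inner nu h e * (\<xi> + sqrt (real n) * m) + W (R h) \<omega>)" for h
      by (simp add: ring_distribs) (metis mult.assoc mult.commute)
    then show "\<Phi> (Y (\<xi>, \<omega>)) = (\<lambda>h\<in>L2 nu. b h + ?c * (l2_inner nu h e * (\<xi> + sqrt (real n) * m) + W (R h) \<omega>))"
      unfolding \<Phi>_def Y_def by (intro restrict_ext) (simp add: shift)
  qed
  finally show ?thesis unfolding R_def .
qed

text \<open>Given the remainder \<omega>, both hypotheses are evaluated along the same curve \<Psi>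
  in the data space and differ only in the law of its parameter. Both laws dominate the common
  minorant on [0, 1], under which no value of \<open>T\<close> can be close to both 0 and
  \<epsilon>.\<close>

lemma two_point_lower_bound:
  assumes W: "white_noise P W" and n: "n > 0" and e: "e \<in> L2 nu" and e1: "l2_inner nu e e = 1"
    and shift: "\<And>h. h \<in> L2 nu \<Longrightarrow> l2_inner nu h (radon f1) = l2_inner nu h (radon f0) + m * l2_inner nu h e"
    and m: "0 \<le> sqrt (real n) * m" "sqrt (real n) * m \<le> 1"
    and T[measurable]: "T \<in> borel_measurable data_space"
  shows "ennreal (\<epsilon>\<^sup>2 / 2 * std_normal_density 1) \<le>
     (\<integral>\<^sup>+\<omega>. ennreal ((T (observation W n f0 \<omega>))\<^sup>2) \<partial>P) + (\<integral>\<^sup>+\<omega>. ennreal ((T (observation W n f1 \<omega>) - \<epsilon>)\<^sup>2) \<partial>P)"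
proof -
  interpret P: prob_space P using W by (rule white_noise_prob)
  interpret S: real_distribution SN by (rule real_dist_normal_dist)
  define \<Psi> where "\<Psi> \<xi> \<omega> = (\<lambda>h\<in>L2 nu. l2_inner nu h (radon f0) +
     real n powr (- 1 / 2) * (l2_inner nu h e * \<xi> + W (\<lambda>x. h x - l2_inner nu h e * e x) \<omega>))" for \<xi> \<omega>
  have \<Psi>: "(\<lambda>p. \<Psi> (snd p) (fst p)) \<in> measurable (P \<Otimes>\<^sub>M lborel) data_space"
    unfolding \<Psi>_def data_space_def
  proof (rule measurable_restrict)
    fix h assume "h \<in> L2 nu"
    then have [measurable]: "W (\<lambda>x. h x - l2_inner nu h e * e x) \<in> borel_measurable P"
      by (intro white_noise_measurable[OF W] L2_diff L2_scale e)
    show "(\<lambda>p. l2_inner nu h (radon f0) + real n powr (- 1 / 2) * (l2_inner nu h e * snd p +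
        W (\<lambda>x. h x - l2_inner nu h e * e x) (fst p))) \<in> borel_measurable (P \<Otimes>\<^sub>M lborel)" by measurable
  qed
  define F0 F1 where "F0 y = ennreal ((T y)\<^sup>2)" and "F1 y = ennreal ((T y - \<epsilon>)\<^sup>2)" for y
  have [measurable]: "F0 \<in> borel_measurable data_space" "F1 \<in> borel_measurable data_space"
    unfolding F0_def F1_def by measurable
  let ?k = "\<lambda>\<xi> :: real. indicator {0..1} \<xi> * ennreal (std_normal_density 1)"
  have Fm[measurable]: "(\<lambda>p. F0 (\<Psi> (snd p) (fst p))) \<in> borel_measurable (P \<Otimes>\<^sub>M lborel)"
      "(\<lambda>p. F1 (\<Psi> (snd p) (fst p))) \<in> borel_measurable (P \<Otimes>\<^sub>M lborel)"
    using \<Psi> by measurable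
  have Fm1: "(\<lambda>\<xi>. F0 (\<Psi> \<xi> \<omega>)) \<in> borel_measurable borel" "(\<lambda>\<xi>. F1 (\<Psi> \<xi> \<omega>)) \<in> borel_measurable borel"
    if "\<omega> \<in> space P" for \<omega>
    using measurable_compose[OF measurable_Pair1'[OF that] Fm(1)] measurable_compose[OF measurable_Pair1'[OF that] Fm(2)]
    by simp_all
  have A: "(\<integral>\<^sup>+\<omega>. \<integral>\<^sup>+\<xi>. F0 (\<Psi> \<xi> \<omega>) * ?k \<xi> \<partial>lborel \<partial>P) \<le> (\<integral>\<^sup>+\<omega>. F0 (observation W n f0 \<omega>) \<partial>P)"
  proof -
    have "(\<integral>\<^sup>+\<omega>. F0 (observation W n f0 \<omega>) \<partial>P) = (\<integral>\<^sup>+\<omega>. \<integral>\<^sup>+\<xi>. F0 (\<Psi> (\<xi> + 0) \<omega>) \<partial>SN \<partial>P)"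
      using nn_integral_observation[OF W n e e1, of f0 "\<lambda>h. l2_inner nu h (radon f0)" 0 F0] by (simp add: \<Psi>_def)
    moreover have "(\<integral>\<^sup>+\<omega>. \<integral>\<^sup>+\<xi>. F0 (\<Psi> \<xi> \<omega>) * ?k \<xi> \<partial>lborel \<partial>P) \<le> (\<integral>\<^sup>+\<omega>. \<integral>\<^sup>+\<xi>. F0 (\<Psi> (\<xi> + 0) \<omega>) \<partial>SN \<partial>P)"
      by (intro nn_integral_mono nn_integral_SN_shift_ge Fm1) auto
    ultimately show ?thesis by simp
  qed
  have B: "(\<integral>\<^sup>+\<omega>. \<integral>\<^sup>+\<xi>. F1 (\<Psi> \<xi> \<omega>) * ?k \<xi> \<partial>lborel \<partial>P) \<le> (\<integral>\<^sup>+\<omega>. F1 (observation W n f1 \<omega>) \<partial>P)"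
  proof -
    have "(\<integral>\<^sup>+\<omega>. F1 (observation W n f1 \<omega>) \<partial>P) = (\<integral>\<^sup>+\<omega>. \<integral>\<^sup>+\<xi>. F1 (\<Psi> (\<xi> + sqrt (real n) * m) \<omega>) \<partial>SN \<partial>P)"
      using nn_integral_observation[OF W n e e1 shift, of F1] by (simp add: \<Psi>_def)
    moreover have "(\<integral>\<^sup>+\<omega>. \<integral>\<^sup>+\<xi>. F1 (\<Psi> \<xi> \<omega>) * ?k \<xi> \<partial>lborel \<partial>P) \<le> (\<integral>\<^sup>+\<omega>. \<integral>\<^sup>+\<xi>. F1 (\<Psi> (\<xi> + sqrt (real n) * m) \<omega>) \<partial>SN \<partial>P)"
      using m by (intro nn_integral_mono nn_integral_SN_shift_ge Fm1) auto
    ultimately show ?thesis by simp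
  qed
  have Fk: "F0 y + F1 y \<ge> ennreal (\<epsilon>\<^sup>2 / 2)" for y
  proof -
    \<comment> \<open>Completing the square: the worst value of \<open>T\<close> is the midpoint of
      0 and \<epsilon>.\<close>
    have "(T y)\<^sup>2 + (T y - \<epsilon>)\<^sup>2 = 2 * (T y - \<epsilon> / 2)\<^sup>2 + \<epsilon>\<^sup>2 / 2"
      by (simp add: power2_eq_square field_simps)
    then have "\<epsilon>\<^sup>2 / 2 \<le> (T y)\<^sup>2 + (T y - \<epsilon>)\<^sup>2" by simp
    then show ?thesis unfolding F0_def F1_def by (simp add: ennreal_leI flip: ennreal_plus)
  qed
  have "ennreal (\<epsilon>\<^sup>2 / 2 * std_normal_density 1) = (\<integral>\<^sup>+\<omega>. \<integral>\<^sup>+\<xi>. ennreal (\<epsilon>\<^sup>2 / 2) * ?k \<xi> \<partial>lborel \<partial>P)"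
  proof -
    have "(\<integral>\<^sup>+\<xi>. ennreal (\<epsilon>\<^sup>2 / 2) * ?k \<xi> \<partial>lborel) = (\<integral>\<^sup>+\<xi>. ennreal (\<epsilon>\<^sup>2 / 2 * std_normal_density 1) * indicator {0..1 :: real} \<xi> \<partial>lborel)"
      by (intro nn_integral_cong) (auto split: split_indicator simp flip: ennreal_mult)
    also have "\<dots> = ennreal (\<epsilon>\<^sup>2 / 2 * std_normal_density 1)"
      by (subst nn_integral_cmult_indicator) auto
    finally show ?thesis by (simp add: P.emeasure_space_1)
  qed
  also have "\<dots> \<le> (\<integral>\<^sup>+\<omega>. \<integral>\<^sup>+\<xi>. (F0 (\<Psi> \<xi> \<omega>) + F1 (\<Psi> \<xi> \<omega>)) * ?k \<xi> \<partial>lborel \<partial>P)"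
    by (intro nn_integral_mono mult_right_mono Fk) auto
  also have "\<dots> = (\<integral>\<^sup>+\<omega>. (\<integral>\<^sup>+\<xi>. F0 (\<Psi> \<xi> \<omega>) * ?k \<xi> \<partial>lborel) + (\<integral>\<^sup>+\<xi>. F1 (\<Psi> \<xi> \<omega>) * ?k \<xi> \<partial>lborel) \<partial>P)"
    using Fm1 by (intro nn_integral_cong) (simp add: distrib_right nn_integral_add)
  also have "\<dots> = (\<integral>\<^sup>+\<omega>. \<integral>\<^sup>+\<xi>. F0 (\<Psi> \<xi> \<omega>) * ?k \<xi> \<partial>lborel \<partial>P) + (\<integral>\<^sup>+\<omega>. \<integral>\<^sup>+\<xi>. F1 (\<Psi> \<xi> \<omega>) * ?k \<xi> \<partial>lborel \<partial>P)"
  proof (rule nn_integral_add)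
    have "(\<lambda>(\<omega>, \<xi>). F0 (\<Psi> \<xi> \<omega>) * ?k \<xi>) \<in> borel_measurable (P \<Otimes>\<^sub>M lborel)"
      "(\<lambda>(\<omega>, \<xi>). F1 (\<Psi> \<xi> \<omega>) * ?k \<xi>) \<in> borel_measurable (P \<Otimes>\<^sub>M lborel)"
      unfolding case_prod_beta' by measurable
    then show "(\<lambda>\<omega>. \<integral>\<^sup>+\<xi>. F0 (\<Psi> \<xi> \<omega>) * ?k \<xi> \<partial>lborel) \<in> borel_measurable P"
      "(\<lambda>\<omega>. \<integral>\<^sup>+\<xi>. F1 (\<Psi> \<xi> \<omega>) * ?k \<xi> \<partial>lborel) \<in> borel_measurable P"
      by (auto intro: lborel.borel_measurable_nn_integral)
  qed
  also have "\<dots> \<le> (\<integral>\<^sup>+\<omega>. F0 (observation W n f0 \<omega>) \<partial>P) + (\<integral>\<^sup>+\<omega>. F1 (observation W n f1 \<omega>) \<partial>P)"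
    by (intro add_mono A B)
  finally show ?thesis by (simp add: F0_def F1_def)
qed

section \<open>Averaging over the hypercube of hypotheses\<close>

lemma sum_Pow_pairs:
  assumes "finite I" "i \<in> I"
  shows "(\<Sum>S\<in>Pow I. R S) = (\<Sum>S\<in>Pow (I - {i}). R S + (R (insert i S) :: ennreal))"
proof -
  have "(\<Sum>S\<in>Pow I. R S) = (\<Sum>S\<in>Pow (insert i (I - {i})). R S)" using assms by (simp add: insert_absorb)
  also have "\<dots> = (\<Sum>S\<in>Pow (I - {i}). R S) + (\<Sum>S\<in>insert i ` Pow (I - {i}). R S)"
    unfolding Pow_insert using assms by (intro sum.union_disjoint) auto
  also have "(\<Sum>S\<in>insert i ` Pow (I - {i}). R S) = (\<Sum>S\<in>Pow (I - {i}). R (insert i S))"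
    by (subst sum.reindex) (auto simp: inj_on_def)
  finally show ?thesis by (simp add: sum.distrib)
qed

text \<open>Double counting over the subsets of \<open>I\<close>: each coordinate has 2^(card I - 1)
  edges, each contributing at least \<kappa>, against 2^(card I) vertices with total at most
  \<open>B\<close> each. Hence the factor 2.\<close>

lemma assouad:
  fixes R :: "'i \<Rightarrow> 'i set \<Rightarrow> ennreal"
  assumes I: "finite I"
    and le: "\<And>i S. i \<in> I \<Longrightarrow> S \<subseteq> I - {i} \<Longrightarrow> \<kappa> \<le> R i S + R i (insert i S)"
    and sup: "\<And>S. S \<subseteq> I \<Longrightarrow> (\<Sum>i\<in>I. R i S) \<le> B"
  shows "of_nat (card I) * \<kappa> \<le> 2 * B"
proof (cases "I = {}")
  case False
  then obtain c where c: "card I = Suc c" using I by (metis card_0_eq not0_implies_Suc)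
  have "of_nat (card I) * (of_nat (2 ^ c) * \<kappa>) = (\<Sum>i\<in>I. \<Sum>S\<in>Pow (I - {i}). \<kappa>)"
    using I c by (simp add: card_Pow)
  also have "\<dots> \<le> (\<Sum>i\<in>I. \<Sum>S\<in>Pow (I - {i}). R i S + R i (insert i S))"
    by (intro sum_mono le) auto
  also have "\<dots> = (\<Sum>i\<in>I. \<Sum>S\<in>Pow I. R i S)"
    using I by (intro sum.cong refl sum_Pow_pairs[symmetric])
  also have "\<dots> = (\<Sum>S\<in>Pow I. \<Sum>i\<in>I. R i S)" by (rule sum.swap)
  also have "\<dots> \<le> (\<Sum>S\<in>Pow I. B)" by (intro sum_mono sup) auto
  also have "\<dots> = of_nat (2 ^ c) * (2 * B)" using I c by (simp add: card_Pow mult_ac)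
  finally have "of_nat (2 ^ c) * (of_nat (card I) * \<kappa>) \<le> of_nat (2 ^ c) * (2 * B)" by (simp only: mult_ac)
  moreover have "(of_nat (2 ^ c) :: ennreal) \<noteq> 0" "(of_nat (2 ^ c) :: ennreal) \<noteq> top"
    by (simp_all add: power_eq_top_ennreal)
  ultimately show ?thesis by (subst (asm) ennreal_mult_le_mult_iff) auto
qed simp

text \<open>Coefficient functionals are continuous by Cauchy-Schwarz. This lets a function-valued
  estimator be reduced to real statistics.\<close>

lemma l2_borel_inner_measurable:
  assumes z: "z \<in> L2 M"
  shows "(\<lambda>f. l2_inner M f z) \<in> borel_measurable (l2_borel M)"
proof (rule borel_measurableI)
  fix S :: "real set" assume S: "open S"
  have sub: "{U. l2_open M U} \<subseteq> Pow (L2 M)" by (auto simp: l2_open_def)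
  have sp: "space (l2_borel M) = L2 M" unfolding l2_borel_def by (rule space_measure_of[OF sub])
  have "l2_open M ((\<lambda>f. l2_inner M f z) -` S \<inter> L2 M)"
    unfolding l2_open_def
  proof (intro conjI ballI)
    fix f assume f: "f \<in> (\<lambda>f. l2_inner M f z) -` S \<inter> L2 M"
    then obtain r where r: "r > 0" "\<And>y. dist y (l2_inner M f z) < r \<Longrightarrow> y \<in> S"
      using S by (auto simp: open_dist)
    \<comment> \<open>The added 1 covers the case that \<open>z\<close> has norm 0.\<close>
    define e where "e = r / (l2_norm M z + 1)"
    have pos: "l2_norm M z + 1 > 0" using l2_norm_nonneg[of M z] by linarith
    show "\<exists>e>0. \<forall>g\<in>L2 M. l2_dist M g f < e \<longrightarrow> g \<in> (\<lambda>f. l2_inner M f z) -` S \<inter> L2 M"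
    proof (intro exI[of _ e] conjI ballI impI)
      show "e > 0" using r pos by (simp add: e_def)
      fix g assume g: "g \<in> L2 M" and d: "l2_dist M g f < e"
      have "\<bar>l2_inner M g z - l2_inner M f z\<bar> = \<bar>l2_inner M (\<lambda>x. g x - f x) z\<bar>"
        using f g z by (simp add: l2_inner_diff)
      also have "\<dots> \<le> l2_dist M g f * l2_norm M z"
        unfolding l2_dist_def using f g z by (intro l2_cauchy_schwarz L2_diff) auto
      also have "\<dots> \<le> l2_dist M g f * (l2_norm M z + 1)"
        by (intro mult_left_mono) (auto simp: l2_dist_def l2_norm_nonneg)
      also have "\<dots> < e * (l2_norm M z + 1)"
        using d pos by (intro mult_strict_right_mono)
      also have "\<dots> = r" using pos by (simp add: e_def)
      finally show "g \<in> (\<lambda>f. l2_inner M f z) -` S \<inter> L2 M"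
        using r(2) g by (simp add: dist_real_def)
    qed
  qed auto
  then show "(\<lambda>f. l2_inner M f z) -` S \<inter> space (l2_borel M) \<in> sets (l2_borel M)"
    unfolding sp by (simp add: l2_borel_def sets_measure_of[OF sub] sigma_sets.Basic)
qed

lemma estimator_L2: "g \<in> estimators \<Longrightarrow> y \<in> space data_space \<Longrightarrow> g y \<in> L2 disk"
proof -
  assume g: "g \<in> estimators" "y \<in> space data_space"
  have "{U. l2_open disk U} \<subseteq> Pow (L2 disk)" by (auto simp: l2_open_def)
  then have "space (l2_borel disk) = L2 disk" unfolding l2_borel_def by (rule space_measure_of)
  then show ?thesis using measurable_space[of g data_space "l2_borel disk" y] g by (simp add: estimators_def)
qed

lemma observation_measurable:
  assumes "white_noise P W" shows "observation W n f \<in> measurable P data_space"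
  unfolding observation_def data_space_def
proof (rule measurable_restrict)
  fix h assume "h \<in> L2 nu"
  then have [measurable]: "W h \<in> borel_measurable P" by (rule white_noise_measurable[OF assms])
  show "(\<lambda>\<omega>. l2_inner nu h (radon f) + real n powr (- 1 / 2) * W h \<omega>) \<in> borel_measurable P"
    by measurable
qed

section \<open>Finite Zernike sums\<close>

definition zernike_sum :: "(nat \<times> nat) set \<Rightarrow> (nat \<times> nat \<Rightarrow> real) \<Rightarrow> real \<times> real \<Rightarrow> real" where
  "zernike_sum I c = (\<lambda>x. \<Sum>i\<in>I. c i * zernike i x)"

lemma zernike_sum_L2: "zernike_sum I c \<in> L2 disk"
  unfolding zernike_sum_def by (intro L2_sum L2_scale zernike_L2)

lemma l2_inner_zernike_sum_left:
  assumes "f \<in> L2 disk" shows "l2_inner disk (zernike_sum I c) f = (\<Sum>i\<in>I. c i * l2_inner disk (zernike i) f)"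
  unfolding zernike_sum_def using assms by (subst l2_inner_sum) (auto intro: L2_scale zernike_L2 simp: l2_inner_scale)

lemma l2_inner_zernike_sum_zernike:
  assumes "finite I" shows "l2_inner disk (zernike_sum I c) (zernike j) = (if j \<in> I then c j else 0)"
  unfolding l2_inner_zernike_sum_left[OF zernike_L2] using assms
  by (simp add: zernike_orthonormal if_distrib[of "\<lambda>z. _ * z"] cong: if_cong)

lemma l2_inner_zernike_sum_zernike_sum:
  assumes "finite I" shows "l2_inner disk (zernike_sum I c) (zernike_sum I d) = (\<Sum>i\<in>I. c i * d i)"
proof -
  have "l2_inner disk (zernike_sum I c) (zernike_sum I d) = (\<Sum>i\<in>I. c i * l2_inner disk (zernike_sum I d) (zernike i))"
    unfolding l2_inner_zernike_sum_left[OF zernike_sum_L2] by (simp add: l2_inner_commute)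
  then show ?thesis using assms by (simp add: l2_inner_zernike_sum_zernike)
qed

text \<open>Bounds the sum of the coordinatewise losses by the full loss, as the averaging argument
  demands.\<close>

lemma bessel_zernike:
  assumes f: "f \<in> L2 disk" and I: "finite I"
  shows "(\<Sum>i\<in>I. (l2_inner disk f (zernike i))\<^sup>2) \<le> (l2_norm disk f)\<^sup>2"
proof -
  define c where "c i = l2_inner disk f (zernike i)" for i
  let ?p = "zernike_sum I c"
  have fp: "l2_inner disk ?p f = (\<Sum>i\<in>I. (c i)\<^sup>2)"
    unfolding l2_inner_zernike_sum_left[OF f] by (simp add: c_def l2_inner_commute power2_eq_square)
  have pp: "l2_inner disk ?p ?p = (\<Sum>i\<in>I. (c i)\<^sup>2)"
    by (simp add: l2_inner_zernike_sum_zernike_sum[OF I] power2_eq_square)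
  have "0 \<le> l2_inner disk (\<lambda>x. f x - ?p x) (\<lambda>x. f x - ?p x)" by (rule l2_inner_self_nonneg)
  also have "\<dots> = l2_inner disk f f - l2_inner disk f ?p - (l2_inner disk ?p f - l2_inner disk ?p ?p)"
    by (simp only: l2_inner_diff[OF f zernike_sum_L2 L2_diff[OF f zernike_sum_L2]] l2_inner_diff_right[OF f zernike_sum_L2 f]
        l2_inner_diff_right[OF f zernike_sum_L2 zernike_sum_L2])
  also have "\<dots> = l2_inner disk f f - (\<Sum>i\<in>I. (c i)\<^sup>2)"
    unfolding l2_inner_commute[of disk f ?p] fp pp by simp
  finally show ?thesis by (simp add: c_def l2_norm_sq)
qed

lemma zernike_sum_in_ellipsoid:
  assumes I: "finite I" "I \<subseteq> index_set" and le: "(\<Sum>i\<in>I. (a i)\<^sup>2 * (c i)\<^sup>2) \<le> L\<^sup>2"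
  shows "zernike_sum I c \<in> ellipsoid a L"
proof -
  define \<theta> where "\<theta> i = (if i \<in> I then c i else 0)" for i
  have sum: "((\<lambda>i. (a i)\<^sup>2 * (\<theta> i)\<^sup>2) has_sum (\<Sum>i\<in>I. (a i)\<^sup>2 * (c i)\<^sup>2)) index_set"
  proof -
    have "((\<lambda>i. (a i)\<^sup>2 * (c i)\<^sup>2) has_sum (\<Sum>i\<in>I. (a i)\<^sup>2 * (c i)\<^sup>2)) I"
      using I by (intro has_sum_finite)
    then show ?thesis
      using I by (subst has_sum_cong_neutral[where T = I and g = "\<lambda>i. (a i)\<^sup>2 * (c i)\<^sup>2"]) (auto simp: \<theta>_def)
  qed
  \<comment> \<open>Once a finite set of indices contains \<open>I\<close>, the partial sum equals
    the function itself, so the convergence is trivial.\<close>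
  have "\<forall>\<^sub>F F in finite_subsets_at_top index_set. l2_dist disk (\<lambda>x. \<Sum>i\<in>F. \<theta> i * zernike i x) (zernike_sum I c) = 0"
    unfolding eventually_finite_subsets_at_top
  proof (intro exI[of _ I] conjI allI impI)
    fix F assume F: "finite F \<and> I \<subseteq> F \<and> F \<subseteq> index_set"
    have "(\<Sum>i\<in>F. \<theta> i * zernike i x) = zernike_sum I c x" for x
      unfolding zernike_sum_def using F by (intro sum.mono_neutral_cong_right) (auto simp: \<theta>_def)
    then show "l2_dist disk (\<lambda>x. \<Sum>i\<in>F. \<theta> i * zernike i x) (zernike_sum I c) = 0"
      by (simp add: l2_dist_def l2_norm_def l2_inner_def)
  qed (use I in auto)
  then have "l2_has_sum disk (\<lambda>i x. \<theta> i * zernike i x) index_set (zernike_sum I c)"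
    unfolding l2_has_sum_def by (rule tendsto_eventually)
  then show ?thesis
    unfolding ellipsoid_def using sum le zernike_sum_L2
    by (auto intro!: exI[of _ \<theta>] simp: has_sum_imp_summable infsumI)
qed

text \<open>Condition \<open>c1\<close> puts every hypothesis into the ellipsoid: there are
  \<open>m^2\<close> indices, all of degree below 4m. Condition \<open>c2\<close> keeps the shift
  caused by one index within one standard deviation, since every eigenvalue involved is at most pi^2
  / m.\<close>

lemma risk_lower_bound:
  assumes W: "white_noise P W" and n: "n > 0" and m: "m > 0" and \<epsilon>: "\<epsilon> \<ge> 0"
    and a: "\<And>j k. (j, k) \<noteq> (0, 0) \<Longrightarrow> 0 \<le> a (j, k) \<and> a (j, k) \<le> C1 * real (j + k) powr s"
    and s: "s > 0" and C1: "C1 > 0"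
    and c1: "(real m)\<^sup>2 * ((C1 * (4 * real m) powr s)\<^sup>2 * \<epsilon>\<^sup>2) \<le> L\<^sup>2"
    and c2: "real n * \<epsilon>\<^sup>2 * pi\<^sup>2 / real m \<le> 1"
    and g: "g \<in> estimators"
  shows "ennreal ((real m)\<^sup>2 * (\<epsilon>\<^sup>2 / 2 * std_normal_density 1)) \<le> 2 * (SUP f\<in>ellipsoid a L. risk P W n g f)"
proof -
  define I where "I = {m..<2 * m} \<times> {m..<2 * m}"
  have I: "finite I" "I \<subseteq> index_set" "card I = m\<^sup>2"
    using m by (auto simp: I_def index_set_def power2_eq_square)
  define f where "f S = zernike_sum S (\<lambda>_. \<epsilon>)" for S
  define T where "T i y = l2_inner disk (g y) (zernike i)" for i y
  define R where "R i S = (\<integral>\<^sup>+\<omega>. ennreal ((T i (observation W n (f S) \<omega>) - (if i \<in> S then \<epsilon> else 0))\<^sup>2) \<partial>P)" for i S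
  have T[measurable]: "T i \<in> borel_measurable data_space" for i
    unfolding T_def using g l2_borel_inner_measurable[OF zernike_L2]
    by (auto simp: estimators_def intro: measurable_compose)
  have [measurable]: "observation W n f \<in> measurable P data_space" for f
    by (rule observation_measurable[OF W])
  have "of_nat (card I) * ennreal (\<epsilon>\<^sup>2 / 2 * std_normal_density 1) \<le> 2 * (SUP f\<in>ellipsoid a L. risk P W n g f)"
  proof (rule assouad[where R = R])
    show "finite I" by (rule I)
  next
    fix i S assume i: "i \<in> I" and S: "S \<subseteq> I - {i}"
    have fS: "finite S" "i \<notin> S" using finite_subset[OF S] I(1) S by auto
    define b where "b = sqrt (eigval i)"
    have ev: "eigval i > 0" by (simp add: eigval_def)
    then have b: "b > 0" "b * b = eigval i" by (simp_all add: b_def)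
    \<comment> \<open>The normalized image of \<open>zernike i\<close>; toggling index
      \<open>i\<close> displaces the transform by \<epsilon> times the singular value
      \<open>b\<close> in this direction.\<close>
    define e where "e = (\<lambda>p. 1 / b * radon (zernike i) p)"
    have e: "e \<in> L2 nu" unfolding e_def by (intro L2_scale radon_zernike_L2)
    have e1: "l2_inner nu e e = 1"
      unfolding e_def l2_inner_scale l2_inner_scale_right radon_zernike_adjoint[OF zernike_L2]
      using b ev by (simp add: zernike_orthonormal)
    have rf: "radon (f S) = (\<lambda>p. \<Sum>i\<in>S. \<epsilon> * radon (zernike i) p)" if "finite S" for S
      unfolding f_def zernike_sum_def using radon_sum_zernike[OF that, of "\<lambda>_. \<epsilon>"] by auto
    have rL: "(\<lambda>p. \<Sum>i\<in>S. \<epsilon> * radon (zernike i) p) \<in> L2 nu" by (intro L2_sum L2_scale radon_zernike_L2)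
    have shift: "l2_inner nu h (radon (f (insert i S))) = l2_inner nu h (radon (f S)) + (\<epsilon> * b) * l2_inner nu h e" if h: "h \<in> L2 nu" for h
    proof -
      have "radon (f (insert i S)) = (\<lambda>p. (\<Sum>i\<in>S. \<epsilon> * radon (zernike i) p) + (\<epsilon> * b) * e p)"
        using fS b rf[of "insert i S"] by (simp add: e_def add.commute)
      then have "l2_inner nu h (radon (f (insert i S))) = l2_inner nu (\<lambda>p. (\<Sum>i\<in>S. \<epsilon> * radon (zernike i) p) + (\<epsilon> * b) * e p) h"
        by (simp add: l2_inner_commute)
      also have "\<dots> = l2_inner nu (\<lambda>p. \<Sum>i\<in>S. \<epsilon> * radon (zernike i) p) h + l2_inner nu (\<lambda>p. (\<epsilon> * b) * e p) h"
        by (rule l2_inner_add[OF rL L2_scale[OF e] h])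
      also have "l2_inner nu (\<lambda>p. (\<epsilon> * b) * e p) h = (\<epsilon> * b) * l2_inner nu e h"
        by (rule l2_inner_scale)
      finally show ?thesis by (simp only: rf[OF fS(1)] l2_inner_commute[of nu h])
    qed
    have m0: "0 \<le> sqrt (real n) * (\<epsilon> * b)" using \<epsilon> b by simp
    have "(sqrt (real n) * (\<epsilon> * b))\<^sup>2 = real n * \<epsilon>\<^sup>2 * eigval i"
      unfolding b(2)[symmetric] by (simp add: power2_eq_square power_mult_distrib)
    also have "\<dots> \<le> real n * \<epsilon>\<^sup>2 * (pi\<^sup>2 / real m)"
    proof -
      have "real m \<le> real (deg i) + 1" using i by (auto simp: I_def)
      then show ?thesis using m unfolding eigval_def by (intro mult_left_mono divide_left_mono) auto
    qed
    also have "\<dots> \<le> 1" using c2 by simp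
    finally have "(sqrt (real n) * (\<epsilon> * b))\<^sup>2 \<le> 1\<^sup>2" by (simp only: one_power2)
    then have m1: "sqrt (real n) * (\<epsilon> * b) \<le> 1" by (rule power2_le_imp_le) simp
    have "ennreal (\<epsilon>\<^sup>2 / 2 * std_normal_density 1) \<le>
        (\<integral>\<^sup>+\<omega>. ennreal ((T i (observation W n (f S) \<omega>))\<^sup>2) \<partial>P) + (\<integral>\<^sup>+\<omega>. ennreal ((T i (observation W n (f (insert i S)) \<omega>) - \<epsilon>)\<^sup>2) \<partial>P)"
      by (rule two_point_lower_bound[OF W n e e1 shift m0 m1 T])
    then show "ennreal (\<epsilon>\<^sup>2 / 2 * std_normal_density 1) \<le> R i S + R i (insert i S)"
      using fS by (simp add: R_def)
  next
    fix S assume S: "S \<subseteq> I"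
    then have fS: "finite S" using I finite_subset by blast
    have "f S \<in> ellipsoid a L"
      unfolding f_def
    proof (rule zernike_sum_in_ellipsoid[OF fS])
      show "S \<subseteq> index_set" using S I by blast
      have "(\<Sum>i\<in>S. (a i)\<^sup>2 * \<epsilon>\<^sup>2) \<le> (\<Sum>i\<in>I. (a i)\<^sup>2 * \<epsilon>\<^sup>2)"
        using S I by (intro sum_mono2) auto
      also have "\<dots> \<le> (\<Sum>i\<in>I. (C1 * (4 * real m) powr s)\<^sup>2 * \<epsilon>\<^sup>2)"
      proof (intro sum_mono mult_right_mono power_mono)
        fix i assume "i \<in> I"
        then obtain j k where i: "i = (j, k)" "m \<le> j" "j < 2 * m" "m \<le> k" "k < 2 * m"
          by (auto simp: I_def)
        have "C1 * real (j + k) powr s \<le> C1 * (4 * real m) powr s"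
          using i C1 s by (intro mult_left_mono powr_mono2) auto
        then show "a i \<le> C1 * (4 * real m) powr s" "0 \<le> a i"
          using a[of j k] i m by auto
      qed simp
      also have "\<dots> = (real m)\<^sup>2 * ((C1 * (4 * real m) powr s)\<^sup>2 * \<epsilon>\<^sup>2)" by (simp add: I)
      also have "\<dots> \<le> L\<^sup>2" by (rule c1)
      finally show "(\<Sum>i\<in>S. (a i)\<^sup>2 * \<epsilon>\<^sup>2) \<le> L\<^sup>2" .
    qed
    have "(\<Sum>i\<in>I. R i S) = (\<integral>\<^sup>+\<omega>. (\<Sum>i\<in>I. ennreal ((T i (observation W n (f S) \<omega>) - (if i \<in> S then \<epsilon> else 0))\<^sup>2)) \<partial>P)"
      unfolding R_def by (intro nn_integral_sum[symmetric]) measurable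
    also have "\<dots> \<le> risk P W n g (f S)"
      unfolding risk_def
    proof (intro nn_integral_mono)
      fix \<omega>
      let ?y = "observation W n (f S) \<omega>"
      have gy: "g ?y \<in> L2 disk" by (rule estimator_L2[OF g observation_in_space])
      have fL: "f S \<in> L2 disk" unfolding f_def by (rule zernike_sum_L2)
      have T_eq: "T i ?y - (if i \<in> S then \<epsilon> else 0) = l2_inner disk (\<lambda>x. g ?y x - f S x) (zernike i)" for i
        unfolding T_def l2_inner_diff[OF gy fL zernike_L2] by (simp add: f_def l2_inner_zernike_sum_zernike[OF fS])
      have "(\<Sum>i\<in>I. ennreal ((T i ?y - (if i \<in> S then \<epsilon> else 0))\<^sup>2)) =
          ennreal (\<Sum>i\<in>I. (l2_inner disk (\<lambda>x. g ?y x - f S x) (zernike i))\<^sup>2)"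
        unfolding T_eq by (intro sum_ennreal) auto
      also have "\<dots> \<le> ennreal ((l2_dist disk (g ?y) (f S))\<^sup>2)"
        unfolding l2_dist_def by (intro ennreal_leI bessel_zernike L2_diff gy fL I)
      finally show "(\<Sum>i\<in>I. ennreal ((T i ?y - (if i \<in> S then \<epsilon> else 0))\<^sup>2)) \<le> ennreal ((l2_dist disk (g ?y) (f S))\<^sup>2)" .
    qed
    also have "\<dots> \<le> (SUP f\<in>ellipsoid a L. risk P W n g f)"
      by (rule SUP_upper) fact
    finally show "(\<Sum>i\<in>I. R i S) \<le> (SUP f\<in>ellipsoid a L. risk P W n g f)" .
  qed
  moreover have "ennreal ((real m)\<^sup>2 * (\<epsilon>\<^sup>2 / 2 * std_normal_density 1)) =
      of_nat (card I) * ennreal (\<epsilon>\<^sup>2 / 2 * std_normal_density 1)"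
    unfolding I(3) ennreal_of_nat_eq_real_of_nat of_nat_power by (rule ennreal_mult) auto
  ultimately show ?thesis by (simp only:)
qed

text \<open>Writing n = x^(2s+3) turns all rates into powers of x. The resolution M is x rounded up,
  so it lies between x and 2x, and \<epsilon> = q * M^(-s-1) satisfies the ellipsoid and the noise
  condition together.\<close>

lemma minimax_lower_rate:
  assumes W: "white_noise P W" and L: "L > 0" and s: "s > 0" and C1: "C1 > 0"
    and a: "\<And>j k. (j, k) \<noteq> (0, 0) \<Longrightarrow> 0 \<le> a (j, k) \<and> a (j, k) \<le> C1 * real (j + k) powr s"
  obtains \<kappa> where "\<kappa> > 0"
    "\<And>n g. n > 0 \<Longrightarrow> g \<in> estimators \<Longrightarrow>
       ennreal (\<kappa> * real n powr (- (2 * s / (2 * s + 3)))) \<le> (SUP f\<in>ellipsoid a L. risk P W n g f)"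
proof -
  \<comment> \<open>The first bound serves membership in the ellipsoid, with 4 from degrees below
    4m; the second gives \<open>q * pi\<close> at most 1, which limits the shift.\<close>
  define q where "q = min (L / (C1 * 4 powr s)) (1 / pi)"
  have q: "q > 0" "q \<le> L / (C1 * 4 powr s)" "q \<le> 1 / pi" using L C1 by (simp_all add: q_def)
  \<comment> \<open>The power of 2 pays for M up to 2x; the 4 collects the factor 1/2 of the
    two-point bound and the factor 2 of the averaging argument.\<close>
  define \<kappa> where "\<kappa> = q\<^sup>2 * 2 powr (- (2 * s)) * std_normal_density 1 / 4"
  have sn: "std_normal_density 1 > 0" by (simp add: normal_density_pos)
  have "\<kappa> > 0" using q sn by (simp add: \<kappa>_def)
  moreover have "ennreal (\<kappa> * real n powr (- (2 * s / (2 * s + 3)))) \<le> (SUP f\<in>ellipsoid a L. risk P W n g f)"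
    if n: "n > 0" and g: "g \<in> estimators" for n g
  proof -
    define x where "x = real n powr (1 / (2 * s + 3))"
    have x1: "x \<ge> 1" using n s by (simp add: x_def ge_one_powr_ge_zero)
    have nx: "real n = x powr (2 * s + 3)" using n s by (simp add: x_def powr_powr)
    have rx: "real n powr (- (2 * s / (2 * s + 3))) = x powr (- (2 * s))"
      using n s by (simp add: x_def powr_powr)
    define m where "m = nat \<lceil>x\<rceil>"
    define M where "M = real m"
    have M: "x \<le> M" "M \<le> 2 * x" "M \<ge> 1" using x1 unfolding M_def m_def by linarith+
    have m: "m > 0" using M(3) by (simp add: M_def)
    define \<epsilon> where "\<epsilon> = q * M powr (- (s + 1))"
    have \<epsilon>: "\<epsilon> \<ge> 0" using q by (simp add: \<epsilon>_def)
    have p1: "M * M powr (- (s + 1)) = M powr (- s)"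
    proof -
      have "M * M powr (- (s + 1)) = M powr 1 * M powr (- (s + 1))" using M by simp
      also have "\<dots> = M powr (- s)" unfolding powr_add[symmetric] by simp
      finally show ?thesis .
    qed
    have p2: "M powr s * M powr (- s) = 1" unfolding powr_add[symmetric] using M by simp
    have c1: "M\<^sup>2 * ((C1 * (4 * M) powr s)\<^sup>2 * \<epsilon>\<^sup>2) \<le> L\<^sup>2"
    proof -
      have "M\<^sup>2 * ((C1 * (4 * M) powr s)\<^sup>2 * \<epsilon>\<^sup>2) = (C1 * 4 powr s * q * (M powr s * (M * M powr (- (s + 1)))))\<^sup>2"
        using M by (simp add: \<epsilon>_def powr_mult power_mult_distrib mult_ac)
      also have "\<dots> = (C1 * 4 powr s * q)\<^sup>2" unfolding p1 p2 by simp
      also have "\<dots> \<le> L\<^sup>2"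
      proof (rule power_mono)
        show "C1 * 4 powr s * q \<le> L" using q C1 by (simp add: field_simps)
      qed (use C1 q in simp)
      finally show ?thesis .
    qed
    have c2: "real n * \<epsilon>\<^sup>2 * pi\<^sup>2 / M \<le> 1"
    proof -
      have "real n \<le> M powr (2 * s + 3)" unfolding nx using M x1 s by (intro powr_mono2) auto
      have "(M powr (- (s + 1)))\<^sup>2 / M = M powr (- (s + 1)) * M powr (- (s + 1)) * M powr (- 1)"
        using M by (simp add: power2_eq_square powr_minus_divide)
      also have "\<dots> = M powr (- (2 * s + 3))" unfolding powr_add[symmetric] by (simp add: algebra_simps)
      finally have pm: "(M powr (- (s + 1)))\<^sup>2 / M = M powr (- (2 * s + 3))" .
      have "real n * \<epsilon>\<^sup>2 * pi\<^sup>2 / M = (q * pi)\<^sup>2 * (real n * ((M powr (- (s + 1)))\<^sup>2 / M))"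
        by (simp add: \<epsilon>_def power_mult_distrib)
      also have "\<dots> \<le> 1 * (M powr (2 * s + 3) * M powr (- (2 * s + 3)))"
        unfolding pm
      proof (intro mult_mono)
        have "q * pi \<le> 1" "0 \<le> q * pi" using q by (simp_all add: field_simps)
        then show "(q * pi)\<^sup>2 \<le> 1" by (rule power_le_one[rotated])
      qed (use \<open>real n \<le> M powr (2 * s + 3)\<close> in auto)
      also have "\<dots> = 1" unfolding powr_add[symmetric] using M by simp
      finally show ?thesis .
    qed
    have "ennreal (M\<^sup>2 * (\<epsilon>\<^sup>2 / 2 * std_normal_density 1)) \<le> 2 * (SUP f\<in>ellipsoid a L. risk P W n g f)"
      unfolding M_def
      by (rule risk_lower_bound[OF W n m \<epsilon> a s C1 c1[unfolded M_def] c2[unfolded M_def] g])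
    moreover have "2 * (\<kappa> * x powr (- (2 * s))) \<le> M\<^sup>2 * (\<epsilon>\<^sup>2 / 2 * std_normal_density 1)"
    proof -
      have "M\<^sup>2 * \<epsilon>\<^sup>2 = q\<^sup>2 * (M powr (- s))\<^sup>2"
        unfolding p1[symmetric] by (simp add: \<epsilon>_def power_mult_distrib)
      also have "(M powr (- s))\<^sup>2 = M powr (- (2 * s))"
        by (simp add: power2_eq_square flip: powr_add)
      finally have e: "M\<^sup>2 * \<epsilon>\<^sup>2 = q\<^sup>2 * M powr (- (2 * s))" .
      have "2 powr (- (2 * s)) * x powr (- (2 * s)) = (2 * x) powr (- (2 * s))" using x1 by (simp add: powr_mult)
      also have "\<dots> \<le> M powr (- (2 * s))" using M s by (intro powr_mono2') auto
      finally have "q\<^sup>2 * (2 powr (- (2 * s)) * x powr (- (2 * s))) \<le> M\<^sup>2 * \<epsilon>\<^sup>2"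
        unfolding e by (intro mult_left_mono) auto
      from mult_right_mono[OF this, of "std_normal_density 1 / 2"] sn show ?thesis
        by (simp add: \<kappa>_def mult_ac)
    qed
    ultimately have "ennreal (2 * (\<kappa> * x powr (- (2 * s)))) \<le> 2 * (SUP f\<in>ellipsoid a L. risk P W n g f)"
      by (meson ennreal_leI order_trans)
    moreover have "ennreal (2 * (\<kappa> * x powr (- (2 * s)))) = 2 * ennreal (\<kappa> * x powr (- (2 * s)))"
      using \<open>\<kappa> > 0\<close> by (subst ennreal_mult) auto
    ultimately have "ennreal (\<kappa> * x powr (- (2 * s))) \<le> (SUP f\<in>ellipsoid a L. risk P W n g f)"
      by (simp add: ennreal_mult_le_mult_iff)
    then show ?thesis unfolding rx .
  qed
  ultimately show ?thesis by (rule that)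
qed

lemma minimax_liminf_pos:
  assumes W: "white_noise P W" and L: "L > 0" and s: "s > 0" and C1: "C1 > 0"
    and a: "\<And>j k. (j, k) \<noteq> (0, 0) \<Longrightarrow> 0 \<le> a (j, k) \<and> a (j, k) \<le> C1 * real (j + k) powr s"
  shows "liminf (\<lambda>n. ennreal (real n powr (2 * s / (2 * s + 3))) *
              (INF g\<in>estimators. SUP f\<in>ellipsoid a L. risk P W n g f)) > 0"
proof -
  obtain \<kappa> where \<kappa>: "\<kappa> > 0" and le: "\<And>n g. n > 0 \<Longrightarrow> g \<in> estimators \<Longrightarrow>
       ennreal (\<kappa> * real n powr (- (2 * s / (2 * s + 3)))) \<le> (SUP f\<in>ellipsoid a L. risk P W n g f)"
    using minimax_lower_rate[OF assms] by blast
  let ?r = "2 * s / (2 * s + 3)"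
  have "ennreal \<kappa> \<le> liminf (\<lambda>n. ennreal (real n powr ?r) * (INF g\<in>estimators. SUP f\<in>ellipsoid a L. risk P W n g f))"
  proof (rule Liminf_bounded)
    show "\<forall>\<^sub>F n in sequentially. ennreal \<kappa> \<le> ennreal (real n powr ?r) * (INF g\<in>estimators. SUP f\<in>ellipsoid a L. risk P W n g f)"
      using eventually_gt_at_top[of 0]
    proof eventually_elim
      fix n :: nat assume n: "0 < n"
      have "real n powr ?r * (\<kappa> * real n powr (- ?r)) = \<kappa> * (real n powr ?r * real n powr (- ?r))" by simp
      also have "\<dots> = \<kappa>" unfolding powr_add[symmetric] using n by simp
      finally have "ennreal \<kappa> = ennreal (real n powr ?r * (\<kappa> * real n powr (- ?r)))" by (simp only:)
      also have "\<dots> = ennreal (real n powr ?r) * ennreal (\<kappa> * real n powr (- ?r))"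
        using \<kappa> by (intro ennreal_mult) auto
      also have "\<dots> \<le> ennreal (real n powr ?r) * (INF g\<in>estimators. SUP f\<in>ellipsoid a L. risk P W n g f)"
        by (intro mult_left_mono INF_greatest le n) auto
      finally show "ennreal \<kappa> \<le> ennreal (real n powr ?r) * (INF g\<in>estimators. SUP f\<in>ellipsoid a L. risk P W n g f)" .
    qed
  qed
  moreover have "0 < ennreal \<kappa>" using \<kappa> by simp
  ultimately show ?thesis by (rule less_le_trans[rotated])
qed

section \<open>The upper bound\<close>

text \<open>Lets one representative of a class replace another within inner products, so that no
  statement about values almost everywhere is involved.\<close>

lemma l2_dist_zero_inner:
  assumes f: "f \<in> L2 M" and g: "g \<in> L2 M" and h: "h \<in> L2 M" and d: "l2_dist M f g = 0"
  shows "l2_inner M f h = l2_inner M g h"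
proof -
  have "\<bar>l2_inner M (\<lambda>x. f x - g x) h\<bar> \<le> l2_norm M (\<lambda>x. f x - g x) * l2_norm M h"
    by (intro l2_cauchy_schwarz L2_diff f g h)
  also have "\<dots> = 0" using d by (simp add: l2_dist_def)
  finally show ?thesis using l2_inner_diff[OF f g h] by simp
qed

text \<open>The partial sums are constant once they contain all nonzero coefficients, so their limit
  says that \<open>f\<close> has distance 0 from a finite sum. Equality as functions cannot be
  expected.\<close>

lemma zernike_span_coeffs:
  assumes "f \<in> zernike_span M"
  obtains I c where "finite I" "I \<subseteq> {0..M} \<times> {0..M}" "f \<in> L2 disk" "l2_dist disk (zernike_sum I c) f = 0"
    "\<And>i. i \<notin> I \<Longrightarrow> c i = 0"
proof -
  obtain \<theta> where f: "f \<in> L2 disk" and \<theta>: "\<And>i. i \<notin> {0..M} \<times> {0..M} \<Longrightarrow> \<theta> i = 0"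
    and sum: "l2_has_sum disk (\<lambda>i x. \<theta> i * zernike i x) index_set f"
    using assms unfolding zernike_span_def by blast
  \<comment> \<open>The square contains (0, 0), which does not belong to the system and must be
    removed.\<close>
  define I where "I = {0..M} \<times> {0..M} \<inter> index_set"
  have I: "finite I" "I \<subseteq> index_set" by (auto simp: I_def)
  have "\<forall>\<^sub>F S in finite_subsets_at_top index_set. l2_dist disk (\<lambda>x. \<Sum>i\<in>S. \<theta> i * zernike i x) f = l2_dist disk (zernike_sum I \<theta>) f"
    unfolding eventually_finite_subsets_at_top
  proof (intro exI[of _ I] conjI allI impI)
    fix F assume F: "finite F \<and> I \<subseteq> F \<and> F \<subseteq> index_set"
    have "(\<lambda>x. \<Sum>i\<in>F. \<theta> i * zernike i x) = zernike_sum I \<theta>"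
      unfolding zernike_sum_def using F \<theta> by (intro ext sum.mono_neutral_right) (auto simp: I_def)
    then show "l2_dist disk (\<lambda>x. \<Sum>i\<in>F. \<theta> i * zernike i x) f = l2_dist disk (zernike_sum I \<theta>) f" by simp
  qed (use I in auto)
  with sum have "((\<lambda>S. l2_dist disk (zernike_sum I \<theta>) f) \<longlongrightarrow> 0) (finite_subsets_at_top index_set)"
    unfolding l2_has_sum_def by (rule Lim_transform_eventually)
  then have d: "l2_dist disk (zernike_sum I \<theta>) f = 0"
    by (simp add: tendsto_const_iff)
  define c where "c i = (if i \<in> I then \<theta> i else 0)" for i
  have "zernike_sum I c = zernike_sum I \<theta>" by (auto simp: zernike_sum_def c_def)
  with d have "l2_dist disk (zernike_sum I c) f = 0" by simp
  then show ?thesis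
    using I f by (intro that[of I c]) (auto simp: I_def c_def)
qed

section \<open>The operator \<open>Q_op\<close> on finite Zernike sums\<close>

lemma radon_zernike_sum: "finite I \<Longrightarrow> radon (zernike_sum I c) = (\<lambda>p. \<Sum>i\<in>I. c i * radon (zernike i) p)"
  unfolding zernike_sum_def using radon_sum_zernike by blast

lemma radon_zernike_sum_L2: "finite I \<Longrightarrow> radon (zernike_sum I c) \<in> L2 nu"
  by (simp only: radon_zernike_sum) (intro L2_sum L2_scale radon_zernike_L2)

lemma eigval_pos: "eigval i > 0"
  by (simp add: eigval_def)

text \<open>Dividing the coefficients by the eigenvalues inverts the normal operator. This provides
  the witness that gives the choice in \<open>radon_normal_inv\<close> its meaning.\<close>

lemma radon_adjoint_zernike_sum:
  assumes I: "finite I" and \<phi>: "\<phi> \<in> L2 disk" and d: "l2_dist disk (zernike_sum I c) \<phi> = 0"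
  shows "radon_adjoint (radon (zernike_sum I (\<lambda>i. c i / eigval i))) \<phi>"
  unfolding radon_adjoint_def
proof (intro conjI ballI)
  fix f assume f: "f \<in> L2 disk"
  have "l2_inner nu (radon f) (radon (zernike_sum I (\<lambda>i. c i / eigval i))) =
      (\<Sum>i\<in>I. (c i / eigval i) * l2_inner nu (radon f) (radon (zernike i)))"
    unfolding radon_zernike_sum[OF I] l2_inner_def
    by (simp add: sum_distrib_left mult.left_commute[of "radon f _"] integrable_radon_mult_zernike[OF f])
  also have "\<dots> = (\<Sum>i\<in>I. c i * l2_inner disk (zernike i) f)"
  proof (intro sum.cong refl)
    fix i
    show "(c i / eigval i) * l2_inner nu (radon f) (radon (zernike i)) = c i * l2_inner disk (zernike i) f"
      unfolding radon_zernike_adjoint[OF f] using eigval_pos[of i] by (simp add: l2_inner_commute)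
  qed
  also have "\<dots> = l2_inner disk (zernike_sum I c) f" by (rule l2_inner_zernike_sum_left[OF f, symmetric])
  also have "\<dots> = l2_inner disk \<phi> f" by (rule l2_dist_zero_inner[OF zernike_sum_L2 \<phi> f d])
  finally show "l2_inner nu (radon f) (radon (zernike_sum I (\<lambda>i. c i / eigval i))) = l2_inner disk f \<phi>"
    by (simp only: l2_inner_commute)
qed (use \<phi> radon_zernike_sum_L2[OF I] in auto)

text \<open>The chosen preimage need not be the explicit finite sum, so the adjoint relation is what
  is retained of it.\<close>

lemma Q_op_adjoint:
  assumes "\<phi> \<in> zernike_span M"
  shows "radon_normal_inv \<phi> \<in> L2 disk" "radon_adjoint (Q_op \<phi>) \<phi>"
proof -
  obtain I c where *: "finite I" "\<phi> \<in> L2 disk" "l2_dist disk (zernike_sum I c) \<phi> = 0"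
    using zernike_span_coeffs[OF assms] by metis
  have "\<exists>h. h \<in> L2 disk \<and> radon_adjoint (radon h) \<phi>"
    using radon_adjoint_zernike_sum[OF *] zernike_sum_L2 by blast
  then have "radon_normal_inv \<phi> \<in> L2 disk \<and> radon_adjoint (radon (radon_normal_inv \<phi>)) \<phi>"
    unfolding radon_normal_inv_def by (rule someI_ex)
  then show "radon_normal_inv \<phi> \<in> L2 disk" "radon_adjoint (Q_op \<phi>) \<phi>"
    by (simp_all add: Q_op_def)
qed

lemma Q_op_L2: "\<phi> \<in> zernike_span M \<Longrightarrow> Q_op \<phi> \<in> L2 nu"
  using Q_op_adjoint(2) by (auto simp: radon_adjoint_def)

lemma l2_inner_Q_op_radon:
  "\<phi> \<in> zernike_span M \<Longrightarrow> f \<in> L2 disk \<Longrightarrow> l2_inner nu (Q_op \<phi>) (radon f) = l2_inner disk f \<phi>"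
  using Q_op_adjoint(2) by (auto simp: radon_adjoint_def l2_inner_commute)

text \<open>The chosen preimages are eliminated by passing back and forth through the adjoint
  relation, with the explicit sum inserted on one side. The covariance of the noise is thereby
  diagonal in the coefficients, amplified by the inverse eigenvalues.\<close>

lemma l2_inner_Q_op:
  assumes I: "finite I" and \<phi>: "\<phi> \<in> zernike_span M" "l2_dist disk (zernike_sum I c) \<phi> = 0"
    and \<psi>: "\<psi> \<in> zernike_span M'" "l2_dist disk (zernike_sum I d) \<psi> = 0"
  shows "l2_inner nu (Q_op \<phi>) (Q_op \<psi>) = (\<Sum>i\<in>I. c i * d i / eigval i)"
proof -
  have L: "\<phi> \<in> L2 disk" "\<psi> \<in> L2 disk" using \<phi> \<psi> by (auto simp: zernike_span_def)
  let ?h = "radon_normal_inv \<phi>" and ?g = "zernike_sum I (\<lambda>i. d i / eigval i)"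
  have h: "?h \<in> L2 disk" by (rule Q_op_adjoint(1)[OF \<phi>(1)])
  have "l2_inner nu (Q_op \<phi>) (Q_op \<psi>) = l2_inner disk ?h \<psi>"
    using l2_inner_Q_op_radon[OF \<psi>(1) h] by (simp add: Q_op_def l2_inner_commute)
  also have "\<dots> = l2_inner nu (radon ?h) (radon ?g)"
    using radon_adjoint_zernike_sum[OF I L(2) \<psi>(2)] h by (simp add: radon_adjoint_def)
  also have "\<dots> = l2_inner nu (Q_op \<phi>) (radon ?g)" by (simp add: Q_op_def)
  also have "\<dots> = l2_inner disk ?g \<phi>" by (rule l2_inner_Q_op_radon[OF \<phi>(1) zernike_sum_L2])
  also have "\<dots> = l2_inner disk \<phi> ?g" by (rule l2_inner_commute)
  also have "\<dots> = l2_inner disk (zernike_sum I c) ?g"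
    by (rule l2_dist_zero_inner[OF zernike_sum_L2 L(1) zernike_sum_L2 \<phi>(2), symmetric])
  also have "\<dots> = (\<Sum>i\<in>I. c i * d i / eigval i)"
    by (simp add: l2_inner_zernike_sum_zernike_sum[OF I])
  finally show ?thesis .
qed

lemma zernike_sum_mono_neutral:
  assumes "finite J" "I \<subseteq> J" "\<And>i. i \<notin> I \<Longrightarrow> c i = 0"
  shows "zernike_sum I c = zernike_sum J c"
  unfolding zernike_sum_def using assms by (intro ext sum.mono_neutral_left) auto

text \<open>The price of ill-posedness: the inverse eigenvalue (deg + 1) / pi^2 is at most 2M + 1 on
  the span. The left side is left expanded because in this form it is the variance of the difference
  of two white noise integrals.\<close>

lemma Q_op_variance_le:
  assumes \<phi>: "\<phi> \<in> zernike_span M" and \<psi>: "\<psi> \<in> zernike_span M"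
  shows "l2_inner nu (Q_op \<phi>) (Q_op \<phi>) - 2 * l2_inner nu (Q_op \<phi>) (Q_op \<psi>) + l2_inner nu (Q_op \<psi>) (Q_op \<psi>)
     \<le> (2 * real M + 1) * (l2_dist disk \<phi> \<psi>)\<^sup>2"
proof -
  define J where "J = {0..M} \<times> {0..M}"
  have J: "finite J" by (simp add: J_def)
  obtain I c where c: "finite I" "I \<subseteq> J" "\<phi> \<in> L2 disk" "l2_dist disk (zernike_sum I c) \<phi> = 0" "\<And>i. i \<notin> I \<Longrightarrow> c i = 0"
    using zernike_span_coeffs[OF \<phi>] unfolding J_def by metis
  obtain I' d where d: "finite I'" "I' \<subseteq> J" "\<psi> \<in> L2 disk" "l2_dist disk (zernike_sum I' d) \<psi> = 0" "\<And>i. i \<notin> I' \<Longrightarrow> d i = 0"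
    using zernike_span_coeffs[OF \<psi>] unfolding J_def by metis
  have c0: "l2_dist disk (zernike_sum J c) \<phi> = 0" using c zernike_sum_mono_neutral[OF J c(2,5)] by simp
  have d0: "l2_dist disk (zernike_sum J d) \<psi> = 0" using d zernike_sum_mono_neutral[OF J d(2,5)] by simp
  note q = l2_inner_Q_op[OF J \<phi> c0 \<phi> c0] l2_inner_Q_op[OF J \<phi> c0 \<psi> d0] l2_inner_Q_op[OF J \<psi> d0 \<psi> d0]
  have "l2_inner nu (Q_op \<phi>) (Q_op \<phi>) - 2 * l2_inner nu (Q_op \<phi>) (Q_op \<psi>) + l2_inner nu (Q_op \<psi>) (Q_op \<psi>) =
     (\<Sum>i\<in>J. (c i - d i)\<^sup>2 / eigval i)"
    unfolding q sum_distrib_left sum_subtractf[symmetric] sum.distrib[symmetric]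
    by (intro sum.cong refl) (simp add: power2_eq_square add_divide_distrib diff_divide_distrib algebra_simps)
  also have "\<dots> \<le> (\<Sum>i\<in>J. (2 * real M + 1) * (c i - d i)\<^sup>2)"
  proof (intro sum_mono)
    fix i assume "i \<in> J"
    then have "real (deg i) + 1 \<le> 2 * real M + 1" by (auto simp: J_def)
    moreover have "1 \<le> pi\<^sup>2" using pi_gt3 by (simp add: one_le_power)
    then have "(real (deg i) + 1) / pi\<^sup>2 \<le> (real (deg i) + 1) / 1" by (intro divide_left_mono) auto
    ultimately have "(c i - d i)\<^sup>2 * ((real (deg i) + 1) / pi\<^sup>2) \<le> (c i - d i)\<^sup>2 * (2 * real M + 1)"
      by (intro mult_left_mono) auto
    then show "(c i - d i)\<^sup>2 / eigval i \<le> (2 * real M + 1) * (c i - d i)\<^sup>2"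
      by (simp add: eigval_def mult.commute)
  qed
  also have "\<dots> = (2 * real M + 1) * l2_inner disk (zernike_sum J (\<lambda>i. c i - d i)) (zernike_sum J (\<lambda>i. c i - d i))"
    by (simp add: l2_inner_zernike_sum_zernike_sum[OF J] sum_distrib_left power2_eq_square)
  also have "l2_inner disk (zernike_sum J (\<lambda>i. c i - d i)) (zernike_sum J (\<lambda>i. c i - d i)) = (l2_dist disk \<phi> \<psi>)\<^sup>2"
  proof -
    let ?a = "zernike_sum J c" and ?b = "zernike_sum J d"
    have z: "zernike_sum J (\<lambda>i. c i - d i) = (\<lambda>x. ?a x - ?b x)"
      by (simp add: zernike_sum_def left_diff_distrib sum_subtractf)
    have e1: "l2_inner disk (\<lambda>x. ?a x - ?b x) h = l2_inner disk (\<lambda>x. \<phi> x - \<psi> x) h" if h: "h \<in> L2 disk" for h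
      using l2_dist_zero_inner[OF zernike_sum_L2 c(3) h c0] l2_dist_zero_inner[OF zernike_sum_L2 d(3) h d0]
      by (simp add: l2_inner_diff[OF zernike_sum_L2 zernike_sum_L2 h] l2_inner_diff[OF c(3) d(3) h])
    have "l2_inner disk (\<lambda>x. ?a x - ?b x) (\<lambda>x. ?a x - ?b x) = l2_inner disk (\<lambda>x. ?a x - ?b x) (\<lambda>x. \<phi> x - \<psi> x)"
      using e1[OF L2_diff[OF zernike_sum_L2 zernike_sum_L2]] by (simp only: l2_inner_commute)
    also have "\<dots> = l2_inner disk (\<lambda>x. \<phi> x - \<psi> x) (\<lambda>x. \<phi> x - \<psi> x)"
      by (rule e1[OF L2_diff[OF c(3) d(3)]])
    finally show ?thesis unfolding z by (simp add: l2_dist_def l2_norm_sq)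
  qed
  finally show ?thesis .
qed

text \<open>Multiplying the density of variance v by exp(x^2 / (4v)) gives sqrt 2 times the density
  of variance 2v. For v = 0 division by zero makes the exponent 0, and 1 lies below the
  bound.\<close>

lemma normal_rv_exp_square:
  assumes P: "prob_space P" and X: "normal_rv P X 0 v" "v \<ge> 0"
  shows "(\<integral>\<^sup>+\<omega>. ennreal (exp ((X \<omega>)\<^sup>2 / v / 4)) \<partial>P) \<le> ennreal (sqrt 2)"
proof (cases "v = 0")
  case True
  interpret prob_space P by fact
  have "ennreal 1 \<le> ennreal (sqrt 2)" by (intro ennreal_leI) simp
  then show ?thesis using True by (simp add: emeasure_space_1)
next
  case False
  then have v: "v > 0" using X by simp
  define \<sigma> where "\<sigma> = sqrt v"
  have \<sigma>: "\<sigma> > 0" "\<sigma>\<^sup>2 = v" using v by (simp_all add: \<sigma>_def)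
  have D: "distributed P lborel X (\<lambda>x. ennreal (normal_density 0 \<sigma> x))"
    using X False by (simp add: normal_rv_def \<sigma>_def)
  have "(\<integral>\<^sup>+\<omega>. ennreal (exp ((X \<omega>)\<^sup>2 / v / 4)) \<partial>P) = (\<integral>\<^sup>+x. ennreal (normal_density 0 \<sigma> x) * ennreal (exp (x\<^sup>2 / v / 4)) \<partial>lborel)"
    by (rule distributed_nn_integral[OF D, symmetric]) simp
  also have "\<dots> = (\<integral>\<^sup>+x. ennreal (sqrt 2) * ennreal (normal_density 0 (sqrt 2 * \<sigma>) x) \<partial>lborel)"
  proof (intro nn_integral_cong)
    fix x :: real
    have "- x\<^sup>2 / (2 * v) + x\<^sup>2 / v / 4 = - x\<^sup>2 / (2 * (2 * v))" using v by (simp add: field_simps)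
    then have "exp (- x\<^sup>2 / (2 * v)) * exp (x\<^sup>2 / v / 4) = exp (- x\<^sup>2 / (2 * (2 * v)))"
      by (simp only: exp_add[symmetric])
    then have "normal_density 0 \<sigma> x * exp (x\<^sup>2 / v / 4) = sqrt 2 * normal_density 0 (sqrt 2 * \<sigma>) x"
      using v by (simp add: normal_density_def \<sigma> power_mult_distrib real_sqrt_mult field_simps)
    then show "ennreal (normal_density 0 \<sigma> x) * ennreal (exp (x\<^sup>2 / v / 4)) = ennreal (sqrt 2) * ennreal (normal_density 0 (sqrt 2 * \<sigma>) x)"
      by (simp add: normal_density_nonneg flip: ennreal_mult)
  qed
  also have "\<dots> = ennreal (sqrt 2) * (\<integral>\<^sup>+x. ennreal (normal_density 0 (sqrt 2 * \<sigma>) x) \<partial>lborel)"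
    by (rule nn_integral_cmult) simp
  also have "(\<integral>\<^sup>+x. ennreal (normal_density 0 (sqrt 2 * \<sigma>) x) \<partial>lborel) = 1"
  proof -
    have "prob_space (density lborel (normal_density 0 (sqrt 2 * \<sigma>)))"
      using \<sigma> by (intro prob_space_normal_density) simp
    from prob_space.emeasure_space_1[OF this] show ?thesis by (simp add: emeasure_density)
  qed
  finally show ?thesis by simp
qed

text \<open>With \<open>l\<close> the logarithm of the number of net elements, summing
  \<open>exp (x - l)\<close> over the net is averaging, so this replaces a maximum by a logarithm
  plus a term of bounded expectation.\<close>

lemma le_add_exp: "x \<le> l + exp (x - l)" for x l :: real
  using exp_ge_add_one_self[of "x - l"] by linarith

text \<open>Here \<open>D\<close> and \<open>D0\<close> are the squared losses of two elements of the net, \<open>E\<close> is their squared distance and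
  \<open>x\<close> the noise increment between them, of variance \<open>v\<close>; the part of \<open>x\<close> growing with \<open>E\<close> is absorbed
  on the left.\<close>

lemma basic_inequality:
  fixes D D0 E v x n B :: real
  assumes n: "n > 0" and B: "B > 0" and v: "0 \<le> v" "v = 0 \<Longrightarrow> x = 0"
    and D: "D \<le> D0 + 2 * n powr (- 1 / 2) * x"
    and vE: "v \<le> B * E" and E: "E \<le> 2 * D + 2 * D0"
  shows "D \<le> 3 * D0 + 8 * B / n * (x\<^sup>2 / v)"
proof -
  have pn: "(n powr (- 1 / 2))\<^sup>2 = 1 / n"
    using n by (simp add: powr_minus powr_half_sqrt power_inverse inverse_eq_divide power_divide)
  have "2 * n powr (- 1 / 2) * x \<le> E / 4 + 4 * B / n * (x\<^sup>2 / v)"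
  proof (cases "v = 0")
    case True
    then have "0 \<le> B * E" using vE by simp
    then have "E \<ge> 0" using B by (simp add: zero_le_mult_iff)
    then show ?thesis using True v by simp
  next
    case False
    then have v0: "v > 0" using v by simp
    \<comment> \<open>A weighted square bound: the weights are such that a^2 = v / (4B), at most E /
      4.\<close>
    define a b where "a = sqrt v / (2 * sqrt B)" and "b = 2 * sqrt B * n powr (- 1 / 2) * (x / sqrt v)"
    have "2 * n powr (- 1 / 2) * x = 2 * a * b" using v0 B by (simp add: a_def b_def)
    also have "\<dots> \<le> a\<^sup>2 + b\<^sup>2" by (rule sum_squares_bound)
    also have "a\<^sup>2 = v / (4 * B)" using v0 B by (simp add: a_def power_divide power_mult_distrib)
    also have "b\<^sup>2 = 4 * B * (1 / n) * (x\<^sup>2 / v)"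
      unfolding b_def power_mult_distrib pn using v0 B by (simp add: power_divide)
    also have "v / (4 * B) \<le> E / 4" using vE B by (simp add: field_simps)
    finally show ?thesis by simp
  qed
  then have "D \<le> D0 + (E / 4 + 4 * B / n * (x\<^sup>2 / v))"
    using D by (meson add_left_mono order_trans)
  then have D': "D \<le> D0 + (E / 4 + T)" if "T = 4 * B / n * (x\<^sup>2 / v)" for T using that by simp
  \<comment> \<open>E / 4 is at most D / 2 + D0 / 2; moving D / 2 to the left and doubling gives the
    constants 3 and 2.\<close>
  have "D \<le> 3 * D0 + 2 * T" if "T = 4 * B / n * (x\<^sup>2 / v)" for T
    using D'[OF that] E by linarith
  then show ?thesis by simp
qed

lemma l2_dist_sq_triangle:
  assumes f: "f \<in> L2 M" and g: "g \<in> L2 M" and h: "h \<in> L2 M"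
  shows "(l2_dist M f g)\<^sup>2 \<le> 2 * (l2_dist M f h)\<^sup>2 + 2 * (l2_dist M g h)\<^sup>2"
proof -
  have sq: "(l2_dist M f g)\<^sup>2 = (\<integral>x. (f x - g x)\<^sup>2 \<partial>M)" for f g
    unfolding l2_dist_def l2_norm_sq l2_inner_def by (simp add: power2_eq_square)
  have int: "integrable M (\<lambda>x. (f x - g x)\<^sup>2)" if "f \<in> L2 M" "g \<in> L2 M" for f g
    using L2_diff[OF that] by (simp add: L2_def)
  have "(\<integral>x. (f x - g x)\<^sup>2 \<partial>M) \<le> (\<integral>x. 2 * (f x - h x)\<^sup>2 + 2 * (g x - h x)\<^sup>2 \<partial>M)"
  proof (intro integral_mono)
    fix x
    have "2 * (f x - h x)\<^sup>2 + 2 * (g x - h x)\<^sup>2 - (f x - g x)\<^sup>2 = ((f x - h x) + (g x - h x))\<^sup>2"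
      by (simp add: power2_eq_square algebra_simps)
    then show "(f x - g x)\<^sup>2 \<le> 2 * (f x - h x)\<^sup>2 + 2 * (g x - h x)\<^sup>2"
      using zero_le_power2[of "(f x - h x) + (g x - h x)"] by linarith
  qed (use f g h int in auto)
  also have "\<dots> = 2 * (l2_dist M f h)\<^sup>2 + 2 * (l2_dist M g h)\<^sup>2"
    unfolding sq using int[OF f h] int[OF g h] by simp
  finally show ?thesis unfolding sq .
qed

text \<open>The signal part of the integral of \<open>Q_op \<phi>\<close> is the inner product of f
  and \<phi>, by the adjoint relation. Hence the criterion estimates the squared loss without bias
  up to a term free of \<phi>.\<close>

lemma empirical_risk_observation:
  assumes \<phi>: "\<phi> \<in> zernike_span M" and f: "f \<in> L2 disk"
  shows "empirical_risk (observation W n f \<omega>) \<phi> =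
    (l2_dist disk \<phi> f)\<^sup>2 - (l2_norm disk f)\<^sup>2 - 2 * real n powr (- 1 / 2) * W (Q_op \<phi>) \<omega>"
proof -
  have L: "\<phi> \<in> L2 disk" using \<phi> by (auto simp: zernike_span_def)
  have "(l2_dist disk \<phi> f)\<^sup>2 = l2_inner disk \<phi> \<phi> - 2 * l2_inner disk f \<phi> + l2_inner disk f f"
    unfolding l2_dist_def l2_norm_sq l2_inner_diff[OF L f L2_diff[OF L f]]
      l2_inner_diff_right[OF L f L] l2_inner_diff_right[OF L f f] l2_inner_commute[of disk \<phi> f] by simp
  then show ?thesis
    unfolding empirical_risk_def observation_def using Q_op_L2[OF \<phi>]
    by (simp add: l2_inner_Q_op_radon[OF \<phi> f] l2_norm_sq algebra_simps)
qed

text \<open>The minimizer is compared with an approximating net element \<phi>0. Its noise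
  increment, squared and divided by its variance, is controlled through exponential moments summed
  over the net. The factor 32 is the 8 of the basic inequality times 4, because the moment bound
  concerns a quarter of that ratio.\<close>

lemma net_estimator_risk:
  assumes W: "white_noise P W" and n: "n > 0" and fin: "finite N" and span: "N \<subseteq> zernike_span M"
    and g: "is_net_estimator N g" and f: "f \<in> L2 disk" and \<phi>0: "\<phi>0 \<in> N" "l2_dist disk f \<phi>0 \<le> \<delta>"
  shows "risk P W n g f \<le> ennreal (3 * \<delta>\<^sup>2 + 32 * (2 * real M + 1) / real n * (ln (real (card N)) + sqrt 2))"
proof -
  interpret P: prob_space P using W by (rule white_noise_prob)
  define B where "B = 2 * real M + 1"
  have B: "B > 0" by (simp add: B_def)
  define l where "l = ln (real (card N))"
  have card: "card N \<ge> 1" using fin \<phi>0(1) by (metis One_nat_def Suc_leI card_gt_0_iff empty_iff)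
  then have l: "l \<ge> 0" "exp (- l) = 1 / real (card N)" by (simp_all add: l_def exp_minus inverse_eq_divide)
  have sp: "\<phi> \<in> zernike_span M" if "\<phi> \<in> N" for \<phi> using span that by blast
  have NL: "\<phi> \<in> L2 disk" if "\<phi> \<in> N" for \<phi> using sp[OF that] by (simp add: zernike_span_def)
  have QL: "Q_op \<phi> \<in> L2 nu" if "\<phi> \<in> N" for \<phi> by (rule Q_op_L2[OF sp[OF that]])
  let ?D = "3 * \<delta>\<^sup>2 + 32 * B / real n * l"
  define X where "X \<phi> \<omega> = W (Q_op \<phi>) \<omega> - W (Q_op \<phi>0) \<omega>" for \<phi> \<omega>
  define v where "v \<phi> = l2_inner nu (Q_op \<phi>) (Q_op \<phi>) - 2 * l2_inner nu (Q_op \<phi>) (Q_op \<phi>0) + l2_inner nu (Q_op \<phi>0) (Q_op \<phi>0)" for \<phi>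
  have v0: "0 \<le> v \<phi>" if "\<phi> \<in> N" for \<phi>
  proof -
    note q = QL[OF that] QL[OF \<phi>0(1)]
    have "l2_inner nu (\<lambda>x. Q_op \<phi> x - Q_op \<phi>0 x) (\<lambda>x. Q_op \<phi> x - Q_op \<phi>0 x) = v \<phi>"
      unfolding v_def l2_inner_diff[OF q L2_diff[OF q]] l2_inner_diff_right[OF q q(1)] l2_inner_diff_right[OF q q(2)]
        l2_inner_commute[of nu "Q_op \<phi>0" "Q_op \<phi>"] by simp
    then show ?thesis using l2_inner_self_nonneg by metis
  qed
  have Xn: "normal_rv P (X \<phi>) 0 (v \<phi>)" if "\<phi> \<in> N" for \<phi>
    using white_noise_pair[OF W QL[OF that] QL[OF \<phi>0(1)], of 1 "- 1"] by (simp add: X_def[abs_def] v_def)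
  have Xm: "X \<phi> \<in> borel_measurable P" if "\<phi> \<in> N" for \<phi>
    using Xn[OF that] by (simp add: normal_rv_def)
  define Z where "Z \<phi> \<omega> = (X \<phi> \<omega>)\<^sup>2 / v \<phi>" for \<phi> \<omega>
  let ?t = "\<lambda>\<phi> \<omega>. (32 * B / real n * exp (- l)) * exp (Z \<phi> \<omega> / 4)"
  let ?T = "\<lambda>\<phi> \<omega>. ennreal (32 * B / real n * exp (- l)) * ennreal (exp (Z \<phi> \<omega> / 4))"
  have Zm: "(\<lambda>\<omega>. ennreal (exp (Z \<phi> \<omega> / 4))) \<in> borel_measurable P" if "\<phi> \<in> N" for \<phi>
  proof -
    have [measurable]: "X \<phi> \<in> borel_measurable P" by (rule Xm[OF that])
    show ?thesis unfolding Z_def by measurable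
  qed
  \<comment> \<open>Increments of variance 0 vanish almost surely; finiteness of the net permits a
    single null set for all of them.\<close>
  have "AE \<omega> in P. \<forall>\<phi>\<in>N. v \<phi> = 0 \<longrightarrow> X \<phi> \<omega> = 0"
    using fin
  proof (rule AE_finite_allI)
    fix \<phi> assume "\<phi> \<in> N"
    then show "AE \<omega> in P. v \<phi> = 0 \<longrightarrow> X \<phi> \<omega> = 0"
      using Xn[of \<phi>] by (cases "v \<phi> = 0") (auto simp: normal_rv_def)
  qed
  then have main: "AE \<omega> in P. ennreal ((l2_dist disk (g (observation W n f \<omega>)) f)\<^sup>2) \<le>
      ennreal ?D + (\<Sum>\<phi>\<in>N. ?T \<phi> \<omega>)"
  proof eventually_elim
    fix \<omega> assume deg: "\<forall>\<phi>\<in>N. v \<phi> = 0 \<longrightarrow> X \<phi> \<omega> = 0"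
    let ?y = "observation W n f \<omega>"
    define \<phi> where "\<phi> = g ?y"
    have arg: "is_arg_min (empirical_risk ?y) (\<lambda>\<phi>. \<phi> \<in> N) \<phi>"
      unfolding \<phi>_def
      by (rule bspec[OF conjunct2[OF g[unfolded is_net_estimator_def]] observation_in_space])
    then have \<phi>: "\<phi> \<in> N" and "\<not> empirical_risk ?y \<phi>0 < empirical_risk ?y \<phi>"
      using \<phi>0(1) by (auto simp: is_arg_min_def)
    then have "empirical_risk ?y \<phi> \<le> empirical_risk ?y \<phi>0" by simp
    then have D: "(l2_dist disk \<phi> f)\<^sup>2 \<le> (l2_dist disk \<phi>0 f)\<^sup>2 + 2 * real n powr (- 1 / 2) * X \<phi> \<omega>"
      unfolding empirical_risk_observation[OF sp[OF \<phi>] f] empirical_risk_observation[OF sp[OF \<phi>0(1)] f]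
      by (simp add: X_def right_diff_distrib)
    have vE: "v \<phi> \<le> B * (l2_dist disk \<phi> \<phi>0)\<^sup>2"
      unfolding v_def B_def by (rule Q_op_variance_le[OF sp[OF \<phi>] sp[OF \<phi>0(1)]])
    have E: "(l2_dist disk \<phi> \<phi>0)\<^sup>2 \<le> 2 * (l2_dist disk \<phi> f)\<^sup>2 + 2 * (l2_dist disk \<phi>0 f)\<^sup>2"
      by (rule l2_dist_sq_triangle[OF NL[OF \<phi>] NL[OF \<phi>0(1)] f])
    have "(l2_dist disk \<phi> f)\<^sup>2 \<le> 3 * (l2_dist disk \<phi>0 f)\<^sup>2 + 8 * B / real n * Z \<phi> \<omega>"
      unfolding Z_def using n deg \<phi> by (intro basic_inequality[OF _ B v0[OF \<phi>] _ D vE E]) auto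
    moreover have "(l2_dist disk \<phi>0 f)\<^sup>2 \<le> \<delta>\<^sup>2"
    proof (rule power_mono)
      have "l2_dist disk \<phi>0 f = l2_dist disk f \<phi>0"
        by (simp add: l2_dist_def l2_norm_def l2_inner_def algebra_simps)
      then show "l2_dist disk \<phi>0 f \<le> \<delta>" using \<phi>0(2) by simp
    qed (simp add: l2_dist_def l2_norm_nonneg)
    moreover have "8 * B / real n * Z \<phi> \<omega> \<le> 32 * B / real n * (l + (\<Sum>\<phi>\<in>N. exp (- l) * exp (Z \<phi> \<omega> / 4)))"
    proof -
      \<comment> \<open>The selected element depends on \<omega>, so its exponential is bounded by
        the sum over the entire net before expectations are taken.\<close>
      have "Z \<phi> \<omega> / 4 \<le> l + exp (Z \<phi> \<omega> / 4 - l)" by (rule le_add_exp)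
      also have "exp (Z \<phi> \<omega> / 4 - l) = exp (- l) * exp (Z \<phi> \<omega> / 4)" by (simp flip: exp_add)
      also have "\<dots> \<le> (\<Sum>\<phi>\<in>N. exp (- l) * exp (Z \<phi> \<omega> / 4))"
        using fin \<phi> by (intro member_le_sum) auto
      finally have "Z \<phi> \<omega> / 4 \<le> l + (\<Sum>\<phi>\<in>N. exp (- l) * exp (Z \<phi> \<omega> / 4))" by simp
      from mult_left_mono[OF this, of "32 * B / real n"] B show ?thesis by simp
    qed
    ultimately have "(l2_dist disk \<phi> f)\<^sup>2 \<le> ?D + (\<Sum>\<phi>\<in>N. ?t \<phi> \<omega>)"
      by (simp add: ring_distribs sum_distrib_left mult.assoc)
    then have "ennreal ((l2_dist disk \<phi> f)\<^sup>2) \<le> ennreal (?D + (\<Sum>\<phi>\<in>N. ?t \<phi> \<omega>))"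
      by (rule ennreal_leI)
    also have "\<dots> = ennreal (?D) + ennreal (\<Sum>\<phi>\<in>N. ?t \<phi> \<omega>)"
      using B l by (intro ennreal_plus sum_nonneg) auto
    also have "ennreal (\<Sum>\<phi>\<in>N. ?t \<phi> \<omega>) =
        (\<Sum>\<phi>\<in>N. ennreal (?t \<phi> \<omega>))"
      using B by (intro sum_ennreal[symmetric]) auto
    also have "\<dots> = (\<Sum>\<phi>\<in>N. ?T \<phi> \<omega>)"
      using B by (intro sum.cong refl ennreal_mult) auto
    finally show "ennreal ((l2_dist disk (g ?y) f)\<^sup>2) \<le>
      ennreal ?D + (\<Sum>\<phi>\<in>N. ?T \<phi> \<omega>)"
      unfolding \<phi>_def .
  qed
  have "risk P W n g f \<le> (\<integral>\<^sup>+\<omega>. ennreal (?D) +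
      (\<Sum>\<phi>\<in>N. ?T \<phi> \<omega>) \<partial>P)"
    unfolding risk_def by (rule nn_integral_mono_AE[OF main])
  also have "\<dots> = ennreal (?D) +
      (\<Sum>\<phi>\<in>N. ennreal (32 * B / real n * exp (- l)) * (\<integral>\<^sup>+\<omega>. ennreal (exp (Z \<phi> \<omega> / 4)) \<partial>P))"
  proof -
    have m: "(\<lambda>\<omega>. ?T \<phi> \<omega>) \<in> borel_measurable P" if "\<phi> \<in> N" for \<phi>
      using Zm[OF that] by measurable
    have "(\<integral>\<^sup>+\<omega>. (\<Sum>\<phi>\<in>N. ?T \<phi> \<omega>) \<partial>P) =
       (\<Sum>\<phi>\<in>N. \<integral>\<^sup>+\<omega>. ?T \<phi> \<omega> \<partial>P)"
      by (rule nn_integral_sum[OF m])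
    also have "\<dots> = (\<Sum>\<phi>\<in>N. ennreal (32 * B / real n * exp (- l)) * (\<integral>\<^sup>+\<omega>. ennreal (exp (Z \<phi> \<omega> / 4)) \<partial>P))"
      using Zm by (intro sum.cong refl nn_integral_cmult)
    finally show ?thesis
      using m by (subst nn_integral_add) (auto simp: P.emeasure_space_1)
  qed
  also have "\<dots> \<le> ennreal ?D + (\<Sum>\<phi>\<in>N. ennreal (32 * B / real n * exp (- l)) * ennreal (sqrt 2))"
    unfolding Z_def
    by (intro add_left_mono sum_mono mult_left_mono normal_rv_exp_square P.prob_space_axioms Xn v0) auto
  also have "(\<Sum>\<phi>\<in>N. ennreal (32 * B / real n * exp (- l)) * ennreal (sqrt 2)) = ennreal (32 * B / real n * sqrt 2)"
  proof -
    have "(\<Sum>\<phi>\<in>N. ennreal (32 * B / real n * exp (- l)) * ennreal (sqrt 2)) =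
       (\<Sum>\<phi>\<in>N. ennreal (32 * B / real n * exp (- l) * sqrt 2))"
      using B by (intro sum.cong refl ennreal_mult[symmetric]) auto
    also have "\<dots> = ennreal (\<Sum>\<phi>\<in>N. 32 * B / real n * exp (- l) * sqrt 2)"
      using B by (intro sum_ennreal) auto
    also have "(\<Sum>\<phi>\<in>N. 32 * B / real n * exp (- l) * sqrt 2) = 32 * B / real n * sqrt 2"
      using card by (simp add: l)
    finally show ?thesis .
  qed
  also have "ennreal (?D) + ennreal (32 * B / real n * sqrt 2) =
     ennreal (3 * \<delta>\<^sup>2 + 32 * B / real n * (l + sqrt 2))"
    using B l by (subst ennreal_plus[symmetric]) (auto simp: ring_distribs)
  finally show ?thesis by (simp add: B_def l_def)
qed

text \<open>With n = x^(2s+3) and \<delta> = x^(-s), the size conditions read M at most K x and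
  log-cardinality at most K' x^2. The stochastic term is then of order x^3 / n = x^(-2s), the same
  as the squared approximation error.\<close>

lemma net_estimator_limsup:
  assumes W: "white_noise P W" and s: "s > 0"
    and net: "net_family (ellipsoid a L) s K K' N"
    and est: "\<And>n. n > 0 \<Longrightarrow> is_net_estimator (N (real n powr (- s / (2 * s + 3)))) (fhat n)"
  shows "limsup (\<lambda>n. ennreal (real n powr (2 * s / (2 * s + 3))) *
              (SUP f\<in>ellipsoid a L. risk P W n (fhat n) f)) < \<infinity>"
proof -
  define \<delta> where "\<delta> n = real n powr (- s / (2 * s + 3))" for n
  let ?r = "2 * s / (2 * s + 3)"
  have \<delta>0: "\<delta> n > 0" if "n > 0" for n using that by (simp add: \<delta>_def)
  have "filterlim \<delta> (at_right 0) sequentially"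
    unfolding filterlim_at
  proof
    show "\<forall>\<^sub>F n in sequentially. \<delta> n \<in> {0<..} \<and> \<delta> n \<noteq> 0"
      using eventually_gt_at_top[of 0] by eventually_elim (simp add: \<delta>_def)
    have "- s / (2 * s + 3) < 0" using s by simp
    then show "\<delta> \<longlonglongrightarrow> 0"
      unfolding \<delta>_def[abs_def] by (intro tendsto_neg_powr filterlim_real_sequentially) auto
  qed
  moreover have "\<forall>\<^sub>F \<delta> in at_right 0.
        (\<exists>M. real M \<le> K * \<delta> powr (- 1 / s) \<and> N \<delta> \<subseteq> zernike_span M) \<and>
        ln (real (card (N \<delta>))) \<le> K' * \<delta> powr (- 2 / s)"
    using net by (simp add: net_family_def)
  ultimately have ev: "\<forall>\<^sub>F n in sequentially.
        (\<exists>M. real M \<le> K * \<delta> n powr (- 1 / s) \<and> N (\<delta> n) \<subseteq> zernike_span M) \<and>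
        ln (real (card (N (\<delta> n)))) \<le> K' * \<delta> n powr (- 2 / s)"
    unfolding filterlim_iff by blast
  \<comment> \<open>The 3 is the contribution of \<delta>^2. Absolute values appear because the
    signs of \<open>K\<close> and \<open>K'\<close> are unrestricted, and the added terms absorb the
    lower order parts of 2M + 1 and of the moment bound, as x is at least 1.\<close>
  define C where "C = 3 + 32 * (2 * \<bar>K\<bar> + 1) * (\<bar>K'\<bar> + sqrt 2)"
  have "limsup (\<lambda>n. ennreal (real n powr ?r) * (SUP f\<in>ellipsoid a L. risk P W n (fhat n) f)) \<le> ennreal C"
  proof (rule Limsup_bounded)
    show "\<forall>\<^sub>F n in sequentially. ennreal (real n powr ?r) * (SUP f\<in>ellipsoid a L. risk P W n (fhat n) f) \<le> ennreal C"
      using ev eventually_gt_at_top[of 0]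
    proof eventually_elim
      fix n :: nat
      assume sz: "(\<exists>M. real M \<le> K * \<delta> n powr (- 1 / s) \<and> N (\<delta> n) \<subseteq> zernike_span M) \<and>
        ln (real (card (N (\<delta> n)))) \<le> K' * \<delta> n powr (- 2 / s)" and n: "0 < n"
      define x where "x = real n powr (1 / (2 * s + 3))"
      have x1: "x \<ge> 1" using n s by (simp add: x_def ge_one_powr_ge_zero)
      have nx: "real n = x powr (2 * s + 3)" using n s by (simp add: x_def powr_powr)
      have \<delta>x: "\<delta> n = x powr (- s)" by (simp add: \<delta>_def x_def powr_powr)
      have d1: "\<delta> n powr (- 1 / s) = x" unfolding \<delta>x using s x1 by (simp add: powr_powr)
      have d2: "\<delta> n powr (- 2 / s) = x\<^sup>2" unfolding \<delta>x using s x1 by (simp add: powr_powr)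
      have rx: "real n powr ?r = x powr (2 * s)" by (simp add: x_def powr_powr)
      obtain M where M: "real M \<le> K * x" "N (\<delta> n) \<subseteq> zernike_span M" using sz unfolding d1 by blast
      define l where "l = ln (real (card (N (\<delta> n))))"
      have l: "l \<le> K' * x\<^sup>2" using sz unfolding d2 l_def by blast
      define b where "b = 3 * (\<delta> n)\<^sup>2 + 32 * (2 * real M + 1) / real n * (l + sqrt 2)"
      have dn: "is_delta_net (ellipsoid a L) (\<delta> n) (N (\<delta> n))" using net \<delta>0[OF n] by (simp add: net_family_def)
      have est_n: "is_net_estimator (N (\<delta> n)) (fhat n)" using est[OF n] by (simp add: \<delta>_def)
      have "risk P W n (fhat n) f \<le> ennreal b" if f: "f \<in> ellipsoid a L" for f
      proof -
        obtain \<phi>0 where "\<phi>0 \<in> N (\<delta> n)" "l2_dist disk f \<phi>0 \<le> \<delta> n"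
          using dn f unfolding is_delta_net_def by blast
        moreover have "finite (N (\<delta> n))" "f \<in> L2 disk" using dn f by (auto simp: is_delta_net_def ellipsoid_def)
        ultimately show ?thesis
          unfolding b_def l_def by (intro net_estimator_risk[OF W n _ M(2) est_n])
      qed
      then have "(SUP f\<in>ellipsoid a L. risk P W n (fhat n) f) \<le> ennreal b" by (rule SUP_least)
      then have "ennreal (real n powr ?r) * (SUP f\<in>ellipsoid a L. risk P W n (fhat n) f) \<le> ennreal (real n powr ?r) * ennreal b"
        by (rule mult_left_mono) simp
      also have "\<dots> = ennreal (real n powr ?r * b)" by (rule ennreal_mult'[symmetric]) simp
      also have "\<dots> \<le> ennreal C"
      proof (rule ennreal_leI)
        have p1: "x powr (2 * s) * (\<delta> n)\<^sup>2 = 1"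
          unfolding \<delta>x power2_eq_square powr_add[symmetric] using x1 by simp
        have p2: "x powr (2 * s) / real n = 1 / x ^ 3"
        proof -
          have "x powr (2 * s) / real n = x powr (2 * s - (2 * s + 3))" unfolding nx by (rule powr_diff[symmetric])
          also have "\<dots> = x powr (- 3)" by simp
          also have "\<dots> = 1 / x ^ 3" using x1 by (simp add: powr_minus_divide)
          finally show ?thesis .
        qed
        have "2 * real M + 1 \<le> (2 * \<bar>K\<bar> + 1) * x"
        proof -
          have "K * x \<le> \<bar>K\<bar> * x" using x1 by (intro mult_right_mono) auto
          moreover have "(2 * \<bar>K\<bar> + 1) * x = 2 * (\<bar>K\<bar> * x) + x" by (simp add: ring_distribs)
          ultimately show ?thesis using M(1) x1 by linarith
        qed
        moreover have "l + sqrt 2 \<le> (\<bar>K'\<bar> + sqrt 2) * x\<^sup>2"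
        proof -
          have "K' * x\<^sup>2 \<le> \<bar>K'\<bar> * x\<^sup>2" by (intro mult_right_mono) auto
          moreover have "sqrt 2 * 1 \<le> sqrt 2 * x\<^sup>2" using x1 by (intro mult_left_mono) (auto simp: one_le_power)
          ultimately show ?thesis using l unfolding distrib_right by linarith
        qed
        moreover have "0 \<le> (2 * \<bar>K\<bar> + 1) * x" using x1 by simp
        moreover have "0 \<le> 2 * real M + 1" by simp
        ultimately have "(2 * real M + 1) * (l + sqrt 2) \<le> ((2 * \<bar>K\<bar> + 1) * x) * ((\<bar>K'\<bar> + sqrt 2) * x\<^sup>2)"
          by (meson mult_left_mono mult_right_mono order_trans mult_nonneg_nonneg abs_ge_zero add_nonneg_nonneg real_sqrt_ge_zero zero_le_numeral zero_le_power2)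
        then have "32 * ((2 * real M + 1) * (l + sqrt 2)) / x ^ 3 \<le> 32 * (((2 * \<bar>K\<bar> + 1) * x) * ((\<bar>K'\<bar> + sqrt 2) * x\<^sup>2)) / x ^ 3"
          using x1 by (intro divide_right_mono) auto
        also have "\<dots> = 32 * (2 * \<bar>K\<bar> + 1) * (\<bar>K'\<bar> + sqrt 2)"
          using x1 by (simp add: power2_eq_square power3_eq_cube)
        finally have X: "32 * ((2 * real M + 1) * (l + sqrt 2)) / x ^ 3 \<le> 32 * (2 * \<bar>K\<bar> + 1) * (\<bar>K'\<bar> + sqrt 2)" .
        have gen: "r * (3 * e + 32 * A / k * c) = 3 * (r * e) + 32 * (A * c) * (r / k)" for r e A k c :: real
          by (simp add: distrib_left)
        have "real n powr ?r * b = 3 * (x powr (2 * s) * (\<delta> n)\<^sup>2) + 32 * ((2 * real M + 1) * (l + sqrt 2)) * (x powr (2 * s) / real n)"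
          unfolding rx b_def by (rule gen)
        also have "\<dots> = 3 + 32 * ((2 * real M + 1) * (l + sqrt 2)) / x ^ 3"
          unfolding p1 p2 by simp
        also have "\<dots> \<le> C" using X by (simp add: C_def)
        finally show "real n powr ?r * b \<le> C" .
      qed
      finally show "ennreal (real n powr ?r) * (SUP f\<in>ellipsoid a L. risk P W n (fhat n) f) \<le> ennreal C" .
    qed
  qed
  also have "\<dots> < \<infinity>" by simp
  finally show ?thesis .
qed

theorem corollary2:
  fixes P :: "'w measure"
    and W :: "(real \<times> real \<Rightarrow> real) \<Rightarrow> 'w \<Rightarrow> real"
    and a :: "nat \<times> nat \<Rightarrow> real"
    and L s C0 C1 :: real
    and d :: nat
  assumes "white_noise P W"
    and "L > 0" and "s > 0" and "C0 > 0" and "C1 > 0"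
    and "\<And>j k. (j, k) \<noteq> (0, 0) \<Longrightarrow>
           C0 * real (j + k) powr s \<le> a (j, k) \<and> a (j, k) \<le> C1 * real (j + k) powr s"
    and "d = 2"
  shows "(\<forall>K K' N fhat.
            net_family (ellipsoid a L) s K K' N \<and>
            (\<forall>n>0. is_net_estimator (N (real n powr (- s / (2 * s + 2 * real d - 1)))) (fhat n)) \<longrightarrow>
            limsup (\<lambda>n. ennreal (real n powr (2 * s / (2 * s + 2 * real d - 1))) *
              (SUP f\<in>ellipsoid a L. risk P W n (fhat n) f)) < \<infinity>) \<and>
         liminf (\<lambda>n. ennreal (real n powr (2 * s / (2 * s + 2 * real d - 1))) *
              (INF g\<in>estimators. SUP f\<in>ellipsoid a L. risk P W n g f)) > 0"
proof -
  have d: "2 * s + 2 * real d - 1 = 2 * s + 3" using \<open>d = 2\<close> by simp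
  have a: "0 \<le> a (j, k) \<and> a (j, k) \<le> C1 * real (j + k) powr s" if "(j, k) \<noteq> (0, 0)" for j k
  proof -
    have "0 \<le> C0 * real (j + k) powr s" using \<open>C0 > 0\<close> by simp
    then show ?thesis using assms(6)[OF that] by linarith
  qed
  show ?thesis
    unfolding d
  proof (intro conjI allI impI)
    fix K K' N fhat
    assume "net_family (ellipsoid a L) s K K' N \<and>
      (\<forall>n>0. is_net_estimator (N (real n powr (- s / (2 * s + 3)))) (fhat n))"
    then show "limsup (\<lambda>n. ennreal (real n powr (2 * s / (2 * s + 3))) *
              (SUP f\<in>ellipsoid a L. risk P W n (fhat n) f)) < \<infinity>"
      using net_estimator_limsup[OF assms(1) assms(3)] by blast
  next
    show "0 < liminf (\<lambda>n. ennreal (real n powr (2 * s / (2 * s + 3))) *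
              (INF g\<in>estimators. SUP f\<in>ellipsoid a L. risk P W n g f))"
      by (rule minimax_liminf_pos[OF assms(1-3) assms(5) a])
  qed
qed

end
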